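(* Assume Hypotheses (H) on the data $(\Omega,\Gamma^D,\Gamma^N,N_0,P_0,N^D,P^D,\Psi^D,m,M)$ (see context), and let $T>0$, $\xi>0$, $\beta>0$. Then there exists a constant $K_E$, depending only on $\Omega,T,m,M,N^D,P^D,\Psi^D,\beta$ and $\xi$, such that the following holds for every admissible mesh $\mathcal M=(\mathcal T,\mathcal E,\mathcal P)$ of $\Omega$ with $\mathrm d(x_K,\sigma)\ge\xi\,\mathrm{diam}(K)$ for all $K\in\mathcal T$, $\sigma\in\mathcal E_K$ and $\mathrm{card}(\mathcal E_K)\le\beta$ for all $K\in\mathcal T$, every $\Delta t>0$ and every $\lambda\ge0$ (where, if $\lambda=0$, it is assumed in addition that $P_0-N_0=0$ and $P^D-N^D=0$): every solution $(N_{\mathcal T}^n,P_{\mathcal T}^n,\Psi_{\mathcal T}^n)_{n\ge0}$ to the scheme $(\mathcal S_\lambda)$ satisfies $$\frac{\mathbb E^{n+1}-\mathbb E^n}{\Delta t}+\frac12\,\mathbb I^{n+1}\le K_E,\qquad\forall n\ge0.$$ Furthermore, if $N_0$ and $P_0$ satisfy the quasi-neutrality assumption $P_0-N_0=0$, then, with $N_T=\lfloor T/\Delta t\rfloor$, $$\sum_{n=0}^{N_T-1}\Delta t\,\mathbb I^{n+1}\le K_E(1+\lambda^2).$$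
   Context: **Hypotheses (H).** $\Omega$ is an open bounded subset of $\mathbb R^d$ ($d\ge1$), $\partial\Omega=\Gamma^D\cup\Gamma^N$ with $\Gamma^D\cap\Gamma^N=\emptyset$ and $\mathrm m(\Gamma^D)>0$. The boundary data $N^D,P^D,\Psi^D$ are traces of functions defined on all of $\Omega$, denoted the same way. Moreover $N_0,P_0\in L^\infty(\Omega)$, $N^D,P^D\in L^\infty(\Omega)\cap H^1(\Omega)$, $\Psi^D\in H^1(\Omega)$, and $m>0$, $M>0$ are constants such that $m\le N_0,P_0,N^D,P^D\le M$ a.e. on $\Omega$. **Admissible mesh.** $\mathcal M=(\mathcal T,\mathcal E,\mathcal P)$ where $\mathcal T$ is a finite family of pairwise disjoint open polygonal (polyhedral) convex subsets of $\Omega$ (control volumes), $\mathcal E$ is a finite family of edges (faces), i.e. subsets of $\overline\Omega$ contained in hyperplanes with positive $(d-1)$-dimensional measure, and $\mathcal P=(x_K)_{K\in\mathcal T}$ is a family of points, such that: the closure of the union of the control volumes is $\overline\Omega$; for each $K$ there is $\mathcal E_K\subset\mathcal E$ with $\partial K=\bigcup_{\sigma\in\mathcal E_K}\overline\sigma$, and $\mathcal E=\bigcup_K\mathcal E_K$; for $K\ne L$, either $\overline K\cap\overline L$ has zero $(d-1)$-measure or $\overline K\cap\overline L=\overline\sigma$ for some $\sigma\in\mathcal E$, then denoted $\sigma=K|L$; $x_K\in\overline K$, and if $\sigma=K|L$ then $x_K\neq x_L$ and the line through $x_K,x_L$ is orthogonal to $\sigma$; if $\sigma\in\mathcal E_K$,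 $\sigma\subset\partial\Omega$ and $x_K\notin\sigma$, the line through $x_K$ orthogonal to $\sigma$ meets $\sigma$. Edges are split as $\mathcal E=\mathcal E_{int}\cup\mathcal E_{ext}$ (interior edges $K|L$; edges in $\partial\Omega$), and $\mathcal E_{ext}=\mathcal E_{ext}^D\cup\mathcal E_{ext}^N$ (edges included in $\Gamma^D$, resp. $\Gamma^N$); likewise $\mathcal E_K=\mathcal E_{K,int}\cup\mathcal E_{K,ext}^D\cup\mathcal E_{K,ext}^N$. Set $\mathrm d_\sigma=\mathrm d(x_K,x_L)$ if $\sigma=K|L$, $\mathrm d_\sigma=\mathrm d(x_K,\sigma)$ if $\sigma\in\mathcal E_{ext}\cap\mathcal E_K$, and $\tau_\sigma=\mathrm m(\sigma)/\mathrm d_\sigma$, where $\mathrm m$ denotes Lebesgue measure in dimension $d$ or $d-1$ as appropriate. **Discrete vectors.** For $u_{\mathcal M}=((u_K)_{K\in\mathcal T},(u_\sigma)_{\sigma\in\mathcal E_{ext}^D})$, $K\in\mathcal T$, $\sigma\in\mathcal E_K$: $u_{K,\sigma}=u_L$ if $\sigma=K|L$, $u_{K,\sigma}=u_\sigma$ if $\sigma\in\mathcal E_{K,ext}^D$, $u_{K,\sigma}=u_K$ if $\sigma\in\mathcal E_{K,ext}^N$; $Du_{K,\sigma}=u_{K,\sigma}-u_K$; $D_\sigma u=|Du_{K,\sigma}|$; and $|u_{\mathcal M}|_{1,\mathcal M}^2=\sum_{\sigma\in\mathcal E}\tau_\sigma(D_\sigma u)^2$. Functions of discrete vectors (e.g.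 $\log N-\Psi$) are taken componentwise, on cells and on Dirichlet edges. **Scheme $(\mathcal S_\lambda)$.** $B(0)=1$, $B(x)=x/(e^x-1)$ for $x\ne0$. Initial values: $(N_K^0,P_K^0)=\frac1{\mathrm m(K)}\int_K(N_0,P_0)\,dx$. Boundary values, for $\sigma\in\mathcal E_{ext}^D$ and all $n\ge0$: $(N_\sigma^n,P_\sigma^n,\Psi_\sigma^n)=(N_\sigma^D,P_\sigma^D,\Psi_\sigma^D)=\frac1{\mathrm m(\sigma)}\int_\sigma(N^D,P^D,\Psi^D)\,d\gamma$. The equations, for all $K\in\mathcal T$, $n\ge0$, are $$\mathrm m(K)\frac{N_K^{n+1}-N_K^n}{\Delta t}+\sum_{\sigma\in\mathcal E_K}\mathcal F_{K,\sigma}^{n+1}=0,\qquad \mathrm m(K)\frac{P_K^{n+1}-P_K^n}{\Delta t}+\sum_{\sigma\in\mathcal E_K}\mathcal G_{K,\sigma}^{n+1}=0,$$ $$-\lambda^2\sum_{\sigma\in\mathcal E_K}\tau_\sigma D\Psi_{K,\sigma}^n=\mathrm m(K)(P_K^n-N_K^n),$$ with $$\mathcal F_{K,\sigma}^{n+1}=\tau_\sigma\big(B(-D\Psi_{K,\sigma}^{n+1})N_K^{n+1}-B(D\Psi_{K,\sigma}^{n+1})N_{K,\sigma}^{n+1}\big),$$ $$\mathcal G_{K,\sigma}^{n+1}=\tau_\sigma\big(B(D\Psi_{K,\sigma}^{n+1})P_K^{n+1}-B(-D\Psi_{K,\sigma}^{n+1})P_{K,\sigma}^{n+1}\big).$$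 For $\lambda=0$ (with $P_0=N_0$, $P^D=N^D$) the same system with $\lambda=0$ is equivalently: for all $K\in\mathcal T$, $n\ge0$, $$\mathrm m(K)\frac{N_K^{n+1}-N_K^n}{\Delta t}-\sum_{\sigma\in\mathcal E_K}\tau_\sigma\frac{B(D\Psi_{K,\sigma}^{n+1})+B(-D\Psi_{K,\sigma}^{n+1})}{2}DN_{K,\sigma}^{n+1}=0,$$ $$-\sum_{\sigma\in\mathcal E_K}\tau_\sigma D\Psi_{K,\sigma}^{n+1}(N_K^{n+1}+N_{K,\sigma}^{n+1})=0,\qquad P_K^n-N_K^n=0$$ (in this case $\Psi^0_K$ is not constrained). **Entropy and entropy production.** Set $(N_K^D,P_K^D,\Psi_K^D)=\frac1{\mathrm m(K)}\int_K(N^D,P^D,\Psi^D)\,dx$ for $K\in\mathcal T$, $\Psi^D_{\mathcal M}=((\Psi^D_K)_K,(\Psi^D_\sigma)_\sigma)$, $\Psi^n_{\mathcal M}=((\Psi^n_K)_K,(\Psi^D_\sigma)_\sigma)$, and $H(x)=x\log x-x+1$. Then (for positive densities, which is the case for solutions of the scheme) $$\mathbb E^n=\sum_{K\in\mathcal T}\mathrm m(K)\big(H(N_K^n)-H(N_K^D)-\log(N_K^D)(N_K^n-N_K^D)\big)$$ $$\qquad+\sum_{K\in\mathcal T}\mathrm m(K)\big(H(P_K^n)-H(P_K^D)-\log(P_K^D)(P_K^n-P_K^D)\big)+\frac{\lambda^2}{2}\big|\Psi_{\mathcal M}^n-\Psi_{\mathcal M}^D\big|_{1,\mathcal M}^2,$$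 $$\mathbb I^n=\sum_{\sigma\in\mathcal E}\tau_\sigma\Big[\min(N_K^n,N_{K,\sigma}^n)\big(D_\sigma(\log N^n-\Psi^n)\big)^2+\min(P_K^n,P_{K,\sigma}^n)\big(D_\sigma(\log P^n+\Psi^n)\big)^2\Big],$$ where in the last sum $K$ is any cell with $\sigma\in\mathcal E_K$ (the summand does not depend on the choice). *)

theory Defs
  imports "HOL-Analysis.Analysis"
begin

section \<open>Measures of dimension \<open>d - 1\<close>\<close>

text \<open>
  Lebesgue measure on the hyperplane \<open>{x. a \<bullet> x = c}\<close>, for a unit vector \<open>a\<close>: the measure of
  a subset \<open>A\<close> is the \<open>d\<close>-dimensional Lebesgue measure of the right cylinder of height \<open>1\<close> over \<open>A\<close>.
  For \<open>d = 1\<close> this is the Dirac measure at the point \<open>c *\<^sub>R a\<close>.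
\<close>

definition hyperplane_measure :: "'a::euclidean_space \<Rightarrow> real \<Rightarrow> 'a measure" where
  "hyperplane_measure a c =
     completion (distr (restrict_space lborel {x. c \<le> a \<bullet> x \<and> a \<bullet> x \<le> c + 1}) borel
       (\<lambda>x. x - (a \<bullet> x - c) *\<^sub>R a))"

definition in_hyperplane :: "'a::euclidean_space \<Rightarrow> real \<Rightarrow> 'a set \<Rightarrow> bool" where
  "in_hyperplane a c A \<longleftrightarrow> norm a = 1 \<and> A \<subseteq> {x. a \<bullet> x = c}"

text \<open>
  Surface measure for a set \<open>A\<close> contained in some hyperplane. If \<open>A\<close> lies in two different
  hyperplanes it has measure zero for both of them; \<open>(a, c)\<close> and \<open>(-a, -c)\<close> give the same measure.
\<close>

definition surface_measure :: "'a::euclidean_space set \<Rightarrow> 'a measure" where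
  "surface_measure A =
     (let (a, c) = (SOME (a, c). in_hyperplane a c A) in hyperplane_measure a c)"

definition face_area :: "'a::euclidean_space set \<Rightarrow> real" where
  "face_area A = measure (surface_measure A) A"

text \<open>
  The boundary of a general open set need not be flat; its parts are measured by the
  \<open>s\<close>-dimensional Hausdorff (outer) measure, with the usual normalisation under which it agrees with
  Lebesgue measure on \<open>s\<close>-dimensional affine subspaces. Since \<open>0 ^ 0 = 1\<close>, the case \<open>s = 0\<close> is
  the counting measure.
\<close>

definition hausdorff_measure :: "nat \<Rightarrow> 'a::euclidean_space set \<Rightarrow> ennreal" where
  "hausdorff_measure s A =
     (SUP \<delta>\<in>{0<..}.
        INF U\<in>{U :: nat \<Rightarrow> 'a set.
                A \<subseteq> (\<Union>i. U i) \<and> (\<forall>i. bounded (U i) \<and> diameter (U i) \<le> \<delta>)}.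
          (\<Sum>i. if U i = {} then 0
               else ennreal (unit_ball_vol (real s) * (diameter (U i) / 2) ^ s)))"


section \<open>Function spaces and traces\<close>

abbreviation pderivative :: "('a::euclidean_space \<Rightarrow> real) \<Rightarrow> 'a \<Rightarrow> 'a \<Rightarrow> real" where
  "pderivative f i \<equiv> (\<lambda>x. frechet_derivative f (at x) i)"

fun C_k :: "nat \<Rightarrow> ('a::euclidean_space \<Rightarrow> real) \<Rightarrow> bool" where
  "C_k 0 f \<longleftrightarrow> continuous_on UNIV f"
| "C_k (Suc k) f \<longleftrightarrow> (\<forall>x. f differentiable (at x)) \<and> (\<forall>i\<in>Basis. C_k k (pderivative f i))"

definition smooth_fun :: "('a::euclidean_space \<Rightarrow> real) \<Rightarrow> bool" where
  "smooth_fun f \<longleftrightarrow> (\<forall>k. C_k k f)"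

definition test_fun :: "'a::euclidean_space set \<Rightarrow> ('a \<Rightarrow> real) \<Rightarrow> bool" where
  "test_fun \<Omega> \<phi> \<longleftrightarrow>
     smooth_fun \<phi> \<and> compact (closure {x. \<phi> x \<noteq> 0}) \<and> closure {x. \<phi> x \<noteq> 0} \<subseteq> \<Omega>"

definition L2_on :: "'a measure \<Rightarrow> 'a set \<Rightarrow> ('a \<Rightarrow> real) \<Rightarrow> bool" where
  "L2_on \<mu> S f \<longleftrightarrow> set_borel_measurable \<mu> S f \<and> set_integrable \<mu> S (\<lambda>x. (f x)\<^sup>2)"

definition L2_tendsto :: "'a measure \<Rightarrow> 'a set \<Rightarrow> (nat \<Rightarrow> 'a \<Rightarrow> real) \<Rightarrow> ('a \<Rightarrow> real) \<Rightarrow> bool" where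
  "L2_tendsto \<mu> S v f \<longleftrightarrow>
     (\<forall>k. L2_on \<mu> S (\<lambda>x. v k x - f x)) \<and>
     (\<lambda>k. LINT x:S|\<mu>. (v k x - f x)\<^sup>2) \<longlonglongrightarrow> 0"

definition Linf_on :: "'a::euclidean_space set \<Rightarrow> ('a \<Rightarrow> real) \<Rightarrow> bool" where
  "Linf_on \<Omega> f \<longleftrightarrow>
     set_borel_measurable lebesgue \<Omega> f \<and> (\<exists>C. AE x in lebesgue. x \<in> \<Omega> \<longrightarrow> \<bar>f x\<bar> \<le> C)"

definition L2_weak_pderiv ::
  "'a::euclidean_space set \<Rightarrow> ('a \<Rightarrow> real) \<Rightarrow> 'a \<Rightarrow> ('a \<Rightarrow> real) \<Rightarrow> bool" where
  "L2_weak_pderiv \<Omega> u i g \<longleftrightarrow>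
     L2_on lebesgue \<Omega> g \<and>
     (\<forall>\<phi>. test_fun \<Omega> \<phi> \<longrightarrow>
        (LINT x:\<Omega>|lebesgue. u x * pderivative \<phi> i x) = - (LINT x:\<Omega>|lebesgue. g x * \<phi> x))"

definition H1_on :: "'a::euclidean_space set \<Rightarrow> ('a \<Rightarrow> real) \<Rightarrow> bool" where
  "H1_on \<Omega> u \<longleftrightarrow> L2_on lebesgue \<Omega> u \<and> (\<forall>i\<in>Basis. \<exists>g. L2_weak_pderiv \<Omega> u i g)"

text \<open>
  The trace operator is the continuous extension of the restriction to the boundary from functions
  that are smooth up to the boundary: \<open>g\<close> is the trace of \<open>u\<close> if some sequence of smooth functions
  converges to \<open>u\<close> in \<open>H\<^sup>1(\<Omega>)\<close> and to \<open>g\<close> in \<open>L\<^sup>2\<close> of the boundary. As only polyhedral domains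
  admit a mesh, \<open>L\<^sup>2\<close> convergence on the boundary is expressed on its intersection with each
  hyperplane.
\<close>

definition has_trace :: "'a::euclidean_space set \<Rightarrow> ('a \<Rightarrow> real) \<Rightarrow> ('a \<Rightarrow> real) \<Rightarrow> bool" where
  "has_trace \<Omega> u g \<longleftrightarrow>
     (\<exists>v. (\<forall>k. smooth_fun (v k)) \<and>
          L2_tendsto lebesgue \<Omega> v u \<and>
          (\<forall>i\<in>Basis. \<exists>w. L2_weak_pderiv \<Omega> u i w \<and>
             L2_tendsto lebesgue \<Omega> (\<lambda>k. pderivative (v k) i) w) \<and>
          (\<forall>a c. norm a = 1 \<longrightarrow>
             L2_tendsto (hyperplane_measure a c) (frontier \<Omega> \<inter> {x. a \<bullet> x = c}) v g))"


section \<open>Hypotheses on the data\<close>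

text \<open>
  A boundary datum and its extension to \<open>\<Omega>\<close> are denoted by the same function: the values of
  \<open>ND\<close> on \<open>\<Omega>\<close> are those of the \<open>H\<^sup>1\<close> function, the values of \<open>ND\<close> on \<open>frontier \<Omega>\<close> are those of
  its trace. The same applies to \<open>PD\<close> and \<open>PsiD\<close>.
\<close>

definition hypotheses_H ::
  "'a::euclidean_space set \<Rightarrow> 'a set \<Rightarrow> 'a set \<Rightarrow> ('a \<Rightarrow> real) \<Rightarrow> ('a \<Rightarrow> real)
   \<Rightarrow> ('a \<Rightarrow> real) \<Rightarrow> ('a \<Rightarrow> real) \<Rightarrow> ('a \<Rightarrow> real) \<Rightarrow> real \<Rightarrow> real \<Rightarrow> bool" where
  "hypotheses_H \<Omega> \<Gamma>D \<Gamma>N N0 P0 ND PD PsiD m M \<longleftrightarrow>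
     open \<Omega> \<and> bounded \<Omega> \<and>
     frontier \<Omega> = \<Gamma>D \<union> \<Gamma>N \<and> \<Gamma>D \<inter> \<Gamma>N = {} \<and> hausdorff_measure (DIM('a) - 1) \<Gamma>D > 0 \<and>
     Linf_on \<Omega> N0 \<and> Linf_on \<Omega> P0 \<and>
     Linf_on \<Omega> ND \<and> H1_on \<Omega> ND \<and> Linf_on \<Omega> PD \<and> H1_on \<Omega> PD \<and> H1_on \<Omega> PsiD \<and>
     has_trace \<Omega> ND ND \<and> has_trace \<Omega> PD PD \<and> has_trace \<Omega> PsiD PsiD \<and>
     m > 0 \<and> M > 0 \<and>
     (\<forall>f\<in>{N0, P0, ND, PD}. AE x in lebesgue. x \<in> \<Omega> \<longrightarrow> m \<le> f x \<and> f x \<le> M)"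


section \<open>Admissible meshes\<close>

record 'a mesh =
  cells :: "'a set set"
  edges :: "'a set set"
  edges_of :: "'a set \<Rightarrow> 'a set set"
  center :: "'a set \<Rightarrow> 'a"

text \<open>\<open>interface \<M> K L \<sigma>\<close> stands for \<open>\<sigma> = K|L\<close>.\<close>

definition interface :: "'a::euclidean_space mesh \<Rightarrow> 'a set \<Rightarrow> 'a set \<Rightarrow> 'a set \<Rightarrow> bool" where
  "interface \<M> K L \<sigma> \<longleftrightarrow>
     K \<in> cells \<M> \<and> L \<in> cells \<M> \<and> K \<noteq> L \<and> \<sigma> \<in> edges \<M> \<and> closure K \<inter> closure L = closure \<sigma>"

definition interior_edge :: "'a::euclidean_space mesh \<Rightarrow> 'a set \<Rightarrow> bool" where
  "interior_edge \<M> \<sigma> \<longleftrightarrow> (\<exists>K L. interface \<M> K L \<sigma>)"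

text \<open>
  The clauses on the splitting of the edges make explicit what the notation presupposes: the edges
  common to \<open>K\<close> and \<open>L\<close> are those of the form \<open>K|L\<close>, and interior edges and boundary edges are
  disjoint classes. In particular a boundary edge belongs to one cell only.
\<close>

definition admissible_mesh ::
  "'a::euclidean_space set \<Rightarrow> 'a set \<Rightarrow> 'a set \<Rightarrow> 'a mesh \<Rightarrow> bool" where
  "admissible_mesh \<Omega> \<Gamma>D \<Gamma>N \<M> \<longleftrightarrow>
     \<comment> \<open>control volumes\<close>
     finite (cells \<M>) \<and> disjoint (cells \<M>) \<and>
     (\<forall>K\<in>cells \<M>. K \<noteq> {} \<and> open K \<and> convex K \<and> polytope (closure K) \<and> K \<subseteq> \<Omega>) \<and>
     closure (\<Union>(cells \<M>)) = closure \<Omega> \<and>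
     \<comment> \<open>edges\<close>
     finite (edges \<M>) \<and>
     (\<forall>\<sigma>\<in>edges \<M>. \<sigma> \<subseteq> closure \<Omega> \<and> (\<exists>a c. in_hyperplane a c \<sigma>) \<and> face_area \<sigma> > 0) \<and>
     (\<forall>K\<in>cells \<M>. edges_of \<M> K \<subseteq> edges \<M> \<and> frontier K = (\<Union>\<sigma>\<in>edges_of \<M> K. closure \<sigma>)) \<and>
     edges \<M> = (\<Union>K\<in>cells \<M>. edges_of \<M> K) \<and>
     (\<forall>K\<in>cells \<M>. \<forall>L\<in>cells \<M>. K \<noteq> L \<longrightarrow>
        face_area (closure K \<inter> closure L) = 0 \<or> (\<exists>\<sigma>. interface \<M> K L \<sigma>)) \<and>
     \<comment> \<open>splitting of the edges\<close>
     (\<forall>K\<in>cells \<M>. \<forall>L\<in>cells \<M>. \<forall>\<sigma>\<in>edges \<M>. K \<noteq> L \<longrightarrow>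
        (interface \<M> K L \<sigma> \<longleftrightarrow> \<sigma> \<in> edges_of \<M> K \<and> \<sigma> \<in> edges_of \<M> L)) \<and>
     (\<forall>\<sigma>\<in>edges \<M>. interior_edge \<M> \<sigma> \<longleftrightarrow> \<not> \<sigma> \<subseteq> frontier \<Omega>) \<and>
     (\<forall>\<sigma>\<in>edges \<M>. \<sigma> \<subseteq> frontier \<Omega> \<longrightarrow> \<sigma> \<subseteq> \<Gamma>D \<or> \<sigma> \<subseteq> \<Gamma>N) \<and>
     \<comment> \<open>points\<close>
     (\<forall>K\<in>cells \<M>. center \<M> K \<in> closure K) \<and>
     (\<forall>K L \<sigma>. interface \<M> K L \<sigma> \<longrightarrow>
        center \<M> K \<noteq> center \<M> L \<and>
        (\<forall>y\<in>\<sigma>. \<forall>z\<in>\<sigma>. (center \<M> K - center \<M> L) \<bullet> (y - z) = 0)) \<and>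
     (\<forall>K\<in>cells \<M>. \<forall>\<sigma>\<in>edges_of \<M> K. \<sigma> \<subseteq> frontier \<Omega> \<and> center \<M> K \<notin> \<sigma> \<longrightarrow>
        (\<exists>p\<in>\<sigma>. \<forall>y\<in>\<sigma>. \<forall>z\<in>\<sigma>. (p - center \<M> K) \<bullet> (y - z) = 0))"

definition regular_mesh :: "real \<Rightarrow> real \<Rightarrow> 'a::euclidean_space mesh \<Rightarrow> bool" where
  "regular_mesh \<xi> \<beta> \<M> \<longleftrightarrow>
     (\<forall>K\<in>cells \<M>. \<forall>\<sigma>\<in>edges_of \<M> K. infdist (center \<M> K) \<sigma> \<ge> \<xi> * diameter K) \<and>
     (\<forall>K\<in>cells \<M>. real (card (edges_of \<M> K)) \<le> \<beta>)"

definition neighbour :: "'a::euclidean_space mesh \<Rightarrow> 'a set \<Rightarrow> 'a set \<Rightarrow> 'a set" where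
  "neighbour \<M> K \<sigma> = (THE L. interface \<M> K L \<sigma>)"

text \<open>Any cell having \<open>\<sigma>\<close> as an edge; what is built on it does not depend on the choice.\<close>

definition cell_of :: "'a::euclidean_space mesh \<Rightarrow> 'a set \<Rightarrow> 'a set" where
  "cell_of \<M> \<sigma> = (SOME K. K \<in> cells \<M> \<and> \<sigma> \<in> edges_of \<M> K)"

definition d_edge :: "'a::euclidean_space mesh \<Rightarrow> 'a set \<Rightarrow> real" where
  "d_edge \<M> \<sigma> =
     (let K = cell_of \<M> \<sigma> in
      if interior_edge \<M> \<sigma> then dist (center \<M> K) (center \<M> (neighbour \<M> K \<sigma>))
      else infdist (center \<M> K) \<sigma>)"

definition transm :: "'a::euclidean_space mesh \<Rightarrow> 'a set \<Rightarrow> real" where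
  "transm \<M> \<sigma> = face_area \<sigma> / d_edge \<M> \<sigma>"


section \<open>Discrete vectors\<close>

text \<open>Values on the cells and values on the Dirichlet edges.\<close>

type_synonym 'a dvec = "('a set \<Rightarrow> real) \<times> ('a set \<Rightarrow> real)"

definition dmap2 :: "(real \<Rightarrow> real \<Rightarrow> real) \<Rightarrow> 'a dvec \<Rightarrow> 'a dvec \<Rightarrow> 'a dvec" where
  "dmap2 f u v = (\<lambda>K. f (fst u K) (fst v K), \<lambda>\<sigma>. f (snd u \<sigma>) (snd v \<sigma>))"

text \<open>\<open>opp \<M> \<Gamma>D u K \<sigma>\<close> is \<open>u\<^bsub>K,\<sigma>\<^esub>\<close>.\<close>

definition opp ::
  "'a::euclidean_space mesh \<Rightarrow> 'a set \<Rightarrow> 'a dvec \<Rightarrow> 'a set \<Rightarrow> 'a set \<Rightarrow> real" where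
  "opp \<M> \<Gamma>D u K \<sigma> =
     (if interior_edge \<M> \<sigma> then fst u (neighbour \<M> K \<sigma>)
      else if \<sigma> \<subseteq> \<Gamma>D then snd u \<sigma>
      else fst u K)"

definition Dd ::
  "'a::euclidean_space mesh \<Rightarrow> 'a set \<Rightarrow> 'a dvec \<Rightarrow> 'a set \<Rightarrow> 'a set \<Rightarrow> real" where
  "Dd \<M> \<Gamma>D u K \<sigma> = opp \<M> \<Gamma>D u K \<sigma> - fst u K"

definition Dabs :: "'a::euclidean_space mesh \<Rightarrow> 'a set \<Rightarrow> 'a dvec \<Rightarrow> 'a set \<Rightarrow> real" where
  "Dabs \<M> \<Gamma>D u \<sigma> = \<bar>Dd \<M> \<Gamma>D u (cell_of \<M> \<sigma>) \<sigma>\<bar>"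

definition seminorm1_sq :: "'a::euclidean_space mesh \<Rightarrow> 'a set \<Rightarrow> 'a dvec \<Rightarrow> real" where
  "seminorm1_sq \<M> \<Gamma>D u = (\<Sum>\<sigma>\<in>edges \<M>. transm \<M> \<sigma> * (Dabs \<M> \<Gamma>D u \<sigma>)\<^sup>2)"

definition cell_avg :: "('a::euclidean_space \<Rightarrow> real) \<Rightarrow> 'a set \<Rightarrow> real" where
  "cell_avg f K = (LINT x:K|lebesgue. f x) / measure lebesgue K"

definition edge_avg :: "('a::euclidean_space \<Rightarrow> real) \<Rightarrow> 'a set \<Rightarrow> real" where
  "edge_avg f \<sigma> = (LINT x:\<sigma>|surface_measure \<sigma>. f x) / face_area \<sigma>"


section \<open>The scheme\<close>

definition Bern :: "real \<Rightarrow> real" where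
  "Bern x = (if x = 0 then 1 else x / (exp x - 1))"

definition flux_N ::
  "'a::euclidean_space mesh \<Rightarrow> 'a set \<Rightarrow> 'a dvec \<Rightarrow> 'a dvec \<Rightarrow> 'a set \<Rightarrow> 'a set \<Rightarrow> real" where
  "flux_N \<M> \<Gamma>D N \<Psi> K \<sigma> =
     transm \<M> \<sigma> * (Bern (- Dd \<M> \<Gamma>D \<Psi> K \<sigma>) * fst N K - Bern (Dd \<M> \<Gamma>D \<Psi> K \<sigma>) * opp \<M> \<Gamma>D N K \<sigma>)"

definition flux_P ::
  "'a::euclidean_space mesh \<Rightarrow> 'a set \<Rightarrow> 'a dvec \<Rightarrow> 'a dvec \<Rightarrow> 'a set \<Rightarrow> 'a set \<Rightarrow> real" where
  "flux_P \<M> \<Gamma>D P \<Psi> K \<sigma> =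
     transm \<M> \<sigma> * (Bern (Dd \<M> \<Gamma>D \<Psi> K \<sigma>) * fst P K - Bern (- Dd \<M> \<Gamma>D \<Psi> K \<sigma>) * opp \<M> \<Gamma>D P K \<sigma>)"

text \<open>
  The unknowns are the cell values; \<open>with_bd f u\<close> adds the Dirichlet values of \<open>f\<close>.
\<close>

definition with_bd :: "('a::euclidean_space \<Rightarrow> real) \<Rightarrow> ('a set \<Rightarrow> real) \<Rightarrow> 'a dvec" where
  "with_bd f u = (u, edge_avg f)"

text \<open>
  For \<open>lam = 0\<close> the last equation reduces to \<open>P n K = N n K\<close>, and \<open>\<Psi> 0\<close> is not constrained.
\<close>

definition scheme_solution ::
  "'a::euclidean_space mesh \<Rightarrow> 'a set \<Rightarrow> real \<Rightarrow> real
   \<Rightarrow> ('a \<Rightarrow> real) \<Rightarrow> ('a \<Rightarrow> real) \<Rightarrow> ('a \<Rightarrow> real) \<Rightarrow> ('a \<Rightarrow> real) \<Rightarrow> ('a \<Rightarrow> real)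
   \<Rightarrow> (nat \<Rightarrow> 'a set \<Rightarrow> real) \<Rightarrow> (nat \<Rightarrow> 'a set \<Rightarrow> real) \<Rightarrow> (nat \<Rightarrow> 'a set \<Rightarrow> real) \<Rightarrow> bool" where
  "scheme_solution \<M> \<Gamma>D \<Delta>t lam N0 P0 ND PD PsiD N P \<Psi> \<longleftrightarrow>
     (\<forall>K\<in>cells \<M>. N 0 K = cell_avg N0 K \<and> P 0 K = cell_avg P0 K) \<and>
     (\<forall>K\<in>cells \<M>. \<forall>n.
        measure lebesgue K * ((N (Suc n) K - N n K) / \<Delta>t)
          + (\<Sum>\<sigma>\<in>edges_of \<M> K.
               flux_N \<M> \<Gamma>D (with_bd ND (N (Suc n))) (with_bd PsiD (\<Psi> (Suc n))) K \<sigma>) = 0 \<and>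
        measure lebesgue K * ((P (Suc n) K - P n K) / \<Delta>t)
          + (\<Sum>\<sigma>\<in>edges_of \<M> K.
               flux_P \<M> \<Gamma>D (with_bd PD (P (Suc n))) (with_bd PsiD (\<Psi> (Suc n))) K \<sigma>) = 0 \<and>
        - (lam\<^sup>2) * (\<Sum>\<sigma>\<in>edges_of \<M> K. transm \<M> \<sigma> * Dd \<M> \<Gamma>D (with_bd PsiD (\<Psi> n)) K \<sigma>)
          = measure lebesgue K * (P n K - N n K))"


section \<open>Entropy and entropy production\<close>

definition Hfun :: "real \<Rightarrow> real" where
  "Hfun x = x * ln x - x + 1"

definition rel_entropy :: "'a::euclidean_space mesh \<Rightarrow> ('a \<Rightarrow> real) \<Rightarrow> ('a set \<Rightarrow> real) \<Rightarrow> real" where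
  "rel_entropy \<M> f u =
     (\<Sum>K\<in>cells \<M>. measure lebesgue K *
        (Hfun (u K) - Hfun (cell_avg f K) - ln (cell_avg f K) * (u K - cell_avg f K)))"

definition entropy ::
  "'a::euclidean_space mesh \<Rightarrow> 'a set \<Rightarrow> real \<Rightarrow> ('a \<Rightarrow> real) \<Rightarrow> ('a \<Rightarrow> real) \<Rightarrow> ('a \<Rightarrow> real)
   \<Rightarrow> ('a set \<Rightarrow> real) \<Rightarrow> ('a set \<Rightarrow> real) \<Rightarrow> ('a set \<Rightarrow> real) \<Rightarrow> real" where
  "entropy \<M> \<Gamma>D lam ND PD PsiD N P \<Psi> =
     rel_entropy \<M> ND N + rel_entropy \<M> PD P
     + lam\<^sup>2 / 2 * seminorm1_sq \<M> \<Gamma>D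
         (dmap2 (-) (with_bd PsiD \<Psi>) (with_bd PsiD (cell_avg PsiD)))"

definition entropy_production ::
  "'a::euclidean_space mesh \<Rightarrow> 'a set \<Rightarrow> ('a \<Rightarrow> real) \<Rightarrow> ('a \<Rightarrow> real) \<Rightarrow> ('a \<Rightarrow> real)
   \<Rightarrow> ('a set \<Rightarrow> real) \<Rightarrow> ('a set \<Rightarrow> real) \<Rightarrow> ('a set \<Rightarrow> real) \<Rightarrow> real" where
  "entropy_production \<M> \<Gamma>D ND PD PsiD N P \<Psi> =
     (\<Sum>\<sigma>\<in>edges \<M>. transm \<M> \<sigma> *
        (min (N (cell_of \<M> \<sigma>)) (opp \<M> \<Gamma>D (with_bd ND N) (cell_of \<M> \<sigma>) \<sigma>)
           * (Dabs \<M> \<Gamma>D (dmap2 (\<lambda>s t. ln s - t) (with_bd ND N) (with_bd PsiD \<Psi>)) \<sigma>)\<^sup>2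
         + min (P (cell_of \<M> \<sigma>)) (opp \<M> \<Gamma>D (with_bd PD P) (cell_of \<M> \<sigma>) \<sigma>)
           * (Dabs \<M> \<Gamma>D (dmap2 (\<lambda>s t. ln s + t) (with_bd PD P) (with_bd PsiD \<Psi>)) \<sigma>)\<^sup>2))"

end

theory Submission
  imports Defs
begin

text \<open>The constant has to be fixed before the mesh, the splitting of the boundary, the initial
  data, \<Delta>t and \<lambda>. It therefore uses only m, M, T, \<xi>, \<beta>, the measure of
  \<Omega> and one gradient bound per datum, read off from a sequence of smooth functions that
  defines its trace; such a sequence involves neither the mesh nor \<Gamma>D. The potential terms of
  the entropy step use the Poisson equation without dividing by \<lambda>, so \<lambda> = 0 is
  covered by the same computation. Only the initial energy asks for a division, and for \<lambda> =
  0 that energy vanishes. Summing over time telescopes; the initial entropy of the densities is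
  controlled by m and M alone, and quasi-neutrality enters only through the initial potential. A
  further obstacle is that the values on Dirichlet edges are averages of traces, while m and M bound
  the data only almost everywhere inside \<Omega>. Those bounds have to be carried to the boundary
  before the maximum principle can start. Both this and the seminorm estimate rest on one trace
  inequality, with a layer of adjustable width \<epsilon> and an adjustable 1-Lipschitz function
  q.\<close>

text \<open>
  Test the equations for the densities with \<open>log N - \<Psi>\<close> and \<open>log P + \<Psi>\<close> minus the corresponding
  expressions in the boundary data, which vanish on Dirichlet edges. By convexity of \<open>H\<close> and the
  Poisson equation the time differences dominate the increment of the entropy. The
  Scharfetter-Gummel flux through an edge equals \<open>- \<tau> \<theta> D(log N - \<Psi>)\<close> for a mean value
  \<open>\<theta>\<close> of the two densities, so Young's inequality absorbs half of the production and leaves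
  \<open>M / 2\<close> times the discrete \<open>H\<^sup>1\<close> seminorms of the boundary data; the bound \<open>\<theta> \<le> M\<close> is the
  maximum principle for \<open>N\<close> and \<open>P\<close> jointly. The discrete seminorms are bounded by the
  continuous ones through a trace inequality and a Poincare inequality on each convex cell, proved for
  smooth functions and passed to the limit along the sequence that defines the trace.
\<close>

section \<open>The Bernoulli function and the mean value form of the flux\<close>

lemma Bern_pos: "Bern x > 0"
  by (cases "x > 0"; cases "x = 0") (auto simp: Bern_def divide_pos_pos divide_neg_neg)

lemma Bern_mult_exp: "Bern x * (exp x - 1) = x"
  by (auto simp: Bern_def)

lemma Bern_minus: "Bern (- x) = exp x * Bern x"
  by (auto simp: Bern_def exp_minus field_simps)

lemma Bern_minus': "Bern (- x) = Bern x + x"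
  using Bern_mult_exp[of x] by (simp add: Bern_minus algebra_simps)

text \<open>The reciprocal of \<open>Bern s\<close> is the integral of \<open>exp (s * t)\<close>
  over t in [0, 1], and for each t the integrand grows with s. This form also covers the removable
  singularity at zero.\<close>

lemma Bern_antimono:
  assumes "x \<le> y" shows "Bern y \<le> Bern x"
proof -
  have I: "((\<lambda>t. exp (s * t)) has_integral inverse (Bern s)) {0..1}" for s :: real
  proof (cases "s = 0")
    case True
    then show ?thesis using has_integral_const_real[of "1::real" 0 1] by (simp add: Bern_def)
  next
    case False
    have "((\<lambda>t. exp (s * t)) has_integral (exp (s * 1) / s - exp (s * 0) / s)) {0..1}"
      by (rule fundamental_theorem_of_calculus)
        (use False in \<open>auto intro!: derivative_eq_intros simp: has_real_derivative_iff_has_vector_derivative[symmetric]\<close>)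
    then show ?thesis using False by (simp add: Bern_def diff_divide_distrib)
  qed
  have "inverse (Bern x) \<le> inverse (Bern y)"
    by (rule has_integral_le[OF I I]) (use assms in \<open>auto intro: mult_right_mono\<close>)
  then show ?thesis using Bern_pos[of x] Bern_pos[of y] by simp
qed

text \<open>With \<open>B\<close> decreasing and \<open>B (- x) = exp x * B x\<close>, the quotient \<open>B (- y) / B w\<close> lies between
  \<open>1\<close> and \<open>exp (w + y) = n2 / n1\<close>.\<close>

lemma flux_mean_value:
  assumes "n1 > 0" "n2 > 0"
  obtains \<theta> where "min n1 n2 \<le> \<theta>" "\<theta> \<le> max n1 n2"
    "Bern (- y) * n1 - Bern y * n2 = - \<theta> * (ln n2 - ln n1 - y)"
proof -
  define w where "w = ln n2 - ln n1 - y"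
  define \<theta> where "\<theta> = n1 * Bern (- y) / Bern w"
  have n2: "n2 = n1 * exp (w + y)"
    using assms by (simp add: w_def exp_diff)
  have pos: "Bern w > 0" "Bern (-w) > 0" "Bern y > 0" "Bern (- y) > 0" by (simp_all add: Bern_pos)
  \<comment> \<open>The same \<theta> seen from the side of \<open>n2\<close>: each of the two forms
    yields one of the two bounds.\<close>
  have \<theta>2: "\<theta> = n2 * Bern y / Bern (- w)"
    unfolding \<theta>_def n2 by (simp add: Bern_minus[of y] Bern_minus[of w] exp_add)
  have "w = Bern w * (exp w - 1)" by (simp add: Bern_mult_exp)
  then have "\<theta> * w = n1 * Bern (- y) * (exp w - 1)"
    using pos unfolding \<theta>_def by (metis (no_types, lifting) mult.assoc nonzero_eq_divide_eq order_less_irrefl)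
  also have "\<dots> = n2 * Bern y - n1 * Bern (- y)"
    unfolding n2 Bern_minus by (simp add: exp_add algebra_simps)
  finally have eq: "Bern (- y) * n1 - Bern y * n2 = - \<theta> * w" by simp
  have "min n1 n2 \<le> \<theta> \<and> \<theta> \<le> max n1 n2"
  proof (cases "w + y \<ge> 0")
    case True
    have "n1 \<le> \<theta>" using Bern_antimono[of "- y" w] True pos assms by (simp add: \<theta>_def field_simps)
    moreover have "\<theta> \<le> n2"
      using Bern_antimono[of "- w" y] True pos assms unfolding \<theta>2 by (simp add: field_simps)
    ultimately show ?thesis by auto
  next
    case False
    have "\<theta> \<le> n1" using Bern_antimono[of w "- y"] False pos assms by (simp add: \<theta>_def field_simps)
    moreover have "n2 \<le> \<theta>"
      using Bern_antimono[of y "- w"] False pos assms unfolding \<theta>2 by (simp add: field_simps)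
    ultimately show ?thesis by auto
  qed
  with eq show ?thesis unfolding w_def by (intro that[of \<theta>]) auto
qed

text \<open>Young's inequality appears as nonnegativity of
  \<open>\<theta> * (w - \<delta>)\<^sup>2\<close>. Afterwards \<theta> is bounded below by the
  minimum in the production term and above by \<open>M\<close> in the term with \<delta>, which
  stands for the jump of the boundary data.\<close>

lemma flux_dissipation:
  assumes "n1 > 0" "n2 > 0" "n1 \<le> M" "n2 \<le> M"
  shows "(Bern (- y) * n1 - Bern y * n2) * ((ln n2 - ln n1 - y) - \<delta>)
         \<le> - (1/2) * (min n1 n2 * (ln n2 - ln n1 - y)\<^sup>2) + M / 2 * \<delta>\<^sup>2"
proof -
  define w where "w = ln n2 - ln n1 - y"
  obtain \<theta> where th: "min n1 n2 \<le> \<theta>" "\<theta> \<le> max n1 n2"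
    "Bern (- y) * n1 - Bern y * n2 = - \<theta> * w"
    using flux_mean_value[OF assms(1,2)] unfolding w_def by metis
  have "\<theta> \<ge> 0" "\<theta> \<le> M" using th assms by auto
  have "0 \<le> \<theta> * (w - \<delta>)\<^sup>2" using \<open>\<theta> \<ge> 0\<close> by simp
  then have "- \<theta> * w * (w - \<delta>) \<le> - (1/2) * (\<theta> * w\<^sup>2) + 1 / 2 * (\<theta> * \<delta>\<^sup>2)"
    by (simp add: power2_eq_square algebra_simps)
  moreover have "min n1 n2 * w\<^sup>2 \<le> \<theta> * w\<^sup>2" by (rule mult_right_mono) (use th in auto)
  moreover have "\<theta> * \<delta>\<^sup>2 \<le> M * \<delta>\<^sup>2" by (rule mult_right_mono) (use \<open>\<theta> \<le> M\<close> in auto)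
  ultimately show ?thesis unfolding th(3) w_def[symmetric] by simp
qed

section \<open>Tangent inequalities for the logarithm and the entropy density\<close>

lemma ln_tangent:
  fixes a b :: real
  assumes "a > 0" "b > 0"
  shows "b * (ln a - ln b) \<le> a - b"
proof -
  have "ln (a / b) \<le> a / b - 1" using assms by (intro ln_le_minus_one) auto
  then have "b * ln (a / b) \<le> b * (a / b - 1)" using assms by (intro mult_left_mono) auto
  then show ?thesis using assms by (simp add: ln_div algebra_simps)
qed

lemma Hfun_diff_le:
  assumes "a > 0" "b > 0"
  shows "Hfun a - Hfun b \<le> ln a * (a - b)"
  using ln_tangent[OF assms] by (simp add: Hfun_def algebra_simps)

lemma ln_diff_sq_le:
  fixes m x y :: real
  assumes "0 < m" "m \<le> x" "m \<le> y"
  shows "(ln x - ln y)\<^sup>2 \<le> (x - y)\<^sup>2 / m\<^sup>2"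
proof -
  have *: "\<bar>ln x - ln y\<bar> \<le> \<bar>x - y\<bar> / m" if "m \<le> x" "m \<le> y" "x \<le> y" for x y :: real
  proof -
    have "x * (ln y - ln x) \<le> y - x" using that assms by (intro ln_tangent) auto
    moreover have "m * (ln y - ln x) \<le> x * (ln y - ln x)"
      using that assms by (intro mult_right_mono) auto
    ultimately have "m * (ln y - ln x) \<le> y - x" by simp
    then show ?thesis using that assms by (simp add: field_simps)
  qed
  have "\<bar>ln x - ln y\<bar> \<le> \<bar>x - y\<bar> / m"
    using *[of x y] *[of y x] assms by (cases "x \<le> y") (auto simp: abs_minus_commute)
  then have "\<bar>ln x - ln y\<bar>\<^sup>2 \<le> (\<bar>x - y\<bar> / m)\<^sup>2" by (intro power_mono) auto
  then show ?thesis by (simp add: power_divide)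
qed

section \<open>Estimates on the scheme\<close>

lemma Dd_dmap2:
  assumes "\<And>s t s' t'. f s t - f s' t' = g (s - s') (t - t')" "g 0 0 = 0"
  shows "Dd \<M> \<Gamma>D (dmap2 f u v) K \<sigma> = g (Dd \<M> \<Gamma>D u K \<sigma>) (Dd \<M> \<Gamma>D v K \<sigma>)"
  using assms by (auto simp: Dd_def opp_def dmap2_def)

lemma Dd_diff: "Dd \<M> \<Gamma>D (dmap2 (-) u v) K \<sigma> = Dd \<M> \<Gamma>D u K \<sigma> - Dd \<M> \<Gamma>D v K \<sigma>"
  by (rule Dd_dmap2) auto

definition dvec_uminus :: "'a dvec \<Rightarrow> 'a dvec" where
  "dvec_uminus u = (\<lambda>K. - fst u K, \<lambda>\<sigma>. - snd u \<sigma>)"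

lemma Dd_uminus: "Dd \<M> \<Gamma>D (dvec_uminus u) K \<sigma> = - Dd \<M> \<Gamma>D u K \<sigma>"
  by (auto simp: Dd_def opp_def dvec_uminus_def)

text \<open>Reversing the potential exchanges the roles of the two species, so every result on
  \<open>flux_N\<close> also serves \<open>P\<close>.\<close>

lemma flux_P_eq: "flux_P \<M> \<Gamma>D P \<Psi> K \<sigma> = flux_N \<M> \<Gamma>D P (dvec_uminus \<Psi>) K \<sigma>"
  by (simp add: flux_P_def flux_N_def Dd_uminus)

lemma with_bd_simps [simp]: "fst (with_bd f u) = u" "snd (with_bd f u) = edge_avg f"
  by (simp_all add: with_bd_def)

lemma dmap2_simps [simp]: "fst (dmap2 f u v) K = f (fst u K) (fst v K)"
  "snd (dmap2 f u v) \<sigma> = f (snd u \<sigma>) (snd v \<sigma>)"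
  by (simp_all add: dmap2_def)

text \<open>The combinatorial content of a mesh. The estimates on the scheme see the geometry only
  through the signs of measures and transmissibilities and through the number of cells at an edge:
  two inside, one on the boundary.\<close>

locale discrete_mesh =
  fixes \<M> :: "'a::euclidean_space mesh" and \<Gamma>D :: "'a set"
  assumes finite_cells: "finite (cells \<M>)" and finite_edges: "finite (edges \<M>)"
    and edges_eq: "edges \<M> = (\<Union>K\<in>cells \<M>. edges_of \<M> K)"
    and measure_pos: "K \<in> cells \<M> \<Longrightarrow> measure lebesgue K > 0"
    and transm_nonneg: "\<sigma> \<in> edges \<M> \<Longrightarrow> transm \<M> \<sigma> \<ge> 0"
    and boundary_cells: "\<sigma> \<in> edges \<M> \<Longrightarrow> \<not> interior_edge \<M> \<sigma> \<Longrightarrow>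
          {K \<in> cells \<M>. \<sigma> \<in> edges_of \<M> K} = {cell_of \<M> \<sigma>}"
    and interior_cells: "\<sigma> \<in> edges \<M> \<Longrightarrow> interior_edge \<M> \<sigma> \<Longrightarrow>
          {K \<in> cells \<M>. \<sigma> \<in> edges_of \<M> K} = {cell_of \<M> \<sigma>, neighbour \<M> (cell_of \<M> \<sigma>) \<sigma>}"
    and neighbour_neq: "\<sigma> \<in> edges \<M> \<Longrightarrow> interior_edge \<M> \<sigma> \<Longrightarrow>
          neighbour \<M> (cell_of \<M> \<sigma>) \<sigma> \<noteq> cell_of \<M> \<sigma>"
    and neighbour_neighbour: "\<sigma> \<in> edges \<M> \<Longrightarrow> interior_edge \<M> \<sigma> \<Longrightarrow>
          neighbour \<M> (neighbour \<M> (cell_of \<M> \<sigma>) \<sigma>) \<sigma> = cell_of \<M> \<sigma>"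
begin

abbreviation "D \<equiv> Dd \<M> \<Gamma>D"
abbreviation "val \<equiv> opp \<M> \<Gamma>D"
abbreviation "flux \<equiv> flux_N \<M> \<Gamma>D"
abbreviation "cell \<equiv> cell_of \<M>"
abbreviation "snorm \<equiv> seminorm1_sq \<M> \<Gamma>D"
abbreviation "\<tau> \<equiv> transm \<M>"
abbreviation "\<T> \<equiv> cells \<M>"
abbreviation "\<E> \<equiv> edges \<M>"
abbreviation "nbr \<sigma> \<equiv> neighbour \<M> (cell \<sigma>) \<sigma>"

section \<open>Summation by parts on a mesh\<close>

lemma edges_ofD: "K \<in> \<T> \<Longrightarrow> \<sigma> \<in> edges_of \<M> K \<Longrightarrow> \<sigma> \<in> \<E>"
  using edges_eq by blast

lemma cell_of_in: "\<sigma> \<in> \<E> \<Longrightarrow> cell \<sigma> \<in> \<T>"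
  using boundary_cells[of \<sigma>] interior_cells[of \<sigma>] by (cases "interior_edge \<M> \<sigma>") blast+

lemma nbr_in: "\<sigma> \<in> \<E> \<Longrightarrow> interior_edge \<M> \<sigma> \<Longrightarrow> nbr \<sigma> \<in> \<T>"
  using interior_cells[of \<sigma>] by blast

text \<open>On a Neumann edge the opposite value is that of the cell itself, so it falls under the
  first alternative. Comparison with an extremal cell then has only two cases.\<close>

lemma opp_cases:
  assumes "K \<in> \<T>" "\<sigma> \<in> edges_of \<M> K"
  obtains L where "L \<in> \<T>" "\<And>u. val u K \<sigma> = fst u L"
  | "\<not> interior_edge \<M> \<sigma>" "\<sigma> \<subseteq> \<Gamma>D" "\<And>u. val u K \<sigma> = snd u \<sigma>"
proof (cases "interior_edge \<M> \<sigma>")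
  case True
  have s: "\<sigma> \<in> \<E>" using assms edges_ofD by blast
  have "K = cell \<sigma> \<or> K = nbr \<sigma>" using interior_cells[OF s True] assms by blast
  then have "neighbour \<M> K \<sigma> \<in> \<T>"
    using neighbour_neighbour[OF s True] nbr_in[OF s True] cell_of_in[OF s] by auto
  then show ?thesis using True that(1) by (auto simp: opp_def)
next
  case False
  then show ?thesis using that assms by (cases "\<sigma> \<subseteq> \<Gamma>D") (auto simp: opp_def)
qed

lemma sum_cells_edges:
  fixes \<phi> :: "'a set \<Rightarrow> 'a set \<Rightarrow> 'b::comm_monoid_add"
  shows "(\<Sum>K\<in>\<T>. \<Sum>\<sigma>\<in>edges_of \<M> K. \<phi> K \<sigma>)
       = (\<Sum>\<sigma>\<in>\<E>. \<Sum>K | K \<in> \<T> \<and> \<sigma> \<in> edges_of \<M> K. \<phi> K \<sigma>)"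
proof -
  have "(\<Sum>K\<in>\<T>. \<Sum>\<sigma>\<in>edges_of \<M> K. \<phi> K \<sigma>)
      = (\<Sum>K\<in>\<T>. \<Sum>\<sigma> | \<sigma> \<in> \<E> \<and> \<sigma> \<in> edges_of \<M> K. \<phi> K \<sigma>)"
    by (intro sum.cong refl) (auto dest: edges_ofD)
  also have "\<dots> = (\<Sum>\<sigma>\<in>\<E>. \<Sum>K | K \<in> \<T> \<and> \<sigma> \<in> edges_of \<M> K. \<phi> K \<sigma>)"
    by (rule sum.swap_restrict[OF finite_cells finite_edges])
  finally show ?thesis .
qed

text \<open>An interior edge is visited from its two cells with opposite fluxes, which leaves the
  difference of \<open>u\<close>. On a Dirichlet edge \<open>u\<close> vanishes, so minus its jump
  is the cell value; on a Neumann edge there is no flux.\<close>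

lemma summation_by_parts:
  assumes int: "\<And>\<sigma>. \<sigma> \<in> \<E> \<Longrightarrow> interior_edge \<M> \<sigma> \<Longrightarrow> \<phi> (nbr \<sigma>) \<sigma> = - \<phi> (cell \<sigma>) \<sigma>"
    and neu: "\<And>\<sigma>. \<sigma> \<in> \<E> \<Longrightarrow> \<not> interior_edge \<M> \<sigma> \<Longrightarrow> \<not> \<sigma> \<subseteq> \<Gamma>D \<Longrightarrow> \<phi> (cell \<sigma>) \<sigma> = 0"
    and dir: "\<And>\<sigma>. \<sigma> \<in> \<E> \<Longrightarrow> \<not> interior_edge \<M> \<sigma> \<Longrightarrow> \<sigma> \<subseteq> \<Gamma>D \<Longrightarrow> snd u \<sigma> = 0"
  shows "(\<Sum>K\<in>\<T>. fst u K * (\<Sum>\<sigma>\<in>edges_of \<M> K. \<phi> K \<sigma>))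
       = - (\<Sum>\<sigma>\<in>\<E>. \<phi> (cell \<sigma>) \<sigma> * D u (cell \<sigma>) \<sigma>)"
proof -
  have "(\<Sum>K | K \<in> \<T> \<and> \<sigma> \<in> edges_of \<M> K. fst u K * \<phi> K \<sigma>)
      = - (\<phi> (cell \<sigma>) \<sigma> * D u (cell \<sigma>) \<sigma>)" if s: "\<sigma> \<in> \<E>" for \<sigma>
  proof (cases "interior_edge \<M> \<sigma>")
    case True
    show ?thesis unfolding interior_cells[OF s True]
      using neighbour_neq[OF s True] int[OF s True] True
      by (subst sum.insert) (auto simp: Dd_def opp_def algebra_simps)
  next
    case False
    show ?thesis unfolding boundary_cells[OF s False]
      using neu[OF s False] dir[OF s False] False by (auto simp: Dd_def opp_def)
  qed
  then show ?thesis
    by (simp add: sum_distrib_left sum_cells_edges sum_negf)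
qed

lemma Dd_nbr:
  assumes "\<sigma> \<in> \<E>" "interior_edge \<M> \<sigma>"
  shows "D u (nbr \<sigma>) \<sigma> = - D u (cell \<sigma>) \<sigma>"
  using neighbour_neighbour[OF assms] assms by (simp add: Dd_def opp_def)

lemma Dd_neumann: "\<not> interior_edge \<M> \<sigma> \<Longrightarrow> \<not> \<sigma> \<subseteq> \<Gamma>D \<Longrightarrow> D u K \<sigma> = 0"
  by (simp add: Dd_def opp_def)

lemma flux_nbr:
  assumes "\<sigma> \<in> \<E>" "interior_edge \<M> \<sigma>"
  shows "flux N \<Psi> (nbr \<sigma>) \<sigma> = - flux N \<Psi> (cell \<sigma>) \<sigma>"
  unfolding flux_N_def Dd_nbr[OF assms] using neighbour_neighbour[OF assms] assms
  by (simp add: opp_def algebra_simps)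

lemma flux_neumann:
  assumes "\<not> interior_edge \<M> \<sigma>" "\<not> \<sigma> \<subseteq> \<Gamma>D"
  shows "flux N \<Psi> K \<sigma> = 0"
  using assms by (simp add: flux_N_def Dd_def opp_def)

lemmas flux_by_parts = summation_by_parts[where \<phi> = "flux N \<Psi>" for N \<Psi>,
  OF flux_nbr flux_neumann]

section \<open>Nonnegativity and the maximum principle\<close>

text \<open>The test vector is the indicator of the cells with negative value. As
  \<open>Bern\<close> is positive, the flux increases with the inner and decreases with the outer
  density, so all edge terms have one sign, whereas the time difference is strictly negative in a
  negative cell. The potential is arbitrary here; the maximum principle needs this sign beforehand,
  since its drift term carries the factor \<open>fst N K\<close>.\<close>

lemma scheme_nonneg:
  assumes \<Delta>t: "\<Delta>t > 0" and old: "\<And>K. K \<in> \<T> \<Longrightarrow> N' K > 0"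
    and bd: "\<And>\<sigma>. \<sigma> \<in> \<E> \<Longrightarrow> \<not> interior_edge \<M> \<sigma> \<Longrightarrow> \<sigma> \<subseteq> \<Gamma>D \<Longrightarrow> snd N \<sigma> > 0"
    and eq: "\<And>K. K \<in> \<T> \<Longrightarrow>
      measure lebesgue K * ((fst N K - N' K) / \<Delta>t) + (\<Sum>\<sigma>\<in>edges_of \<M> K. flux N \<Psi> K \<sigma>) = 0"
    and K: "K \<in> \<T>"
  shows "fst N K \<ge> 0"
proof (rule ccontr)
  assume neg: "\<not> fst N K \<ge> 0"
  define u :: "'a dvec" where "u = (\<lambda>K. if fst N K < 0 then 1 else 0, \<lambda>_. 0)"
  have "(\<Sum>K\<in>\<T>. fst u K * (\<Sum>\<sigma>\<in>edges_of \<M> K. flux N \<Psi> K \<sigma>))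
       = - (\<Sum>\<sigma>\<in>\<E>. flux N \<Psi> (cell \<sigma>) \<sigma> * D u (cell \<sigma>) \<sigma>)"
    by (rule flux_by_parts) (auto simp: u_def)
  also have "\<dots> \<le> 0"
  proof -
    have "0 \<le> flux N \<Psi> (cell \<sigma>) \<sigma> * D u (cell \<sigma>) \<sigma>" if s: "\<sigma> \<in> \<E>" for \<sigma>
    proof -
      let ?K = "cell \<sigma>" and ?y = "D \<Psi> (cell \<sigma>) \<sigma>"
      have B: "Bern (- ?y) > 0" "Bern ?y > 0" by (rule Bern_pos)+
      have "0 \<le> (Bern (- ?y) * fst N ?K - Bern ?y * val N ?K \<sigma>) * D u ?K \<sigma>"
      proof (cases "fst N ?K < 0")
        case True
        have "Bern (- ?y) * fst N ?K \<le> 0" using B True by (simp add: mult_le_0_iff)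
        moreover have "D u ?K \<sigma> = 0 \<or> D u ?K \<sigma> = - 1 \<and> val N ?K \<sigma> \<ge> 0"
          using True bd[OF s] by (auto simp: Dd_def opp_def u_def)
        moreover have "x \<ge> 0 \<Longrightarrow> Bern ?y * x \<ge> 0" for x using B by simp
        ultimately show ?thesis by fastforce
      next
        case False
        have b: "Bern (- ?y) * fst N ?K \<ge> 0" using B False by simp
        moreover have "x < 0 \<Longrightarrow> Bern ?y * x \<le> 0" for x using B by (simp add: mult_le_0_iff)
        moreover have "D u ?K \<sigma> = 0 \<or> D u ?K \<sigma> = 1 \<and> val N ?K \<sigma> < 0"
          using False bd[OF s] by (auto simp: Dd_def opp_def u_def)
        ultimately show ?thesis by fastforce
      qed
      then show ?thesis using transm_nonneg[OF s] unfolding flux_N_def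
        by (metis (no_types, lifting) mult.assoc mult_nonneg_nonneg)
    qed
    then show ?thesis by (simp add: sum_nonneg)
  qed
  finally have 1: "(\<Sum>K\<in>\<T>. fst u K * (\<Sum>\<sigma>\<in>edges_of \<M> K. flux N \<Psi> K \<sigma>)) \<le> 0" .
  have "0 = (\<Sum>K\<in>\<T>. fst u K *
      (measure lebesgue K * ((fst N K - N' K) / \<Delta>t) + (\<Sum>\<sigma>\<in>edges_of \<M> K. flux N \<Psi> K \<sigma>)))"
    by (intro sum.neutral[symmetric] ballI) (simp only: eq mult_zero_right)
  also have "\<dots> \<le> (\<Sum>K\<in>\<T>. fst u K * (measure lebesgue K * ((fst N K - N' K) / \<Delta>t)))"
    using 1 by (simp add: distrib_left sum.distrib)
  also have "\<dots> < (\<Sum>K\<in>\<T>. 0)"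
  proof (rule sum_strict_mono_ex1[OF finite_cells])
    show "\<forall>K\<in>\<T>. fst u K * (measure lebesgue K * ((fst N K - N' K) / \<Delta>t)) \<le> 0"
      using \<Delta>t by (force simp: u_def mult_le_0_iff divide_le_0_iff dest: old)
    have "measure lebesgue K * ((fst N K - N' K) / \<Delta>t) < 0"
      using \<Delta>t neg old[OF K] measure_pos[OF K] by (simp add: mult_less_0_iff divide_less_0_iff)
    then show "\<exists>K\<in>\<T>. fst u K * (measure lebesgue K * ((fst N K - N' K) / \<Delta>t)) < 0"
      using K neg by (auto simp: u_def)
  qed
  finally show False by simp
qed

text \<open>By B(-y) = B(y) + y the flux splits into a monotone diffusion part and a drift part in
  which the density of the cell multiplies the discrete Laplacian of the potential. The Poisson
  equation controls the latter.\<close>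

lemma flux_sum_eq:
  "(\<Sum>\<sigma>\<in>edges_of \<M> K. flux N \<Psi> K \<sigma>) =
   (\<Sum>\<sigma>\<in>edges_of \<M> K. \<tau> \<sigma> * (Bern (D \<Psi> K \<sigma>) * (fst N K - val N K \<sigma>)))
   + fst N K * (\<Sum>\<sigma>\<in>edges_of \<M> K. \<tau> \<sigma> * D \<Psi> K \<sigma>)"
  unfolding flux_N_def sum_distrib_left sum.distrib[symmetric] Bern_minus'
  by (rule sum.cong) (auto simp: algebra_simps)

text \<open>If the maximal value exceeded \<open>M\<close>, all differences to neighbouring and
  Dirichlet values would be nonnegative, the drift would be nonnegative by assumption and the time
  difference positive, so the three could not add up to zero.\<close>

lemma scheme_upper:
  assumes \<Delta>t: "\<Delta>t > 0" and K: "K \<in> \<T>" and old: "N' K \<le> M"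
    and eq: "measure lebesgue K * ((fst N K - N' K) / \<Delta>t) + (\<Sum>\<sigma>\<in>edges_of \<M> K. flux N \<Psi> K \<sigma>) = 0"
    and max: "\<And>L. L \<in> \<T> \<Longrightarrow> fst N L \<le> fst N K"
    and bd: "\<And>\<sigma>. \<sigma> \<in> \<E> \<Longrightarrow> \<not> interior_edge \<M> \<sigma> \<Longrightarrow> \<sigma> \<subseteq> \<Gamma>D \<Longrightarrow> snd N \<sigma> \<le> M"
    and sgn: "0 \<le> fst N K" "0 \<le> (\<Sum>\<sigma>\<in>edges_of \<M> K. \<tau> \<sigma> * D \<Psi> K \<sigma>)"
  shows "fst N K \<le> M"
proof (rule ccontr)
  assume c: "\<not> fst N K \<le> M"
  have "0 \<le> (\<Sum>\<sigma>\<in>edges_of \<M> K. \<tau> \<sigma> * (Bern (D \<Psi> K \<sigma>) * (fst N K - val N K \<sigma>)))"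
  proof (intro sum_nonneg mult_nonneg_nonneg)
    fix \<sigma> assume s: "\<sigma> \<in> edges_of \<M> K"
    then show "0 \<le> \<tau> \<sigma>" using edges_ofD K transm_nonneg by blast
    show "0 \<le> Bern (D \<Psi> K \<sigma>)" using Bern_pos less_imp_le by blast
    show "0 \<le> fst N K - val N K \<sigma>"
      using K s by (rule opp_cases) (use max bd[OF edges_ofD[OF K s]] c in auto)
  qed
  moreover have "0 < measure lebesgue K * ((fst N K - N' K) / \<Delta>t)"
    using c old \<Delta>t measure_pos[OF K] by simp
  ultimately show False using eq sgn unfolding flux_sum_eq by (smt (verit) mult_nonneg_nonneg)
qed

lemma scheme_lower:
  assumes \<Delta>t: "\<Delta>t > 0" and K: "K \<in> \<T>" and old: "m \<le> N' K"
    and eq: "measure lebesgue K * ((fst N K - N' K) / \<Delta>t) + (\<Sum>\<sigma>\<in>edges_of \<M> K. flux N \<Psi> K \<sigma>) = 0"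
    and min: "\<And>L. L \<in> \<T> \<Longrightarrow> fst N K \<le> fst N L"
    and bd: "\<And>\<sigma>. \<sigma> \<in> \<E> \<Longrightarrow> \<not> interior_edge \<M> \<sigma> \<Longrightarrow> \<sigma> \<subseteq> \<Gamma>D \<Longrightarrow> m \<le> snd N \<sigma>"
    and sgn: "0 \<le> fst N K" "(\<Sum>\<sigma>\<in>edges_of \<M> K. \<tau> \<sigma> * D \<Psi> K \<sigma>) \<le> 0"
  shows "m \<le> fst N K"
proof (rule ccontr)
  assume c: "\<not> m \<le> fst N K"
  have "(\<Sum>\<sigma>\<in>edges_of \<M> K. \<tau> \<sigma> * (Bern (D \<Psi> K \<sigma>) * (fst N K - val N K \<sigma>))) \<le> 0"
  proof (intro sum_nonpos mult_nonneg_nonpos)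
    fix \<sigma> assume s: "\<sigma> \<in> edges_of \<M> K"
    then show "0 \<le> \<tau> \<sigma>" using edges_ofD K transm_nonneg by blast
    show "0 \<le> Bern (D \<Psi> K \<sigma>)" using Bern_pos less_imp_le by blast
    show "fst N K - val N K \<sigma> \<le> 0"
      using K s by (rule opp_cases) (use min bd[OF edges_ofD[OF K s]] c in auto)
  qed
  moreover have "measure lebesgue K * ((fst N K - N' K) / \<Delta>t) < 0"
    using c old \<Delta>t measure_pos[OF K] by (simp add: mult_less_0_iff divide_less_0_iff)
  ultimately show False using eq sgn unfolding flux_sum_eq by (smt (verit) mult_nonneg_nonpos)
qed

text \<open>The extrema are taken over both densities together: at such a cell the Poisson equation
  fixes the sign of the drift term.\<close>

lemma maximum_principle:
  assumes \<Delta>t: "\<Delta>t > 0" and m: "m > 0"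
    and old: "\<And>K. K \<in> \<T> \<Longrightarrow> m \<le> N' K \<and> N' K \<le> M \<and> m \<le> P' K \<and> P' K \<le> M"
    and bd: "\<And>\<sigma>. \<sigma> \<in> \<E> \<Longrightarrow> \<not> interior_edge \<M> \<sigma> \<Longrightarrow> \<sigma> \<subseteq> \<Gamma>D \<Longrightarrow>
      m \<le> snd N \<sigma> \<and> snd N \<sigma> \<le> M \<and> m \<le> snd P \<sigma> \<and> snd P \<sigma> \<le> M"
    and eqN: "\<And>K. K \<in> \<T> \<Longrightarrow>
      measure lebesgue K * ((fst N K - N' K) / \<Delta>t) + (\<Sum>\<sigma>\<in>edges_of \<M> K. flux N \<Psi> K \<sigma>) = 0"
    and eqP: "\<And>K. K \<in> \<T> \<Longrightarrow>
      measure lebesgue K * ((fst P K - P' K) / \<Delta>t) + (\<Sum>\<sigma>\<in>edges_of \<M> K. flux_P \<M> \<Gamma>D P \<Psi> K \<sigma>) = 0"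
    and eqPsi: "\<And>K. K \<in> \<T> \<Longrightarrow>
      - (lam\<^sup>2) * (\<Sum>\<sigma>\<in>edges_of \<M> K. \<tau> \<sigma> * D \<Psi> K \<sigma>) = measure lebesgue K * (fst P K - fst N K)"
    and K: "K \<in> \<T>"
  shows "m \<le> fst N K \<and> fst N K \<le> M \<and> m \<le> fst P K \<and> fst P K \<le> M"
proof -
  have eqP': "measure lebesgue K * ((fst P K - P' K) / \<Delta>t)
      + (\<Sum>\<sigma>\<in>edges_of \<M> K. flux P (dvec_uminus \<Psi>) K \<sigma>) = 0"
    if "K \<in> \<T>" for K using eqP[OF that] unfolding flux_P_eq .
  define S where "S K = (\<Sum>\<sigma>\<in>edges_of \<M> K. \<tau> \<sigma> * D \<Psi> K \<sigma>)" for K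
  have S': "(\<Sum>\<sigma>\<in>edges_of \<M> K. \<tau> \<sigma> * D (dvec_uminus \<Psi>) K \<sigma>) = - S K" for K
    by (simp add: S_def Dd_uminus sum_negf)
  have N0: "0 \<le> fst N K" if "K \<in> \<T>" for K
    by (rule scheme_nonneg[OF \<Delta>t _ _ eqN that]) (use old bd m in force)+
  have P0: "0 \<le> fst P K" if "K \<in> \<T>" for K
    by (rule scheme_nonneg[OF \<Delta>t _ _ eqP' that]) (use old bd m in force)+
  \<comment> \<open>The case distinction is on the sign of \<open>S K\<close> and not on the order
    of the densities: for \<lambda> = 0 the densities agree while \<open>S K\<close> may have either
    sign.\<close>
  have sgn: "(fst N K \<ge> fst P K \<and> S K \<ge> 0) \<or> (fst P K \<ge> fst N K \<and> S K \<le> 0)" if "K \<in> \<T>" for K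
  proof -
    have e: "- (lam\<^sup>2) * S K = measure lebesgue K * (fst P K - fst N K)" using eqPsi[OF that] by (simp add: S_def)
    have "fst N K \<ge> fst P K" if "S K \<ge> 0"
      using e that measure_pos[OF \<open>K \<in> \<T>\<close>]
      by (smt (verit) mult_nonneg_nonneg mult_minus_left mult_pos_pos zero_le_power2)
    moreover have "fst P K \<ge> fst N K" if "S K \<le> 0"
    proof -
      have "0 \<le> - (lam\<^sup>2) * S K" using that by (simp add: mult_nonneg_nonpos)
      then have "0 \<le> measure lebesgue K * (fst P K - fst N K)" unfolding e .
      then show ?thesis using measure_pos[OF \<open>K \<in> \<T>\<close>] by (simp add: zero_le_mult_iff)
    qed
    ultimately show ?thesis by linarith
  qed
  have "\<T> \<noteq> {}" using K by auto
  obtain K1 where K1: "K1 \<in> \<T>" "\<And>L. L \<in> \<T> \<Longrightarrow> max (fst N L) (fst P L) \<le> max (fst N K1) (fst P K1)"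
    using obtains_MAX[OF finite_cells \<open>\<T> \<noteq> {}\<close>, of "\<lambda>L. max (fst N L) (fst P L)"]
      Max_ge finite_cells by (smt (verit) finite_imageI imageI)
  obtain K2 where K2: "K2 \<in> \<T>" "\<And>L. L \<in> \<T> \<Longrightarrow> min (fst N K2) (fst P K2) \<le> min (fst N L) (fst P L)"
    using obtains_MIN[OF finite_cells \<open>\<T> \<noteq> {}\<close>, of "\<lambda>L. min (fst N L) (fst P L)"]
      Min_le finite_cells by (smt (verit) finite_imageI imageI)
  have up: "max (fst N K1) (fst P K1) \<le> M"
    using sgn[OF K1(1)]
  proof
    assume a: "fst P K1 \<le> fst N K1 \<and> 0 \<le> S K1"
    have "fst N K1 \<le> M"
    proof (rule scheme_upper[where N' = N' and N = N, OF \<Delta>t K1(1) _ eqN[OF K1(1)]])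
      show "fst N L \<le> fst N K1" if "L \<in> \<T>" for L using K1(2)[OF that] a by simp
    qed (use old[OF K1(1)] bd N0[OF K1(1)] a in \<open>auto simp: S_def\<close>)
    then show ?thesis using a by simp
  next
    assume a: "fst N K1 \<le> fst P K1 \<and> S K1 \<le> 0"
    have "fst P K1 \<le> M"
    proof (rule scheme_upper[where N' = P' and N = P, OF \<Delta>t K1(1) _ eqP'[OF K1(1)]])
      show "fst P L \<le> fst P K1" if "L \<in> \<T>" for L using K1(2)[OF that] a by simp
    qed (use old[OF K1(1)] bd P0[OF K1(1)] a in \<open>auto simp: S'\<close>)
    then show ?thesis using a by simp
  qed
  have lo: "m \<le> min (fst N K2) (fst P K2)"
    using sgn[OF K2(1)]
  proof
    assume a: "fst P K2 \<le> fst N K2 \<and> 0 \<le> S K2"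
    have "m \<le> fst P K2"
    proof (rule scheme_lower[where N' = P' and N = P, OF \<Delta>t K2(1) _ eqP'[OF K2(1)]])
      show "fst P K2 \<le> fst P L" if "L \<in> \<T>" for L using K2(2)[OF that] a by simp
    qed (use old[OF K2(1)] bd P0[OF K2(1)] a in \<open>auto simp: S'\<close>)
    then show ?thesis using a by simp
  next
    assume a: "fst N K2 \<le> fst P K2 \<and> S K2 \<le> 0"
    have "m \<le> fst N K2"
    proof (rule scheme_lower[where N' = N' and N = N, OF \<Delta>t K2(1) _ eqN[OF K2(1)]])
      show "fst N K2 \<le> fst N L" if "L \<in> \<T>" for L using K2(2)[OF that] a by simp
    qed (use old[OF K2(1)] bd N0[OF K2(1)] a in \<open>auto simp: S_def\<close>)
    then show ?thesis using a by simp
  qed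
  show ?thesis using up lo K1(2)[OF K] K2(2)[OF K] by auto
qed

section \<open>Dissipation of the entropy over one time step\<close>

lemma rel_entropy_diff_le:
  assumes "\<And>K. K \<in> \<T> \<Longrightarrow> N K > 0 \<and> N' K > 0"
  shows "rel_entropy \<M> f N - rel_entropy \<M> f N'
     \<le> (\<Sum>K\<in>\<T>. measure lebesgue K * ((ln (N K) - ln (cell_avg f K)) * (N K - N' K)))"
  unfolding rel_entropy_def sum_subtractf[symmetric] right_diff_distrib[symmetric]
proof (intro sum_mono mult_left_mono)
  fix K assume K: "K \<in> \<T>"
  have "Hfun (N K) - Hfun (N' K) \<le> ln (N K) * (N K - N' K)"
    using assms[OF K] by (intro Hfun_diff_le) auto
  then show "Hfun (N K) - Hfun (cell_avg f K) - ln (cell_avg f K) * (N K - cell_avg f K) -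
      (Hfun (N' K) - Hfun (cell_avg f K) - ln (cell_avg f K) * (N' K - cell_avg f K))
      \<le> (ln (N K) - ln (cell_avg f K)) * (N K - N' K)"
    by (simp add: algebra_simps)
qed (use measure_pos in force)

text \<open>The vector \<open>u\<close> is known only through its jump across the edge. This lets
  the estimate serve log N - \<Psi> and, with the potential reversed, log P + \<Psi>.\<close>

lemma edge_dissipation:
  assumes s: "\<sigma> \<in> \<E>"
    and w: "D u (cell \<sigma>) \<sigma>
      = ln (val N (cell \<sigma>) \<sigma>) - ln (fst N (cell \<sigma>)) - D \<Psi> (cell \<sigma>) \<sigma>"
    and cell: "\<And>K. K \<in> \<T> \<Longrightarrow> 0 < fst N K \<and> fst N K \<le> M"
    and bd: "\<And>\<sigma>. \<sigma> \<in> \<E> \<Longrightarrow> \<not> interior_edge \<M> \<sigma> \<Longrightarrow> \<sigma> \<subseteq> \<Gamma>D \<Longrightarrow> 0 < snd N \<sigma> \<and> snd N \<sigma> \<le> M"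
  shows "flux N \<Psi> (cell \<sigma>) \<sigma> * D (dmap2 (-) u v) (cell \<sigma>) \<sigma>
    \<le> M / 2 * (\<tau> \<sigma> * (D v (cell \<sigma>) \<sigma>)\<^sup>2)
      - 1 / 2 * (\<tau> \<sigma> * (min (fst N (cell \<sigma>)) (val N (cell \<sigma>) \<sigma>) * (Dabs \<M> \<Gamma>D u \<sigma>)\<^sup>2))"
proof -
  let ?K = "cell \<sigma>"
  have K: "?K \<in> \<T>" using cell_of_in[OF s] .
  have o: "0 < val N ?K \<sigma> \<and> val N ?K \<sigma> \<le> M"
    using cell[OF K] bd[OF s] cell[OF nbr_in[OF s]] by (auto simp: opp_def)
  let ?n1 = "fst N ?K" and ?n2 = "val N ?K \<sigma>" and ?y = "D \<Psi> ?K \<sigma>" and ?\<delta> = "D v ?K \<sigma>"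
  have "(Bern (- ?y) * ?n1 - Bern ?y * ?n2) * ((ln ?n2 - ln ?n1 - ?y) - ?\<delta>)
      \<le> - (1/2) * (min ?n1 ?n2 * (ln ?n2 - ln ?n1 - ?y)\<^sup>2) + M / 2 * ?\<delta>\<^sup>2"
    by (rule flux_dissipation) (use o cell[OF K] in auto)
  from mult_left_mono[OF this transm_nonneg[OF s]]
  show ?thesis unfolding flux_N_def Dd_diff w[symmetric] Dabs_def power2_abs
    by (simp add: algebra_simps)
qed

lemma entropy_step:
  assumes \<Delta>t: "\<Delta>t > 0"
    and old: "\<And>K. K \<in> \<T> \<Longrightarrow> 0 < N' K \<and> 0 < P' K"
    and new: "\<And>K. K \<in> \<T> \<Longrightarrow> 0 < N K \<and> N K \<le> M \<and> 0 < P K \<and> P K \<le> M"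
    and bd: "\<And>\<sigma>. \<sigma> \<in> \<E> \<Longrightarrow> \<not> interior_edge \<M> \<sigma> \<Longrightarrow> \<sigma> \<subseteq> \<Gamma>D \<Longrightarrow>
      0 < edge_avg ND \<sigma> \<and> edge_avg ND \<sigma> \<le> M \<and> 0 < edge_avg PD \<sigma> \<and> edge_avg PD \<sigma> \<le> M"
    and eqN: "\<And>K. K \<in> \<T> \<Longrightarrow> measure lebesgue K * ((N K - N' K) / \<Delta>t)
        + (\<Sum>\<sigma>\<in>edges_of \<M> K. flux (with_bd ND N) (with_bd PsiD \<Psi>) K \<sigma>) = 0"
    and eqP: "\<And>K. K \<in> \<T> \<Longrightarrow> measure lebesgue K * ((P K - P' K) / \<Delta>t)
        + (\<Sum>\<sigma>\<in>edges_of \<M> K. flux_P \<M> \<Gamma>D (with_bd PD P) (with_bd PsiD \<Psi>) K \<sigma>) = 0"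
    and eqPsi: "\<And>K. K \<in> \<T> \<Longrightarrow>
      - (lam\<^sup>2) * (\<Sum>\<sigma>\<in>edges_of \<M> K. \<tau> \<sigma> * D (with_bd PsiD \<Psi>) K \<sigma>) = measure lebesgue K * (P K - N K)"
    and eqPsi': "\<And>K. K \<in> \<T> \<Longrightarrow>
      - (lam\<^sup>2) * (\<Sum>\<sigma>\<in>edges_of \<M> K. \<tau> \<sigma> * D (with_bd PsiD \<Psi>') K \<sigma>) = measure lebesgue K * (P' K - N' K)"
  defines "vN \<equiv> dmap2 (\<lambda>s t. ln s - t) (with_bd ND (cell_avg ND)) (with_bd PsiD (cell_avg PsiD))"
    and "vP \<equiv> dmap2 (\<lambda>s t. ln s + t) (with_bd PD (cell_avg PD)) (with_bd PsiD (cell_avg PsiD))"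
  shows "(entropy \<M> \<Gamma>D lam ND PD PsiD N P \<Psi> - entropy \<M> \<Gamma>D lam ND PD PsiD N' P' \<Psi>') / \<Delta>t
       + 1 / 2 * entropy_production \<M> \<Gamma>D ND PD PsiD N P \<Psi>
     \<le> M / 2 * (snorm vN + snorm vP)"
proof -
  define S where "S = with_bd PsiD \<Psi>"
  define S' where "S' = with_bd PsiD \<Psi>'"
  define SD where "SD = with_bd PsiD (cell_avg PsiD)"
  define V where "V = dmap2 (-) S SD"
  define V' where "V' = dmap2 (-) S' SD"
  define uN where "uN = dmap2 (\<lambda>s t. ln s - t) (with_bd ND N) S"
  define uP where "uP = dmap2 (\<lambda>s t. ln s + t) (with_bd PD P) S"
  define wN where "wN = dmap2 (-) uN vN"
  define wP where "wP = dmap2 (-) uP vP"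
  let ?c = "cell"
  define F where "F = flux (with_bd ND N) S"
  define G where "G = flux (with_bd PD P) (dvec_uminus S)"
  have F: "measure lebesgue K * (N K - N' K) = - \<Delta>t * (\<Sum>\<sigma>\<in>edges_of \<M> K. F K \<sigma>)" if "K \<in> \<T>" for K
    using eqN[OF that] \<Delta>t unfolding F_def S_def by (simp add: field_simps)
  have G: "measure lebesgue K * (P K - P' K) = - \<Delta>t * (\<Sum>\<sigma>\<in>edges_of \<M> K. G K \<sigma>)" if "K \<in> \<T>" for K
    using eqP[OF that] \<Delta>t unfolding G_def S_def flux_P_eq by (simp add: field_simps)
  have "lam\<^sup>2 / 2 * snorm V - lam\<^sup>2 / 2 * snorm V'
      = (\<Sum>\<sigma>\<in>\<E>. lam\<^sup>2 / 2 * (\<tau> \<sigma> * ((D V (?c \<sigma>) \<sigma>)\<^sup>2 - (D V' (?c \<sigma>) \<sigma>)\<^sup>2)))"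
    by (simp add: seminorm1_sq_def Dabs_def sum_distrib_left sum_subtractf[symmetric] algebra_simps)
  \<comment> \<open>This is a^2 - b^2 \<le> 2 (a - b) a for the new and old gradients a and b. The
    reference potential \<open>SD\<close> is the same at both times and cancels in a - b.\<close>
  also have "\<dots> \<le> (\<Sum>\<sigma>\<in>\<E>. lam\<^sup>2 / 2 * (\<tau> \<sigma> *
        (2 * ((D S (?c \<sigma>) \<sigma> - D S' (?c \<sigma>) \<sigma>) * D V (?c \<sigma>) \<sigma>))))"
  proof (intro sum_mono mult_left_mono)
    fix \<sigma>
    have *: "D S (?c \<sigma>) \<sigma> - D S' (?c \<sigma>) \<sigma> = D V (?c \<sigma>) \<sigma> - D V' (?c \<sigma>) \<sigma>"
      by (simp add: V_def V'_def Dd_diff)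
    have "0 \<le> (D V (?c \<sigma>) \<sigma> - D V' (?c \<sigma>) \<sigma>)\<^sup>2" by simp
    then show "(D V (?c \<sigma>) \<sigma>)\<^sup>2 - (D V' (?c \<sigma>) \<sigma>)\<^sup>2
      \<le> 2 * ((D S (?c \<sigma>) \<sigma> - D S' (?c \<sigma>) \<sigma>) * D V (?c \<sigma>) \<sigma>)"
      unfolding * by (simp add: power2_eq_square algebra_simps)
  qed (simp_all add: transm_nonneg)
  also have "\<dots> = lam\<^sup>2 * (\<Sum>\<sigma>\<in>\<E>. \<tau> \<sigma> * (D S (?c \<sigma>) \<sigma> - D S' (?c \<sigma>) \<sigma>) * D V (?c \<sigma>) \<sigma>)"
    by (simp add: sum_distrib_left mult_ac)
  \<comment> \<open>\<open>V\<close> vanishes on Dirichlet edges, so the gradient can be moved off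
    it. What results is the discrete Laplacian of the increment of the potential, which the Poisson
    equation at both time levels turns into the increment of the charge.\<close>
  also have "\<dots> = - lam\<^sup>2 * (\<Sum>K\<in>\<T>. fst V K * (\<Sum>\<sigma>\<in>edges_of \<M> K. \<tau> \<sigma> * (D S K \<sigma> - D S' K \<sigma>)))"
    by (subst summation_by_parts) (simp_all add: Dd_nbr Dd_neumann V_def SD_def S_def right_diff_distrib)
  also have "\<dots> = (\<Sum>K\<in>\<T>. fst V K * (measure lebesgue K * ((P K - P' K) - (N K - N' K))))"
    unfolding sum_distrib_left[where A = "\<T>"]
  proof (rule sum.cong[OF refl])
    fix K assume K: "K \<in> \<T>"
    have "- lam\<^sup>2 * (\<Sum>\<sigma>\<in>edges_of \<M> K. \<tau> \<sigma> * (D S K \<sigma> - D S' K \<sigma>))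
       = - lam\<^sup>2 * (\<Sum>\<sigma>\<in>edges_of \<M> K. \<tau> \<sigma> * D S K \<sigma>)
         - (- lam\<^sup>2 * (\<Sum>\<sigma>\<in>edges_of \<M> K. \<tau> \<sigma> * D S' K \<sigma>))"
      by (simp add: right_diff_distrib sum_subtractf)
    also have "\<dots> = measure lebesgue K * ((P K - P' K) - (N K - N' K))"
      unfolding S_def S'_def eqPsi[OF K] eqPsi'[OF K] by (simp add: algebra_simps)
    finally have *: "- lam\<^sup>2 * (\<Sum>\<sigma>\<in>edges_of \<M> K. \<tau> \<sigma> * (D S K \<sigma> - D S' K \<sigma>))
       = measure lebesgue K * ((P K - P' K) - (N K - N' K))" .
    show "- lam\<^sup>2 * (fst V K * (\<Sum>\<sigma>\<in>edges_of \<M> K. \<tau> \<sigma> * (D S K \<sigma> - D S' K \<sigma>)))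
       = fst V K * (measure lebesgue K * ((P K - P' K) - (N K - N' K)))"
      unfolding *[symmetric] by (simp only: mult_ac)
  qed
  finally have psi: "lam\<^sup>2 / 2 * snorm V - lam\<^sup>2 / 2 * snorm V'
    \<le> (\<Sum>K\<in>\<T>. fst V K * (measure lebesgue K * ((P K - P' K) - (N K - N' K))))" .
  have "entropy \<M> \<Gamma>D lam ND PD PsiD N P \<Psi> - entropy \<M> \<Gamma>D lam ND PD PsiD N' P' \<Psi>'
    \<le> (\<Sum>K\<in>\<T>. measure lebesgue K * ((ln (N K) - ln (cell_avg ND K)) * (N K - N' K)))
      + (\<Sum>K\<in>\<T>. measure lebesgue K * ((ln (P K) - ln (cell_avg PD K)) * (P K - P' K)))
      + (\<Sum>K\<in>\<T>. fst V K * (measure lebesgue K * ((P K - P' K) - (N K - N' K))))"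
    using psi rel_entropy_diff_le[of N N' ND] rel_entropy_diff_le[of P P' PD] old new
    unfolding entropy_def V_def V'_def S_def S'_def SD_def by force
  \<comment> \<open>The charge term puts \<open>- V\<close> in front of the increment of
    \<open>N\<close> and \<open>+ V\<close> in front of that of \<open>P\<close>. This completes the
    logarithms to the test vectors, log N - \<Psi> and log P + \<Psi> minus their values for the
    data.\<close>
  also have "\<dots> = (\<Sum>K\<in>\<T>. fst wN K * (measure lebesgue K * (N K - N' K)))
     + (\<Sum>K\<in>\<T>. fst wP K * (measure lebesgue K * (P K - P' K)))"
    unfolding sum.distrib[symmetric]
    by (rule sum.cong[OF refl])
      (simp add: wN_def wP_def uN_def uP_def vN_def vP_def V_def S_def SD_def algebra_simps)
  also have "\<dots> = - \<Delta>t * ((\<Sum>K\<in>\<T>. fst wN K * (\<Sum>\<sigma>\<in>edges_of \<M> K. F K \<sigma>))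
     + (\<Sum>K\<in>\<T>. fst wP K * (\<Sum>\<sigma>\<in>edges_of \<M> K. G K \<sigma>)))"
    by (simp add: F G distrib_left sum_distrib_left[where A = "\<T>"] sum_negf mult.left_commute)
  also have "(\<Sum>K\<in>\<T>. fst wN K * (\<Sum>\<sigma>\<in>edges_of \<M> K. F K \<sigma>))
     = - (\<Sum>\<sigma>\<in>\<E>. F (?c \<sigma>) \<sigma> * D wN (?c \<sigma>) \<sigma>)"
    unfolding F_def by (rule flux_by_parts) (simp_all add: wN_def uN_def vN_def S_def SD_def)
  also have "(\<Sum>K\<in>\<T>. fst wP K * (\<Sum>\<sigma>\<in>edges_of \<M> K. G K \<sigma>))
     = - (\<Sum>\<sigma>\<in>\<E>. G (?c \<sigma>) \<sigma> * D wP (?c \<sigma>) \<sigma>)"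
    unfolding G_def by (rule flux_by_parts) (simp_all add: wP_def uP_def vP_def S_def SD_def)
  finally have 1: "(entropy \<M> \<Gamma>D lam ND PD PsiD N P \<Psi> - entropy \<M> \<Gamma>D lam ND PD PsiD N' P' \<Psi>') / \<Delta>t
     \<le> (\<Sum>\<sigma>\<in>\<E>. F (?c \<sigma>) \<sigma> * D wN (?c \<sigma>) \<sigma> + G (?c \<sigma>) \<sigma> * D wP (?c \<sigma>) \<sigma>)"
    using \<Delta>t by (simp add: field_simps sum.distrib)
  also have "\<dots> \<le> (\<Sum>\<sigma>\<in>\<E>.
      (M / 2 * (\<tau> \<sigma> * (D vN (?c \<sigma>) \<sigma>)\<^sup>2)
        - 1 / 2 * (\<tau> \<sigma> * (min (N (?c \<sigma>)) (val (with_bd ND N) (?c \<sigma>) \<sigma>) * (Dabs \<M> \<Gamma>D uN \<sigma>)\<^sup>2)))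
      + (M / 2 * (\<tau> \<sigma> * (D vP (?c \<sigma>) \<sigma>)\<^sup>2)
        - 1 / 2 * (\<tau> \<sigma> * (min (P (?c \<sigma>)) (val (with_bd PD P) (?c \<sigma>) \<sigma>) * (Dabs \<M> \<Gamma>D uP \<sigma>)\<^sup>2))))"
  proof (intro sum_mono add_mono)
    fix \<sigma> assume s: "\<sigma> \<in> \<E>"
    show "F (?c \<sigma>) \<sigma> * D wN (?c \<sigma>) \<sigma> \<le> M / 2 * (\<tau> \<sigma> * (D vN (?c \<sigma>) \<sigma>)\<^sup>2)
        - 1 / 2 * (\<tau> \<sigma> * (min (N (?c \<sigma>)) (val (with_bd ND N) (?c \<sigma>) \<sigma>) * (Dabs \<M> \<Gamma>D uN \<sigma>)\<^sup>2))"
      unfolding F_def wN_def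
      by (rule edge_dissipation[OF s, of _ "with_bd ND N", simplified with_bd_simps])
        (use new bd in \<open>auto simp: uN_def Dd_def opp_def\<close>)
    show "G (?c \<sigma>) \<sigma> * D wP (?c \<sigma>) \<sigma> \<le> M / 2 * (\<tau> \<sigma> * (D vP (?c \<sigma>) \<sigma>)\<^sup>2)
        - 1 / 2 * (\<tau> \<sigma> * (min (P (?c \<sigma>)) (val (with_bd PD P) (?c \<sigma>) \<sigma>) * (Dabs \<M> \<Gamma>D uP \<sigma>)\<^sup>2))"
      unfolding G_def wP_def
      by (rule edge_dissipation[OF s, of _ "with_bd PD P", simplified with_bd_simps])
        (use new bd in \<open>auto simp: uP_def Dd_uminus, auto simp: Dd_def opp_def\<close>)
  qed
  also have "\<dots> = M / 2 * (snorm vN + snorm vP)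
     - 1 / 2 * entropy_production \<M> \<Gamma>D ND PD PsiD N P \<Psi>"
    unfolding seminorm1_sq_def entropy_production_def uN_def uP_def S_def
    by (simp add: Dabs_def sum.distrib sum_subtractf sum_distrib_left algebra_simps)
  finally show ?thesis by (simp only: le_diff_eq)
qed

section \<open>Bounds for the entropy, the initial potential and the logarithms of the data\<close>

text \<open>The tangent inequality for \<open>ln\<close>, applied in both directions, places the
  relative entropy density of a with respect to b between 0 and (a - b)^2 / b. Here |a - b| \<le> M
  and b \<ge> m.\<close>

lemma rel_entropy_bounds:
  assumes m: "0 < m" and f: "\<And>K. K \<in> \<T> \<Longrightarrow> m \<le> cell_avg f K \<and> cell_avg f K \<le> M"
    and N: "\<And>K. K \<in> \<T> \<Longrightarrow> m \<le> N K \<and> N K \<le> M"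
  shows "0 \<le> rel_entropy \<M> f N" "rel_entropy \<M> f N \<le> M\<^sup>2 / m * (\<Sum>K\<in>\<T>. measure lebesgue K)"
proof -
  have "0 \<le> Hfun a - Hfun b - ln b * (a - b) \<and> Hfun a - Hfun b - ln b * (a - b) \<le> M\<^sup>2 / m"
    if "m \<le> a" "a \<le> M" "m \<le> b" "b \<le> M" for a b
  proof
    have a: "0 < a" "0 < b" using that m by auto
    show "0 \<le> Hfun a - Hfun b - ln b * (a - b)"
      using ln_tangent[OF a(2) a(1)] by (simp add: Hfun_def algebra_simps)
    have "a * (b * (ln a - ln b)) \<le> a * (a - b)"
      using a by (intro mult_left_mono ln_tangent) auto
    then have "b * (Hfun a - Hfun b - ln b * (a - b)) \<le> (a - b)\<^sup>2"
      by (simp add: Hfun_def power2_eq_square algebra_simps)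
    then have "Hfun a - Hfun b - ln b * (a - b) \<le> (a - b)\<^sup>2 / b" using a by (simp add: field_simps)
    also have "\<dots> \<le> M\<^sup>2 / m"
    proof (rule frac_le)
      have "\<bar>a - b\<bar>\<^sup>2 \<le> M\<^sup>2" by (rule power_mono) (use that a in auto)
      then show "(a - b)\<^sup>2 \<le> M\<^sup>2" by simp
    qed (use that m in auto)
    finally show "Hfun a - Hfun b - ln b * (a - b) \<le> M\<^sup>2 / m" .
  qed
  note * = this[OF conjunct1[OF N] conjunct2[OF N] conjunct1[OF f] conjunct2[OF f]]
  show "0 \<le> rel_entropy \<M> f N" unfolding rel_entropy_def
    using * by (intro sum_nonneg mult_nonneg_nonneg) auto
  show "rel_entropy \<M> f N \<le> M\<^sup>2 / m * (\<Sum>K\<in>\<T>. measure lebesgue K)"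
    unfolding rel_entropy_def sum_distrib_left mult.commute[of "M\<^sup>2 / m"]
    using * by (intro sum_mono mult_left_mono) auto
qed

lemma seminorm1_sq_nonneg: "snorm u \<ge> 0"
  unfolding seminorm1_sq_def by (intro sum_nonneg) (auto simp: transm_nonneg)

text \<open>Under quasi-neutrality the initial potential is discretely harmonic, so it minimises the
  Dirichlet energy among all vectors with the same boundary values.\<close>

lemma initial_potential:
  assumes "\<And>K. K \<in> \<T> \<Longrightarrow> (\<Sum>\<sigma>\<in>edges_of \<M> K. \<tau> \<sigma> * D (with_bd f u) K \<sigma>) = 0"
  shows "snorm (dmap2 (-) (with_bd f u) (with_bd f w)) \<le> snorm (with_bd f w)"
proof -
  let ?V = "dmap2 (-) (with_bd f u) (with_bd f w)" and ?c = "cell"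
  have "(\<Sum>K\<in>\<T>. fst ?V K * (\<Sum>\<sigma>\<in>edges_of \<M> K. \<tau> \<sigma> * D (with_bd f u) K \<sigma>))
     = - (\<Sum>\<sigma>\<in>\<E>. \<tau> \<sigma> * D (with_bd f u) (?c \<sigma>) \<sigma> * D ?V (?c \<sigma>) \<sigma>)"
    by (rule summation_by_parts) (simp_all add: Dd_nbr Dd_neumann)
  \<comment> \<open>Orthogonality: the gradient of a discretely harmonic vector is orthogonal to the
    gradient of any vector that vanishes on the Dirichlet edges.\<close>
  then have 0: "(\<Sum>\<sigma>\<in>\<E>. \<tau> \<sigma> * D (with_bd f u) (?c \<sigma>) \<sigma> * D ?V (?c \<sigma>) \<sigma>) = 0"
    by (simp add: assms)
  have "snorm ?V - snorm (with_bd f w)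
      = (\<Sum>\<sigma>\<in>\<E>. \<tau> \<sigma> * ((D ?V (?c \<sigma>) \<sigma>)\<^sup>2 - (D (with_bd f w) (?c \<sigma>) \<sigma>)\<^sup>2))"
    by (simp add: seminorm1_sq_def Dabs_def right_diff_distrib sum_subtractf)
  also have "\<dots> \<le> (\<Sum>\<sigma>\<in>\<E>. \<tau> \<sigma> * (2 * (D (with_bd f u) (?c \<sigma>) \<sigma> * D ?V (?c \<sigma>) \<sigma>)))"
  proof (intro sum_mono mult_left_mono)
    fix \<sigma>
    have "0 \<le> (D (with_bd f u) (?c \<sigma>) \<sigma>)\<^sup>2" by simp
    then show "(D ?V (?c \<sigma>) \<sigma>)\<^sup>2 - (D (with_bd f w) (?c \<sigma>) \<sigma>)\<^sup>2
      \<le> 2 * (D (with_bd f u) (?c \<sigma>) \<sigma> * D ?V (?c \<sigma>) \<sigma>)"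
      unfolding Dd_diff by (simp add: power2_eq_square algebra_simps)
  qed (simp add: transm_nonneg)
  also have "\<dots> = 2 * (\<Sum>\<sigma>\<in>\<E>. \<tau> \<sigma> * D (with_bd f u) (?c \<sigma>) \<sigma> * D ?V (?c \<sigma>) \<sigma>)"
    by (simp add: sum_distrib_left mult_ac)
  finally show ?thesis using 0 by simp
qed

text \<open>Above \<open>m\<close> the logarithm has Lipschitz constant 1/m, and the square of a sum
  or difference costs a factor 2. The function \<open>g\<close> treats log N - \<Psi> and log P +
  \<Psi> together.\<close>

lemma seminorm1_sq_ln:
  assumes m: "0 < m" and cell: "\<And>K. K \<in> \<T> \<Longrightarrow> m \<le> fst u K"
    and bd: "\<And>\<sigma>. \<sigma> \<in> \<E> \<Longrightarrow> \<not> interior_edge \<M> \<sigma> \<Longrightarrow> \<sigma> \<subseteq> \<Gamma>D \<Longrightarrow> m \<le> snd u \<sigma>"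
    and g: "g = (\<lambda>s t. s - t) \<or> g = (\<lambda>s t. s + t)"
  shows "snorm (dmap2 (\<lambda>s t. g (ln s) t) u v)
    \<le> 2 / m\<^sup>2 * snorm u + 2 * snorm v"
proof -
  let ?c = "cell"
  have "\<tau> \<sigma> * (D (dmap2 (\<lambda>s t. g (ln s) t) u v) (?c \<sigma>) \<sigma>)\<^sup>2
    \<le> \<tau> \<sigma> * (2 / m\<^sup>2 * (D u (?c \<sigma>) \<sigma>)\<^sup>2 + 2 * (D v (?c \<sigma>) \<sigma>)\<^sup>2)"
    if s: "\<sigma> \<in> \<E>" for \<sigma>
  proof (rule mult_left_mono[OF _ transm_nonneg[OF s]])
    let ?a = "ln (val u (?c \<sigma>) \<sigma>) - ln (fst u (?c \<sigma>))" and ?b = "D v (?c \<sigma>) \<sigma>"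
    have "m \<le> val u (?c \<sigma>) \<sigma>"
      using cell[OF cell_of_in[OF s]] bd[OF s] cell[OF nbr_in[OF s]] by (auto simp: opp_def)
    then have "?a\<^sup>2 \<le> (D u (?c \<sigma>) \<sigma>)\<^sup>2 / m\<^sup>2"
      unfolding Dd_def using cell[OF cell_of_in[OF s]] m by (intro ln_diff_sq_le) auto
    moreover have "D (dmap2 (\<lambda>s t. g (ln s) t) u v) (?c \<sigma>) \<sigma> = g ?a ?b"
      using g by (auto simp: Dd_def opp_def)
    moreover have "(g ?a ?b)\<^sup>2 \<le> 2 * ?a\<^sup>2 + 2 * ?b\<^sup>2"
      using g sum_squares_bound[of ?a ?b] sum_squares_bound[of ?a "- ?b"]
      by (auto simp: power2_eq_square algebra_simps)
    ultimately show "(D (dmap2 (\<lambda>s t. g (ln s) t) u v) (?c \<sigma>) \<sigma>)\<^sup>2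
      \<le> 2 / m\<^sup>2 * (D u (?c \<sigma>) \<sigma>)\<^sup>2 + 2 * ?b\<^sup>2"
      by simp
  qed
  then have "snorm (dmap2 (\<lambda>s t. g (ln s) t) u v)
    \<le> (\<Sum>\<sigma>\<in>\<E>. \<tau> \<sigma> * (2 / m\<^sup>2 * (D u (?c \<sigma>) \<sigma>)\<^sup>2 + 2 * (D v (?c \<sigma>) \<sigma>)\<^sup>2))"
    unfolding seminorm1_sq_def Dabs_def power2_abs by (rule sum_mono)
  also have "\<dots> = 2 / m\<^sup>2 * snorm u + 2 * snorm v"
    by (simp add: seminorm1_sq_def Dabs_def sum.distrib sum_distrib_left algebra_simps)
  finally show ?thesis .
qed

end

section \<open>Geometry of regular admissible meshes\<close>

definition proj_hyperplane :: "'a::euclidean_space \<Rightarrow> real \<Rightarrow> 'a \<Rightarrow> 'a" where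
  "proj_hyperplane a c x = x - (a \<bullet> x - c) *\<^sub>R a"

text \<open>The surface measure before completion. Fubini arguments and measurability of
  compositions are carried out on this Borel measure, and nonnegative integrals are then transferred
  to the completed one.\<close>

definition hyperplane_borel :: "'a::euclidean_space \<Rightarrow> real \<Rightarrow> 'a measure" where
  "hyperplane_borel a c =
     distr (restrict_space lborel {x. c \<le> a \<bullet> x \<and> a \<bullet> x \<le> c + 1}) borel (proj_hyperplane a c)"

lemma hyperplane_measure_eq: "hyperplane_measure a c = completion (hyperplane_borel a c)"
  unfolding hyperplane_measure_def hyperplane_borel_def proj_hyperplane_def ..

lemma sets_hyperplane_borel [simp, measurable_cong]: "sets (hyperplane_borel a c) = sets borel"
  by (simp add: hyperplane_borel_def)

lemma space_hyperplane [simp]: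
  "space (hyperplane_borel a c) = UNIV" "space (hyperplane_measure a c) = UNIV"
  by (simp_all add: hyperplane_borel_def hyperplane_measure_eq)

lemma slab_sets [measurable]: "{x::'a::euclidean_space. c \<le> a \<bullet> x \<and> a \<bullet> x \<le> d} \<in> sets borel"
proof -
  have "closed ({x. c \<le> a \<bullet> x} \<inter> {x. a \<bullet> x \<le> d})"
    using closed_halfspace_le[of a d] closed_halfspace_ge[of c a] by (intro closed_Int) auto
  then show ?thesis by (simp add: Collect_conj_eq borel_closed)
qed

lemma proj_hyperplane_measurable [measurable]: "proj_hyperplane a c \<in> borel_measurable borel"
  unfolding proj_hyperplane_def[abs_def] by measurable

lemma emeasure_hyperplane_borel:
  assumes "A \<in> sets borel"
  shows "emeasure (hyperplane_borel a c) A
    = emeasure lborel ({x. c \<le> a \<bullet> x \<and> a \<bullet> x \<le> c + 1} \<inter> proj_hyperplane a c -` A)"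
proof -
  have "emeasure (hyperplane_borel a c) A
      = emeasure (restrict_space lborel {x. c \<le> a \<bullet> x \<and> a \<bullet> x \<le> c + 1})
          (proj_hyperplane a c -` A \<inter> {x. c \<le> a \<bullet> x \<and> a \<bullet> x \<le> c + 1})"
    unfolding hyperplane_borel_def
    by (subst emeasure_distr) (use assms in \<open>auto intro!: measurable_restrict_space1 simp: space_restrict_space\<close>)
  also have "\<dots> = emeasure lborel ({x. c \<le> a \<bullet> x \<and> a \<bullet> x \<le> c + 1} \<inter> proj_hyperplane a c -` A)"
    by (subst emeasure_restrict_space) (auto simp: Int_commute)
  finally show ?thesis .
qed

lemma emeasure_hyperplane_measure:
  "A \<in> sets borel \<Longrightarrow> emeasure (hyperplane_measure a c) A = emeasure (hyperplane_borel a c) A"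
  unfolding hyperplane_measure_eq by (simp add: emeasure_completion)

text \<open>Projection along \<open>a\<close> does not change \<open>b \<bullet> x\<close>, so the
  cylinder over the set lies in a hyperplane of the full space, which is a Lebesgue null
  set.\<close>

lemma hyperplane_measure_null:
  assumes "b \<bullet> a = 0" "b \<noteq> 0"
  shows "emeasure (hyperplane_measure a c) {x. b \<bullet> x = k} = 0"
proof -
  have m: "{x. b \<bullet> x = k} \<in> sets borel" by (intro borel_closed closed_hyperplane)
  have "emeasure (hyperplane_borel a c) {x. b \<bullet> x = k} \<le> emeasure lborel {x. b \<bullet> x = k}"
    unfolding emeasure_hyperplane_borel[OF m]
    by (rule emeasure_mono) (use assms m in \<open>auto simp: proj_hyperplane_def inner_diff_right\<close>)
  also have "\<dots> = 0"
    using negligible_hyperplane[of b k] assms m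
    by (simp add: negligible_iff_emeasure0)
  finally show ?thesis by (simp add: emeasure_hyperplane_measure[OF m])
qed

lemma surface_measure_cases:
  assumes "\<exists>a c. in_hyperplane a c \<sigma>"
  obtains a c where "in_hyperplane a c \<sigma>" "surface_measure \<sigma> = hyperplane_measure a c"
proof -
  let ?p = "SOME (a, c). in_hyperplane a c \<sigma>"
  have "case ?p of (a, c) \<Rightarrow> in_hyperplane a c \<sigma>"
    by (rule someI_ex) (use assms in auto)
  then show ?thesis using that by (cases ?p) (auto simp: surface_measure_def)
qed

text \<open>Otherwise the component of \<open>u\<close> orthogonal to \<open>a\<close> would confine
  \<sigma> to a slice of its own hyperplane, which has measure zero. Positive area is thus what lets
  an edge determine its normal up to a factor.\<close>

lemma normal_unique:
  assumes "in_hyperplane a c \<sigma>" "measure (hyperplane_measure a c) \<sigma> > 0" "\<sigma> \<subseteq> {x. u \<bullet> x = k}"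
  shows "u = (a \<bullet> u) *\<^sub>R a"
proof (rule ccontr)
  assume ne: "u \<noteq> (a \<bullet> u) *\<^sub>R a"
  define b where "b = u - (a \<bullet> u) *\<^sub>R a"
  have a: "norm a = 1" "\<sigma> \<subseteq> {x. a \<bullet> x = c}" using assms(1) by (auto simp: in_hyperplane_def)
  have "a \<bullet> a = 1" using a(1) by (simp add: dot_square_norm)
  then have "b \<bullet> a = 0" by (simp add: b_def inner_diff_left inner_diff_right inner_commute)
  moreover have "b \<noteq> 0" using ne by (simp add: b_def)
  ultimately have 0: "emeasure (hyperplane_measure a c) {x. b \<bullet> x = k - (a \<bullet> u) * c} = 0"
    by (rule hyperplane_measure_null)
  have "{x. b \<bullet> x = k - (a \<bullet> u) * c} \<in> sets (hyperplane_measure a c)"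
    unfolding hyperplane_measure_eq by (intro sets_completionI_sets) (simp add: borel_closed closed_hyperplane)
  moreover have "\<sigma> \<subseteq> {x. b \<bullet> x = k - (a \<bullet> u) * c}"
    using a(2) assms(3) by (auto simp: b_def inner_diff_left)
  ultimately have "emeasure (hyperplane_measure a c) \<sigma> \<le> 0" using 0 emeasure_mono by metis
  then show False using assms(2) by (simp add: measure_def)
qed

section \<open>Inscribed balls and separation of convex cells by an edge\<close>

text \<open>A ball that met both \<open>K\<close> and its complement would meet the frontier, by
  connectedness. The frontier is made of edges, all of them at distance at least \<open>r\<close>;
  for the same reason \<open>x\<close> is interior, although it is only assumed to lie in the
  closure.\<close>

lemma ball_subset_cell:
  fixes K :: "'a::euclidean_space set"
  assumes K: "open K" "x \<in> closure K" and r: "r > 0"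
    and fr: "frontier K = (\<Union>\<sigma>\<in>S. closure \<sigma>)" and far: "\<And>\<sigma>. \<sigma> \<in> S \<Longrightarrow> r \<le> infdist x \<sigma>"
  shows "ball x r \<subseteq> K"
proof
  have no: False if q: "q \<in> frontier K" "dist x q < r" for q
  proof -
    obtain \<sigma> where s: "\<sigma> \<in> S" "q \<in> closure \<sigma>" using q fr by auto
    then have ne: "\<sigma> \<noteq> {}" by auto
    have "infdist q \<sigma> = 0" using s ne by (simp add: in_closure_iff_infdist_zero)
    then have "infdist x \<sigma> \<le> dist x q" using infdist_triangle[of x \<sigma> q] by simp
    then show False using far[OF s(1)] q by simp
  qed
  fix y assume y: "y \<in> ball x r"
  have "x \<in> K" using no[of x] K r by (auto simp: frontier_def interior_open)
  show "y \<in> K"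
  proof (rule ccontr)
    assume "y \<notin> K"
    then have "ball x r \<inter> frontier K \<noteq> {}"
    proof (intro connected_Int_frontier)
      show "connected (ball x r)" by (intro convex_connected convex_ball)
      show "ball x r \<inter> K \<noteq> {}" "ball x r - K \<noteq> {}"
        using y \<open>x \<in> K\<close> \<open>y \<notin> K\<close> centre_in_ball[of x r] r by blast+
    qed
    then show False using no by auto
  qed
qed

lemma disjoint_balls_dist:
  fixes x y :: "'a::real_normed_vector"
  assumes "ball x r \<inter> ball y s = {}" "r > 0" "s > 0"
  shows "r + s \<le> dist x y"
proof (rule ccontr)
  assume c: "\<not> r + s \<le> dist x y"
  \<comment> \<open>The point that divides the segment in the ratio r : s would lie in both
    balls.\<close>
  define z where "z = x + (r / (r + s)) *\<^sub>R (y - x)"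
  have "dist x z = r / (r + s) * dist x y"
    using assms by (simp add: z_def dist_norm norm_minus_commute)
  also have "\<dots> < r / (r + s) * (r + s)" using c assms by (intro mult_strict_left_mono) auto
  finally have 1: "dist x z < r" using assms by simp
  have "y - z = (s / (r + s)) *\<^sub>R (y - x)"
  proof -
    have "r / (r + s) = 1 - s / (r + s)" using assms by (simp add: field_simps)
    then show ?thesis by (simp add: z_def scaleR_left_diff_distrib)
  qed
  then have "dist y z = s / (r + s) * dist x y"
    using assms by (simp add: dist_norm norm_minus_commute)
  also have "\<dots> < s / (r + s) * (r + s)" using c assms by (intro mult_strict_left_mono) auto
  finally have "dist y z < s" using assms by simp
  with 1 show False using assms by auto
qed

text \<open>A hyperplane separating the disjoint convex sets contains \<sigma>, which lies in both
  closures. By uniqueness of the normal it is the hyperplane of \<sigma> itself, and openness of the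
  cells makes the inequalities strict.\<close>

lemma opposite_sides:
  assumes K: "open K" "convex K" "K \<noteq> {}" and L: "open L" "convex L" "L \<noteq> {}" and disj: "K \<inter> L = {}"
    and s: "\<sigma> \<subseteq> closure K" "\<sigma> \<subseteq> closure L"
    and a: "in_hyperplane a c \<sigma>" "measure (hyperplane_measure a c) \<sigma> > 0"
  shows "(\<forall>x\<in>K. a \<bullet> x < c) \<and> (\<forall>x\<in>L. a \<bullet> x > c) \<or> (\<forall>x\<in>K. a \<bullet> x > c) \<and> (\<forall>x\<in>L. a \<bullet> x < c)"
proof -
  obtain u k where u: "u \<noteq> 0" "\<forall>x\<in>K. u \<bullet> x \<le> k" "\<forall>x\<in>L. u \<bullet> x \<ge> k"
    using separating_hyperplane_sets[OF K(2) L(2) K(3) L(3) disj] by blast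
  have cK: "closure K \<subseteq> {x. u \<bullet> x \<le> k}"
    by (rule closure_minimal) (use u in \<open>auto simp: closed_halfspace_le\<close>)
  have cL: "closure L \<subseteq> {x. k \<le> u \<bullet> x}"
    by (rule closure_minimal) (use u in \<open>auto simp: closed_halfspace_ge\<close>)
  have "\<sigma> \<subseteq> {x. u \<bullet> x = k}" using s cK cL by fastforce
  then have ua: "u = (a \<bullet> u) *\<^sub>R a" using normal_unique[OF a] by blast
  have "\<sigma> \<noteq> {}" using a(2) by auto
  then obtain p where "p \<in> \<sigma>" by auto
  then have "a \<bullet> p = c" "u \<bullet> p = k" using a(1) \<open>\<sigma> \<subseteq> {x. u \<bullet> x = k}\<close> by (auto simp: in_hyperplane_def)
  then have k: "k = (a \<bullet> u) * c" using ua by (metis inner_scaleR_left)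
  have "K \<subseteq> interior {x. u \<bullet> x \<le> k}" by (rule interior_maximal) (use u K in auto)
  then have K': "\<forall>x\<in>K. u \<bullet> x < k" using u(1) by (auto simp: interior_halfspace_le)
  have "L \<subseteq> interior {x. u \<bullet> x \<ge> k}" by (rule interior_maximal) (use u L in auto)
  then have L': "\<forall>x\<in>L. u \<bullet> x > k" using u(1) by (auto simp: interior_halfspace_ge)
  have ux: "u \<bullet> x = (a \<bullet> u) * (a \<bullet> x)" for x using ua by (metis inner_scaleR_left)
  have "a \<bullet> u \<noteq> 0" using ua u(1) by auto
  then show ?thesis using K' L' unfolding k ux
    by (cases "a \<bullet> u > 0") (auto simp: mult_less_cancel_left)
qed

lemma face_area_pos_cases:
  assumes "\<exists>a c. in_hyperplane a c \<sigma>" "face_area \<sigma> > 0"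
  obtains a c where "in_hyperplane a c \<sigma>" "surface_measure \<sigma> = hyperplane_measure a c"
    "measure (hyperplane_measure a c) \<sigma> > 0"
  using surface_measure_cases[OF assms(1)] assms(2) unfolding face_area_def by metis

text \<open>A hyperplane has only two sides, and any two of the three cells would have to lie on
  different ones.\<close>

lemma three_cells_disjoint:
  assumes "\<And>K. K \<in> {A, B, C} \<Longrightarrow> open K \<and> convex K \<and> K \<noteq> {} \<and> \<sigma> \<subseteq> closure K"
    and "A \<inter> B = {}" "A \<inter> C = {}" "B \<inter> C = {}"
    and "\<exists>a c. in_hyperplane a c \<sigma>" "face_area \<sigma> > 0"
  shows False
proof -
  obtain a c where a: "in_hyperplane a c \<sigma>" "measure (hyperplane_measure a c) \<sigma> > 0"
    using face_area_pos_cases[OF assms(5,6)] by metis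
  have *: "open A" "convex A" "A \<noteq> {}" "\<sigma> \<subseteq> closure A" "open B" "convex B" "B \<noteq> {}" "\<sigma> \<subseteq> closure B"
    "open C" "convex C" "C \<noteq> {}" "\<sigma> \<subseteq> closure C" using assms(1) by simp_all
  obtain x y z where xyz: "x \<in> A" "y \<in> B" "z \<in> C" using * by blast
  have "a \<bullet> x < c \<and> a \<bullet> y > c \<or> a \<bullet> x > c \<and> a \<bullet> y < c"
    using opposite_sides[OF *(1-3,5-7) assms(2) *(4,8) a] xyz by blast
  moreover have "a \<bullet> x < c \<and> a \<bullet> z > c \<or> a \<bullet> x > c \<and> a \<bullet> z < c"
    using opposite_sides[OF *(1-3,9-11) assms(3) *(4,12) a] xyz by blast
  moreover have "a \<bullet> y < c \<and> a \<bullet> z > c \<or> a \<bullet> y > c \<and> a \<bullet> z < c"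
    using opposite_sides[OF *(5-7,9-11) assms(4) *(8,12) a] xyz by blast
  ultimately show False by linarith
qed

locale regular_admissible_mesh =
  fixes \<Omega> \<Gamma>D \<Gamma>N :: "'a::euclidean_space set" and \<M> :: "'a mesh" and \<xi> \<beta> :: real
  assumes admissible: "admissible_mesh \<Omega> \<Gamma>D \<Gamma>N \<M>" and regular: "regular_mesh \<xi> \<beta> \<M>"
    and \<xi>_pos: "\<xi> > 0" and bounded_\<Omega>: "bounded \<Omega>" and open_\<Omega>: "open \<Omega>"
begin

section \<open>Incidence of cells and edges, distances of the centres\<close>

lemmas mesh = admissible[unfolded admissible_mesh_def]

lemma cellD:
  assumes "K \<in> cells \<M>"
  shows "K \<noteq> {}" "open K" "convex K" "K \<subseteq> \<Omega>" "bounded K"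
    "frontier K = (\<Union>\<sigma>\<in>edges_of \<M> K. closure \<sigma>)" "center \<M> K \<in> closure K" "edges_of \<M> K \<subseteq> edges \<M>"
proof -
  have 1: "\<forall>K\<in>cells \<M>. K \<noteq> {} \<and> open K \<and> convex K \<and> polytope (closure K) \<and> K \<subseteq> \<Omega>"
    using mesh by (elim conjE) assumption
  have 2: "\<forall>K\<in>cells \<M>. edges_of \<M> K \<subseteq> edges \<M> \<and> frontier K = (\<Union>\<sigma>\<in>edges_of \<M> K. closure \<sigma>)"
    using mesh by (elim conjE) assumption
  have 3: "\<forall>K\<in>cells \<M>. center \<M> K \<in> closure K"
    using mesh by (elim conjE) assumption
  show "K \<noteq> {}" "open K" "convex K" "K \<subseteq> \<Omega>" using 1 assms by blast+
  then show "bounded K" using bounded_subset[OF bounded_\<Omega>] by blast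
  show "frontier K = (\<Union>\<sigma>\<in>edges_of \<M> K. closure \<sigma>)" "center \<M> K \<in> closure K" "edges_of \<M> K \<subseteq> edges \<M>"
    using 2 3 assms by blast+
qed

lemma cells_disjoint: "K \<in> cells \<M> \<Longrightarrow> L \<in> cells \<M> \<Longrightarrow> K \<noteq> L \<Longrightarrow> K \<inter> L = {}"
proof -
  have "disjoint (cells \<M>)" using mesh by (elim conjE) assumption
  then show "K \<in> cells \<M> \<Longrightarrow> L \<in> cells \<M> \<Longrightarrow> K \<noteq> L \<Longrightarrow> K \<inter> L = {}"
    by (auto simp: pairwise_def disjnt_def)
qed

lemma edge_facts:
  assumes "\<sigma> \<in> edges \<M>"
  shows "\<exists>a c. in_hyperplane a c \<sigma>" "face_area \<sigma> > 0"
    "interior_edge \<M> \<sigma> \<longleftrightarrow> \<not> \<sigma> \<subseteq> frontier \<Omega>" "\<sigma> \<subseteq> closure \<Omega>"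
proof -
  have 1: "\<forall>\<sigma>\<in>edges \<M>. \<sigma> \<subseteq> closure \<Omega> \<and> (\<exists>a c. in_hyperplane a c \<sigma>) \<and> face_area \<sigma> > 0"
    using mesh by (elim conjE) assumption
  have 2: "\<forall>\<sigma>\<in>edges \<M>. interior_edge \<M> \<sigma> \<longleftrightarrow> \<not> \<sigma> \<subseteq> frontier \<Omega>"
    using mesh by (elim conjE) assumption
  show "\<exists>a c. in_hyperplane a c \<sigma>" "face_area \<sigma> > 0"
    "interior_edge \<M> \<sigma> \<longleftrightarrow> \<not> \<sigma> \<subseteq> frontier \<Omega>" "\<sigma> \<subseteq> closure \<Omega>"
    using bspec[OF 1 assms] bspec[OF 2 assms] by blast+
qed

lemma edge_subset_closure: "K \<in> cells \<M> \<Longrightarrow> \<sigma> \<in> edges_of \<M> K \<Longrightarrow> \<sigma> \<subseteq> closure K"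
proof -
  assume "K \<in> cells \<M>" "\<sigma> \<in> edges_of \<M> K"
  then have "closure \<sigma> \<subseteq> frontier K" unfolding cellD(6)[OF \<open>K \<in> cells \<M>\<close>] by blast
  then show "\<sigma> \<subseteq> closure K" using closure_subset[of \<sigma>] unfolding frontier_def by blast
qed

lemma interface_iff:
  assumes "K \<noteq> L"
  shows "interface \<M> K L \<sigma> \<longleftrightarrow> K \<in> cells \<M> \<and> L \<in> cells \<M> \<and> \<sigma> \<in> edges_of \<M> K \<and> \<sigma> \<in> edges_of \<M> L"
proof -
  have *: "\<forall>K\<in>cells \<M>. \<forall>L\<in>cells \<M>. \<forall>\<sigma>\<in>edges \<M>. K \<noteq> L \<longrightarrow>
        (interface \<M> K L \<sigma> \<longleftrightarrow> \<sigma> \<in> edges_of \<M> K \<and> \<sigma> \<in> edges_of \<M> L)"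
    using mesh by (elim conjE) assumption
  show ?thesis
  proof (cases "K \<in> cells \<M> \<and> L \<in> cells \<M> \<and> \<sigma> \<in> edges \<M>")
    case True
    then show ?thesis using * assms by simp
  next
    case False
    then have "\<not> interface \<M> K L \<sigma>" unfolding interface_def by blast
    moreover have "K \<in> cells \<M> \<Longrightarrow> \<sigma> \<in> edges_of \<M> K \<Longrightarrow> \<sigma> \<in> edges \<M>" using cellD(8)[of K] by (rule subsetD)
    ultimately show ?thesis using False by auto
  qed
qed

text \<open>This gives meaning to the definite description in \<open>neighbour\<close>: two
  different neighbours across one edge would make three disjoint cells touching it.\<close>

lemma interface_unique:
  assumes "interface \<M> K L \<sigma>" "interface \<M> K L' \<sigma>"
  shows "L = L'"
proof (rule ccontr)
  assume ne: "L \<noteq> L'"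
  have "K \<noteq> L" "K \<noteq> L'" using assms by (auto simp: interface_def)
  then have c: "K \<in> cells \<M>" "L \<in> cells \<M>" "L' \<in> cells \<M>"
     "\<sigma> \<in> edges_of \<M> K" "\<sigma> \<in> edges_of \<M> L" "\<sigma> \<in> edges_of \<M> L'" 
    using assms interface_iff by blast+
  have *: "open X \<and> convex X \<and> X \<noteq> {} \<and> \<sigma> \<subseteq> closure X" if "X \<in> {K, L, L'}" for X
    using that c cellD(1-3)[of X] edge_subset_closure[of X \<sigma>] by blast
  have "\<sigma> \<in> edges \<M>" using cellD(8)[OF c(1)] c(4) by (rule subsetD)
  then show False
    using three_cells_disjoint[OF *] cells_disjoint[OF c(1,2) \<open>K \<noteq> L\<close>] cells_disjoint[OF c(1,3) \<open>K \<noteq> L'\<close>]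
      cells_disjoint[OF c(2,3) ne] edge_facts(1,2) by meson
qed

lemma neighbour_eq: "interface \<M> K L \<sigma> \<Longrightarrow> neighbour \<M> K \<sigma> = L"
  unfolding neighbour_def by (rule the_equality) (auto dest: interface_unique)

lemma interface_sym: "interface \<M> K L \<sigma> \<Longrightarrow> interface \<M> L K \<sigma>"
  unfolding interface_def by (metis Int_commute)

lemma cell_of_works:
  assumes "\<sigma> \<in> edges \<M>"
  shows "cell_of \<M> \<sigma> \<in> cells \<M> \<and> \<sigma> \<in> edges_of \<M> (cell_of \<M> \<sigma>)"
proof -
  have "edges \<M> = (\<Union>K\<in>cells \<M>. edges_of \<M> K)" using mesh by (elim conjE) assumption
  then have "\<exists>K. K \<in> cells \<M> \<and> \<sigma> \<in> edges_of \<M> K" using assms by blast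
  then show ?thesis unfolding cell_of_def by (rule someI_ex)
qed

text \<open>The pair of cells that witnesses \<open>interior_edge\<close> need not contain the cell
  selected by \<open>cell_of\<close>. Sharing the edge with a member of the pair is enough to form
  an interface.\<close>

lemma interior_edge_interface:
  assumes "\<sigma> \<in> edges \<M>" "interior_edge \<M> \<sigma>"
  shows "interface \<M> (cell_of \<M> \<sigma>) (neighbour \<M> (cell_of \<M> \<sigma>) \<sigma>) \<sigma>"
proof -
  let ?C = "cell_of \<M> \<sigma>"
  obtain K L where KL: "interface \<M> K L \<sigma>" using assms by (auto simp: interior_edge_def)
  have "K \<noteq> L" using KL by (auto simp: interface_def)
  then have s: "K \<in> cells \<M>" "\<sigma> \<in> edges_of \<M> K" using KL interface_iff by blast+
  have "\<exists>L'. interface \<M> ?C L' \<sigma>"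
    using KL interface_iff[of K ?C] interface_sym cell_of_works[OF assms(1)] s by (cases "K = ?C") blast+
  then show ?thesis using neighbour_eq by metis
qed

lemma cells_of_interior:
  assumes "\<sigma> \<in> edges \<M>" "interior_edge \<M> \<sigma>"
  shows "{K \<in> cells \<M>. \<sigma> \<in> edges_of \<M> K} = {cell_of \<M> \<sigma>, neighbour \<M> (cell_of \<M> \<sigma>) \<sigma>}"
proof
  let ?C = "cell_of \<M> \<sigma>" and ?L = "neighbour \<M> (cell_of \<M> \<sigma>) \<sigma>"
  have i: "interface \<M> ?C ?L \<sigma>" using interior_edge_interface[OF assms] .
  then have "?C \<noteq> ?L" by (auto simp: interface_def)
  then show "{?C, ?L} \<subseteq> {K \<in> cells \<M>. \<sigma> \<in> edges_of \<M> K}" using i interface_iff by blast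
  show "{K \<in> cells \<M>. \<sigma> \<in> edges_of \<M> K} \<subseteq> {?C, ?L}"
  proof
    fix K assume "K \<in> {K \<in> cells \<M>. \<sigma> \<in> edges_of \<M> K}"
    then show "K \<in> {?C, ?L}"
      using interface_unique[OF i, of K] interface_iff[of ?C K] cell_of_works[OF assms(1)] by auto
  qed
qed

lemma cells_of_boundary:
  assumes "\<sigma> \<in> edges \<M>" "\<not> interior_edge \<M> \<sigma>"
  shows "{K \<in> cells \<M>. \<sigma> \<in> edges_of \<M> K} = {cell_of \<M> \<sigma>}"
proof -
  have "K = cell_of \<M> \<sigma>" if "K \<in> cells \<M>" "\<sigma> \<in> edges_of \<M> K" for K
    using interface_iff[of K "cell_of \<M> \<sigma>" \<sigma>] cell_of_works[OF assms(1)] that assms(2)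
    unfolding interior_edge_def by metis
  then show ?thesis using cell_of_works[OF assms(1)] by auto
qed

lemma diameter_pos:
  assumes "K \<in> cells \<M>" shows "diameter K > 0"
proof -
  obtain x where "x \<in> K" using cellD(1)[OF assms] by auto
  then obtain e where e: "e > 0" "ball x e \<subseteq> K" using cellD(2)[OF assms] openE by blast
  have "2 * e \<le> diameter K" using diameter_subset[OF e(2) cellD(5)[OF assms]] e by simp
  then show ?thesis using e by simp
qed

lemma ball_center_subset:
  assumes "K \<in> cells \<M>" shows "ball (center \<M> K) (\<xi> * diameter K) \<subseteq> K"
proof (rule ball_subset_cell[OF cellD(2)[OF assms] cellD(7)[OF assms] _ cellD(6)[OF assms]])
  show "0 < \<xi> * diameter K" using \<xi>_pos diameter_pos[OF assms] by simp
  show "\<xi> * diameter K \<le> infdist (center \<M> K) \<sigma>" if "\<sigma> \<in> edges_of \<M> K" for \<sigma>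
    using regular assms that unfolding regular_mesh_def by blast
qed

lemma center_in: "K \<in> cells \<M> \<Longrightarrow> center \<M> K \<in> K"
  using subsetD[OF ball_center_subset, of K "center \<M> K"] \<xi>_pos diameter_pos[of K] by simp

text \<open>Inside, the balls inscribed in the two cells are disjoint, so the centres are at least
  the sum of the radii apart. The bound thus holds for both cells at the edge, whichever of them
  \<open>cell_of\<close> selects.\<close>

lemma d_edge_ge:
  assumes "K \<in> cells \<M>" "\<sigma> \<in> edges_of \<M> K"
  shows "\<xi> * diameter K \<le> d_edge \<M> \<sigma>"
proof -
  have s: "\<sigma> \<in> edges \<M>" using assms cellD(8) by blast
  show ?thesis
  proof (cases "interior_edge \<M> \<sigma>")
    case True
    let ?C = "cell_of \<M> \<sigma>" and ?L = "neighbour \<M> (cell_of \<M> \<sigma>) \<sigma>"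
    have i: "interface \<M> ?C ?L \<sigma>" using interior_edge_interface[OF s True] .
    then have c: "?C \<noteq> ?L" "?C \<in> cells \<M>" "?L \<in> cells \<M>" by (auto simp: interface_def)
    have "\<xi> * diameter ?C + \<xi> * diameter ?L \<le> dist (center \<M> ?C) (center \<M> ?L)"
      by (rule disjoint_balls_dist)
        (use ball_center_subset[OF c(2)] ball_center_subset[OF c(3)] cells_disjoint[OF c(2,3,1)] \<xi>_pos
          diameter_pos[OF c(2)] diameter_pos[OF c(3)] in auto)
    moreover have "K = ?C \<or> K = ?L" using cells_of_interior[OF s True] assms by blast
    moreover have "0 < \<xi> * diameter ?C" "0 < \<xi> * diameter ?L" using \<xi>_pos diameter_pos c by auto
    ultimately show ?thesis using True by (auto simp: d_edge_def Let_def)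
  next
    case False
    then have "K = cell_of \<M> \<sigma>" using cells_of_boundary[OF s False] assms by blast
    then show ?thesis using False regular assms by (auto simp: d_edge_def Let_def regular_mesh_def)
  qed
qed

text \<open>The height of the cone over the edge with apex at the centre. At an interior edge the
  inscribed ball lies on one side of the hyperplane. At a boundary edge admissibility puts a foot of
  the perpendicular into \<sigma>, so the distance to the hyperplane is a distance to a point of
  \<sigma>.\<close>

lemma center_height:
  assumes K: "K \<in> cells \<M>" and s: "\<sigma> \<in> edges_of \<M> K"
    and a: "in_hyperplane a c \<sigma>" "measure (hyperplane_measure a c) \<sigma> > 0"
  shows "\<xi> * diameter K \<le> \<bar>a \<bullet> center \<M> K - c\<bar>"
proof -
  let ?x = "center \<M> K" and ?r = "\<xi> * diameter K"
  have r: "?r > 0" using \<xi>_pos diameter_pos[OF K] by simp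
  have sE: "\<sigma> \<in> edges \<M>" using K s cellD(8) by blast
  have na: "norm a = 1" "\<sigma> \<subseteq> {x. a \<bullet> x = c}" using a by (auto simp: in_hyperplane_def)
  then have aa: "a \<bullet> a = 1" by (simp add: dot_square_norm)
  show ?thesis
  proof (cases "interior_edge \<M> \<sigma>")
    case True
    obtain L where L: "L \<in> cells \<M>" "L \<noteq> K" "\<sigma> \<in> edges_of \<M> L"
    proof -
      have "K \<in> {cell_of \<M> \<sigma>, neighbour \<M> (cell_of \<M> \<sigma>) \<sigma>}" using cells_of_interior[OF sE True] K s by blast
      moreover have "cell_of \<M> \<sigma> \<noteq> neighbour \<M> (cell_of \<M> \<sigma>) \<sigma>"
        using interior_edge_interface[OF sE True] by (auto simp: interface_def)
      ultimately show ?thesis using cells_of_interior[OF sE True] that by blast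
    qed
    have "(\<forall>x\<in>K. a \<bullet> x < c) \<or> (\<forall>x\<in>K. a \<bullet> x > c)"
      using opposite_sides[OF cellD(2,3,1)[OF K] cellD(2,3,1)[OF L(1)] cells_disjoint[OF K L(1)]
          edge_subset_closure[OF K s] edge_subset_closure[OF L(1,3)] a] L by blast
    moreover have in_K: "?x + t *\<^sub>R a \<in> K" if "\<bar>t\<bar> < ?r" for t
      using ball_center_subset[OF K] that na by (auto simp: dist_norm)
    ultimately consider "\<And>t. \<bar>t\<bar> < ?r \<Longrightarrow> a \<bullet> ?x + t < c" | "\<And>t. \<bar>t\<bar> < ?r \<Longrightarrow> a \<bullet> ?x + t > c"
      using aa by (force simp: inner_add_right)
    then show ?thesis
    proof cases
      case 1
      have "?r \<le> c - a \<bullet> ?x"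
      proof (rule dense_le_bounded[OF r])
        show "t \<le> c - a \<bullet> ?x" if "0 < t" "t < ?r" for t using 1[of t] that by simp
      qed
      then show ?thesis by simp
    next
      case 2
      have "?r \<le> a \<bullet> ?x - c"
      proof (rule dense_le_bounded[OF r])
        show "t \<le> a \<bullet> ?x - c" if "0 < t" "t < ?r" for t using 2[of "- t"] that by simp
      qed
      then show ?thesis by simp
    qed
  next
    case False
    have d: "?r \<le> infdist ?x \<sigma>" using regular K s unfolding regular_mesh_def by blast
    then have "?x \<notin> \<sigma>" using r by (auto simp: infdist_zero)
    moreover have "\<forall>K\<in>cells \<M>. \<forall>\<sigma>\<in>edges_of \<M> K. \<sigma> \<subseteq> frontier \<Omega> \<and> center \<M> K \<notin> \<sigma> \<longrightarrow>
        (\<exists>p\<in>\<sigma>. \<forall>y\<in>\<sigma>. \<forall>z\<in>\<sigma>. (p - center \<M> K) \<bullet> (y - z) = 0)"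
      using mesh by (elim conjE) assumption
    ultimately obtain p where p: "p \<in> \<sigma>" "\<forall>y\<in>\<sigma>. \<forall>z\<in>\<sigma>. (p - ?x) \<bullet> (y - z) = 0"
      using K s False edge_facts(3)[OF sE] by blast
    have "\<sigma> \<subseteq> {y. (p - ?x) \<bullet> y = (p - ?x) \<bullet> p}"
      using p(2)[rule_format, OF _ p(1)] by (auto simp: inner_diff_right)
    then have u: "p - ?x = (a \<bullet> (p - ?x)) *\<^sub>R a" using normal_unique[OF a] by blast
    have "?r \<le> dist ?x p" using d infdist_le[OF p(1), of ?x] by simp
    also have "\<dots> = \<bar>a \<bullet> (p - ?x)\<bar>" using u na
      by (metis dist_commute dist_norm mult.right_neutral norm_scaleR)
    also have "\<dots> = \<bar>a \<bullet> ?x - c\<bar>" using p(1) na by (auto simp: inner_diff_right)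
    finally show ?thesis .
  qed
qed

sublocale discrete_mesh \<M> \<Gamma>D
proof
  show "finite (cells \<M>)" using mesh by (elim conjE) assumption
  show "finite (edges \<M>)" using mesh by (elim conjE) assumption
  show "edges \<M> = (\<Union>K\<in>cells \<M>. edges_of \<M> K)"
    using mesh by (elim conjE) assumption
  show "0 < measure lebesgue K" if "K \<in> cells \<M>" for K
  proof -
    have "\<not> negligible K" using cellD(1,2)[OF that] open_not_negligible by blast
    moreover have "K \<in> lmeasurable" using cellD(2,5)[OF that] by (simp add: lmeasurable_open)
    ultimately show ?thesis using negligible_iff_measure by (metis measure_nonneg order_less_le)
  qed
  show "0 \<le> transm \<M> \<sigma>" if "\<sigma> \<in> edges \<M>" for \<sigma>
    using edge_facts(2)[OF that] unfolding transm_def d_edge_def Let_def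
    by (auto simp: infdist_nonneg)
  show "{K \<in> cells \<M>. \<sigma> \<in> edges_of \<M> K} = {cell_of \<M> \<sigma>}"
    if "\<sigma> \<in> edges \<M>" "\<not> interior_edge \<M> \<sigma>" for \<sigma> using cells_of_boundary that .
  show "{K \<in> cells \<M>. \<sigma> \<in> edges_of \<M> K} = {cell_of \<M> \<sigma>, neighbour \<M> (cell_of \<M> \<sigma>) \<sigma>}"
    if "\<sigma> \<in> edges \<M>" "interior_edge \<M> \<sigma>" for \<sigma> using cells_of_interior that .
  show "neighbour \<M> (cell_of \<M> \<sigma>) \<sigma> \<noteq> cell_of \<M> \<sigma>"
    if "\<sigma> \<in> edges \<M>" "interior_edge \<M> \<sigma>" for \<sigma>
    using interior_edge_interface[OF that] by (auto simp: interface_def)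
  show "neighbour \<M> (neighbour \<M> (cell_of \<M> \<sigma>) \<sigma>) \<sigma> = cell_of \<M> \<sigma>"
    if "\<sigma> \<in> edges \<M>" "interior_edge \<M> \<sigma>" for \<sigma>
    using neighbour_eq[OF interface_sym[OF interior_edge_interface[OF that]]] .
qed

end

section \<open>Trace and Poincare inequalities for smooth functions\<close>

lemma nn_integral_lborel_affine:
  fixes f :: "'a::euclidean_space \<Rightarrow> ennreal"
  assumes [measurable]: "f \<in> borel_measurable borel" and c: "c \<noteq> 0"
  shows "(\<integral>\<^sup>+x. f x \<partial>lborel) = ennreal (\<bar>c\<bar> ^ DIM('a)) * (\<integral>\<^sup>+x. f (t + c *\<^sub>R x) \<partial>lborel)"
  by (subst lborel_affine[OF c, of t])
    (simp add: nn_integral_density nn_integral_distr nn_integral_cmult)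

text \<open>The dilation costs the Jacobian s^(-d), which is at most 2^d because s \<ge> 1/2. The
  powers of two with exponent d in the later constants come from here.\<close>

lemma nn_integral_convex_comb_le:
  fixes f :: "'a::euclidean_space \<Rightarrow> ennreal"
  assumes [measurable]: "f \<in> borel_measurable borel" and s: "1/2 \<le> s"
  shows "(\<integral>\<^sup>+x. f (y + s *\<^sub>R x) \<partial>lborel) \<le> ennreal (2 ^ DIM('a)) * (\<integral>\<^sup>+x. f x \<partial>lborel)"
proof -
  let ?I = "\<integral>\<^sup>+x. f (y + s *\<^sub>R x) \<partial>lborel"
  have "1 \<le> (2 * s) ^ DIM('a)" using s by (intro one_le_power) auto
  then have "?I \<le> ennreal ((2 * s) ^ DIM('a)) * ?I"
    by (metis ennreal_1 ennreal_leI mult.left_neutral mult_right_mono zero_le)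
  also have "\<dots> = ennreal (2 ^ DIM('a)) * (ennreal (\<bar>s\<bar> ^ DIM('a)) * ?I)"
    using s by (simp add: power_mult_distrib ennreal_mult' mult.assoc)
  also have "ennreal (\<bar>s\<bar> ^ DIM('a)) * ?I = (\<integral>\<^sup>+x. f x \<partial>lborel)"
    using s by (intro nn_integral_lborel_affine[symmetric]) auto
  finally show ?thesis .
qed

lemma nn_integral_hyperplane:
  assumes [measurable]: "f \<in> borel_measurable borel"
  shows "(\<integral>\<^sup>+x. f x \<partial>hyperplane_borel a c)
    = (\<integral>\<^sup>+z. indicator {0..1} (a \<bullet> z - c) * f (proj_hyperplane a c z) \<partial>lborel)"
proof -
  let ?S = "{x. c \<le> a \<bullet> x \<and> a \<bullet> x \<le> c + 1}"
  have "(\<integral>\<^sup>+x. f x \<partial>hyperplane_borel a c) = (\<integral>\<^sup>+z. f (proj_hyperplane a c z) \<partial>restrict_space lborel ?S)"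
    unfolding hyperplane_borel_def by (rule nn_integral_distr) (auto intro!: measurable_restrict_space1)
  also have "\<dots> = (\<integral>\<^sup>+z. f (proj_hyperplane a c z) * indicator ?S z \<partial>lborel)"
    by (subst nn_integral_restrict_space) auto
  also have "\<dots> = (\<integral>\<^sup>+z. indicator {0..1} (a \<bullet> z - c) * f (proj_hyperplane a c z) \<partial>lborel)"
    by (intro nn_integral_cong) (auto simp: indicator_def)
  finally show ?thesis .
qed

text \<open>For fixed \<open>w\<close> the substitution u = a \<bullet> w - \<tau> turns the
  projection into the translate of \<open>w\<close> by -u a with u in [0, 1]. Translation invariance
  of Lebesgue measure then makes the inner integral independent of u.\<close>

lemma nn_integral_slices:
  fixes g :: "'a::euclidean_space \<Rightarrow> ennreal"
  assumes [measurable]: "g \<in> borel_measurable borel"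
  shows "(\<integral>\<^sup>+\<tau>. (\<integral>\<^sup>+w. indicator {0..1} (a \<bullet> w - \<tau>) * g (proj_hyperplane a \<tau> w) \<partial>lborel) \<partial>lborel)
    = (\<integral>\<^sup>+x. g x \<partial>lborel)"
proof -
  have "(\<integral>\<^sup>+\<tau>. (\<integral>\<^sup>+w. indicator {0..1} (a \<bullet> w - \<tau>) * g (proj_hyperplane a \<tau> w) \<partial>lborel) \<partial>lborel)
      = (\<integral>\<^sup>+w. (\<integral>\<^sup>+\<tau>. indicator {0..1} (a \<bullet> w - \<tau>) * g (proj_hyperplane a \<tau> w) \<partial>lborel) \<partial>lborel)"
    unfolding proj_hyperplane_def by (rule lborel_pair.Fubini') measurable
  also have "\<dots> = (\<integral>\<^sup>+w. (\<integral>\<^sup>+u. indicator {0..1} u * g (w - u *\<^sub>R a) \<partial>lborel) \<partial>lborel)"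
  proof (rule nn_integral_cong)
    fix w
    show "(\<integral>\<^sup>+\<tau>. indicator {0..1} (a \<bullet> w - \<tau>) * g (proj_hyperplane a \<tau> w) \<partial>lborel)
        = (\<integral>\<^sup>+u. indicator {0..1} u * g (w - u *\<^sub>R a) \<partial>lborel)"
      unfolding proj_hyperplane_def
      by (subst nn_integral_real_affine[where c = "-1" and t = "a \<bullet> w"]) auto
  qed
  also have "\<dots> = (\<integral>\<^sup>+u. (\<integral>\<^sup>+w. indicator {0..1} u * g (w - u *\<^sub>R a) \<partial>lborel) \<partial>lborel)"
    by (rule lborel_pair.Fubini'[symmetric]) measurable
  also have "\<dots> = (\<integral>\<^sup>+u. indicator {0..1::real} u * (\<integral>\<^sup>+x. g x \<partial>lborel) \<partial>lborel)"
  proof (rule nn_integral_cong)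
    fix u :: real
    have "(\<integral>\<^sup>+w. g (w - u *\<^sub>R a) \<partial>lborel) = (\<integral>\<^sup>+x. g x \<partial>lborel)"
      using nn_integral_lborel_affine[of g 1 "- u *\<^sub>R a"] by simp
    then show "(\<integral>\<^sup>+w. indicator {0..1} u * g (w - u *\<^sub>R a) \<partial>lborel) = indicator {0..1} u * (\<integral>\<^sup>+x. g x \<partial>lborel)"
      by (simp add: nn_integral_cmult)
  qed
  also have "\<dots> = (\<integral>\<^sup>+x. g x \<partial>lborel)"
    by (subst nn_integral_multc) auto
  finally show ?thesis .
qed

text \<open>Integration in cone coordinates with apex \<open>x0\<close>. Restricting \<open>t\<close> to the half of the cone next to
  the base bounds the Jacobian, and as an inequality the change of variables needs only translations
  and dilations of Lebesgue measure.\<close>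

lemma nn_integral_cone_le:
  fixes g :: "'a::euclidean_space \<Rightarrow> ennreal"
  assumes [measurable]: "g \<in> borel_measurable borel" and a: "norm a = 1" and k: "a \<bullet> x0 \<noteq> c"
    and \<epsilon>: "\<epsilon> \<le> 1/2"
  shows "(\<integral>\<^sup>+x. (\<integral>\<^sup>+t. indicator {0..\<epsilon>} t * g ((1 - t) *\<^sub>R x + t *\<^sub>R x0) \<partial>lborel) \<partial>hyperplane_borel a c)
    \<le> ennreal (2 ^ DIM('a) / \<bar>a \<bullet> x0 - c\<bar>) * (\<integral>\<^sup>+x. g x \<partial>lborel)"
proof -
  have aa: "a \<bullet> a = 1" using a by (simp add: dot_square_norm)
  define G where "G \<tau> w = indicator {0..1} (a \<bullet> w - \<tau>) * g (proj_hyperplane a \<tau> w)" for \<tau> w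
  have [measurable]: "case_prod G \<in> borel_measurable (borel \<Otimes>\<^sub>M borel)"
    unfolding G_def proj_hyperplane_def by measurable
  let ?k = "a \<bullet> x0 - c" and ?z = "\<lambda>t x. (1 - t) *\<^sub>R x + t *\<^sub>R x0"
  have "(\<integral>\<^sup>+x. (\<integral>\<^sup>+t. indicator {0..\<epsilon>} t * g (?z t x) \<partial>lborel) \<partial>hyperplane_borel a c)
     = (\<integral>\<^sup>+x. (\<integral>\<^sup>+t. indicator {0..1} (a \<bullet> x - c) * (indicator {0..\<epsilon>} t * g (?z t (proj_hyperplane a c x)))
          \<partial>lborel) \<partial>lborel)"
    by (subst nn_integral_hyperplane) (simp_all add: nn_integral_cmult)
  also have "\<dots> = (\<integral>\<^sup>+t. (\<integral>\<^sup>+x. indicator {0..1} (a \<bullet> x - c) * (indicator {0..\<epsilon>} t * g (?z t (proj_hyperplane a c x)))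
          \<partial>lborel) \<partial>lborel)"
    unfolding proj_hyperplane_def by (rule lborel_pair.Fubini'[symmetric]) measurable
  also have "\<dots> \<le> (\<integral>\<^sup>+t. ennreal (2 ^ DIM('a)) * (\<integral>\<^sup>+w. G (c + ?k * t) w \<partial>lborel) \<partial>lborel)"
  proof (rule nn_integral_mono)
    fix t
    show "(\<integral>\<^sup>+x. indicator {0..1} (a \<bullet> x - c) * (indicator {0..\<epsilon>} t * g (?z t (proj_hyperplane a c x))) \<partial>lborel)
      \<le> ennreal (2 ^ DIM('a)) * (\<integral>\<^sup>+w. G (c + ?k * t) w \<partial>lborel)"
    proof (cases "t \<in> {0..\<epsilon>}")
      case True
      have "(\<integral>\<^sup>+x. indicator {0..1} (a \<bullet> x - c) * (indicator {0..\<epsilon>} t * g (?z t (proj_hyperplane a c x))) \<partial>lborel)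
        \<le> (\<integral>\<^sup>+x. G (c + ?k * t) (t *\<^sub>R x0 + (1 - t) *\<^sub>R x) \<partial>lborel)"
      proof (rule nn_integral_mono)
        fix x
        \<comment> \<open>The contraction towards the apex maps the hyperplane at height c to the
          one at height c + k t. It commutes with the projections and sends the slab of unit height
          over the first into the slab of unit height over the second.\<close>
        have e: "a \<bullet> (t *\<^sub>R x0 + (1 - t) *\<^sub>R x) - (c + ?k * t) = (1 - t) * (a \<bullet> x - c)"
          by (simp add: inner_add_right inner_diff_right algebra_simps)
        have p: "proj_hyperplane a (c + ?k * t) (t *\<^sub>R x0 + (1 - t) *\<^sub>R x) = ?z t (proj_hyperplane a c x)"
          unfolding proj_hyperplane_def e by (simp add: algebra_simps)
        have "indicator {0..1} (a \<bullet> x - c) \<le> (indicator {0..1} ((1 - t) * (a \<bullet> x - c)) :: ennreal)"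
          using True \<epsilon> by (auto simp: indicator_def mult_le_one)
        then show "indicator {0..1} (a \<bullet> x - c) * (indicator {0..\<epsilon>} t * g (?z t (proj_hyperplane a c x)))
          \<le> G (c + ?k * t) (t *\<^sub>R x0 + (1 - t) *\<^sub>R x)"
          unfolding G_def e p using True by (simp add: mult_right_mono)
      qed
      also have "\<dots> \<le> ennreal (2 ^ DIM('a)) * (\<integral>\<^sup>+w. G (c + ?k * t) w \<partial>lborel)"
        by (rule nn_integral_convex_comb_le) (use True \<epsilon> in auto)
      finally show ?thesis .
    qed simp
  qed
  also have "\<dots> = ennreal (2 ^ DIM('a)) * (\<integral>\<^sup>+t. (\<integral>\<^sup>+w. G (c + ?k * t) w \<partial>lborel) \<partial>lborel)"
    by (rule nn_integral_cmult) measurable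
  also have "(\<integral>\<^sup>+t. (\<integral>\<^sup>+w. G (c + ?k * t) w \<partial>lborel) \<partial>lborel)
     = ennreal (1 / \<bar>?k\<bar>) * (\<integral>\<^sup>+\<tau>. (\<integral>\<^sup>+w. G \<tau> w \<partial>lborel) \<partial>lborel)"
  proof -
    have "(\<integral>\<^sup>+\<tau>. (\<integral>\<^sup>+w. G \<tau> w \<partial>lborel) \<partial>lborel)
       = ennreal \<bar>?k\<bar> * (\<integral>\<^sup>+t. (\<integral>\<^sup>+w. G (c + ?k * t) w \<partial>lborel) \<partial>lborel)"
      by (rule nn_integral_real_affine, measurable) (use k in simp)
    moreover have "ennreal (1 / \<bar>?k\<bar>) * ennreal \<bar>?k\<bar> = 1"
      using k by (simp flip: ennreal_mult')
    ultimately show ?thesis by (simp add: mult.assoc[symmetric])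
  qed
  also have "(\<integral>\<^sup>+\<tau>. (\<integral>\<^sup>+w. G \<tau> w \<partial>lborel) \<partial>lborel) = (\<integral>\<^sup>+x. g x \<partial>lborel)"
    unfolding G_def by (rule nn_integral_slices) simp
  also have "ennreal (2 ^ DIM('a)) * (ennreal (1 / \<bar>?k\<bar>) * (\<integral>\<^sup>+x. g x \<partial>lborel))
     = ennreal (2 ^ DIM('a) / \<bar>?k\<bar>) * (\<integral>\<^sup>+x. g x \<partial>lborel)"
    by (simp add: mult.assoc[symmetric] ennreal_mult'[symmetric])
  finally show ?thesis .
qed

section \<open>Gradients and increments along segments\<close>

definition grad_sq :: "('a::euclidean_space \<Rightarrow> real) \<Rightarrow> 'a \<Rightarrow> real" where
  "grad_sq v x = (\<Sum>i\<in>Basis. (pderivative v i x)\<^sup>2)"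

lemma smooth_funD:
  assumes "smooth_fun v"
  shows "v differentiable (at x)" "continuous_on UNIV v"
    "i \<in> Basis \<Longrightarrow> continuous_on UNIV (pderivative v i)" "continuous_on UNIV (grad_sq v)"
proof -
  have "C_k (Suc (Suc 0)) v" using assms unfolding smooth_fun_def by blast
  then have d: "\<And>x. v differentiable (at x)" and p: "\<And>i. i \<in> Basis \<Longrightarrow> C_k (Suc 0) (pderivative v i)" by auto
  show "v differentiable (at x)" by (rule d)
  show "continuous_on UNIV v"
    using d differentiable_imp_continuous_within by (auto simp: continuous_on_eq_continuous_within)
  have c: "continuous_on UNIV (pderivative v i)" if "i \<in> Basis" for i
  proof -
    have "\<And>x. pderivative v i differentiable (at x)" using p[OF that] by auto
    then show ?thesis
      using differentiable_imp_continuous_within by (auto simp: continuous_on_eq_continuous_within)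
  qed
  then show "i \<in> Basis \<Longrightarrow> continuous_on UNIV (pderivative v i)" .
  show "continuous_on UNIV (grad_sq v)" unfolding grad_sq_def using c by (auto intro!: continuous_intros)
qed

lemma smooth_fun_measurable:
  assumes "smooth_fun v"
  shows "v \<in> borel_measurable borel" "i \<in> Basis \<Longrightarrow> pderivative v i \<in> borel_measurable borel"
    "grad_sq v \<in> borel_measurable borel"
proof -
  show "v \<in> borel_measurable borel"
    by (rule borel_measurable_continuous_onI[OF smooth_funD(2)[OF assms]])
  show "pderivative v i \<in> borel_measurable borel" if "i \<in> Basis"
    by (rule borel_measurable_continuous_onI[OF smooth_funD(3)[OF assms that]])
  show "grad_sq v \<in> borel_measurable borel"
    by (rule borel_measurable_continuous_onI[OF smooth_funD(4)[OF assms]])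
qed

lemma grad_sq_nonneg: "grad_sq v x \<ge> 0"
  unfolding grad_sq_def by (intro sum_nonneg zero_le_power2)

lemma directional_derivative_eq:
  assumes "smooth_fun v"
  shows "frechet_derivative v (at x) h = (\<Sum>i\<in>Basis. pderivative v i x * (h \<bullet> i))"
proof -
  have l: "linear (frechet_derivative v (at x))"
    using smooth_funD(1)[OF assms] by (rule linear_frechet_derivative)
  have "frechet_derivative v (at x) h = frechet_derivative v (at x) (\<Sum>i\<in>Basis. (h \<bullet> i) *\<^sub>R i)"
    by (simp add: euclidean_representation)
  also have "\<dots> = (\<Sum>i\<in>Basis. pderivative v i x * (h \<bullet> i))"
    using l by (simp add: linear_sum linear_scale mult.commute)
  finally show ?thesis .
qed

lemma directional_deriv_sq_le:
  assumes "smooth_fun v"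
  shows "(frechet_derivative v (at x) h)\<^sup>2 \<le> grad_sq v x * (norm h)\<^sup>2"
proof -
  have "(norm h)\<^sup>2 = h \<bullet> h" by (rule power2_norm_eq_inner)
  also have "\<dots> = (\<Sum>i\<in>Basis. (h \<bullet> i)\<^sup>2)"
    unfolding power2_eq_square by (rule euclidean_inner)
  finally have n: "(norm h)\<^sup>2 = (\<Sum>i\<in>Basis. (h \<bullet> i)\<^sup>2)" .
  show ?thesis
    unfolding n grad_sq_def
    by (subst directional_derivative_eq[OF assms]) (rule Cauchy_Schwarz_ineq_sum)
qed

text \<open>The fundamental theorem of calculus along the segment, followed by Cauchy-Schwarz on
  [0, s]. The factor \<open>s\<close>, the length of that interval, is what later makes the gradient
  contribution of a thin layer small.\<close>

lemma increment_sq_le: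
  assumes v: "smooth_fun v" and s: "0 \<le> s"
  shows "ennreal ((v ((1 - s) *\<^sub>R x + s *\<^sub>R y) - v x)\<^sup>2)
    \<le> ennreal (s * (dist x y)\<^sup>2) * (\<integral>\<^sup>+t. indicator {0..s} t * ennreal (grad_sq v ((1 - t) *\<^sub>R x + t *\<^sub>R y)) \<partial>lborel)"
proof -
  define p where "p t = (1 - t) *\<^sub>R x + t *\<^sub>R y" for t :: real
  define D where "D t = (\<Sum>i\<in>Basis. pderivative v i (p t) * ((y - x) \<bullet> i))" for t
  have cp: "isCont p t" for t unfolding p_def by (intro continuous_intros)
  have dp: "(p has_derivative (\<lambda>s. s *\<^sub>R (y - x))) (at t)" for t
    unfolding p_def by (auto intro!: derivative_eq_intros simp: algebra_simps)
  have Deq: "D t = frechet_derivative v (at (p t)) (y - x)" for t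
    unfolding D_def by (rule directional_derivative_eq[OF v, symmetric])
  have der: "DERIV (\<lambda>t. v (p t)) t :> D t" for t
  proof -
    have "(v has_derivative frechet_derivative v (at (p t))) (at (p t))"
      using smooth_funD(1)[OF v] frechet_derivative_works by blast
    from diff_chain_at[OF dp this]
    have "((\<lambda>t. v (p t)) has_derivative (\<lambda>s. frechet_derivative v (at (p t)) (s *\<^sub>R (y - x)))) (at t)"
      by (simp add: o_def)
    moreover have "linear (frechet_derivative v (at (p t)))"
      using smooth_funD(1)[OF v] by (rule linear_frechet_derivative)
    ultimately show ?thesis
      unfolding has_field_derivative_def Deq by (simp add: linear_scale mult.commute[of _ "frechet_derivative _ _ _"])
  qed
  have cD: "isCont D t" for t
    unfolding D_def
  proof (intro continuous_intros)
    fix i :: 'a assume "i \<in> Basis"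
    then have "isCont (pderivative v i) (p t)"
      using smooth_funD(3)[OF v] by (simp add: continuous_on_eq_continuous_at)
    then show "isCont (\<lambda>t. pderivative v i (p t)) t" by (rule isCont_o2[OF cp])
  qed
  have [measurable]: "D \<in> borel_measurable borel"
    by (intro borel_measurable_continuous_onI) (simp add: continuous_on_eq_continuous_at cD)
  have [measurable]: "p \<in> borel_measurable borel"
    by (intro borel_measurable_continuous_onI) (simp add: continuous_on_eq_continuous_at cp)
  note [measurable] = smooth_fun_measurable(3)[OF v]
  have hb: "has_bochner_integral lborel (\<lambda>t. D t * indicator {0..s} t) (v (p s) - v (p 0))"
    by (rule has_bochner_integral_FTC_Icc_real[OF s]) (use der cD in auto)
  have "ennreal \<bar>v (p s) - v (p 0)\<bar> \<le> (\<integral>\<^sup>+t. norm (D t * indicator {0..s} t) \<partial>lborel)"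
    using integral_norm_bound_ennreal[OF integrable.intros[OF hb]]
      has_bochner_integral_integral_eq[OF hb] by simp
  \<comment> \<open>The indicator is doubled so that one copy can serve as the other factor in
    Cauchy-Schwarz.\<close>
  also have "\<dots> = (\<integral>\<^sup>+t. indicator {0..s} t * (indicator {0..s} t * ennreal \<bar>D t\<bar>) \<partial>lborel)"
    by (intro nn_integral_cong) (auto simp: indicator_def)
  finally have "(ennreal \<bar>v (p s) - v (p 0)\<bar>)\<^sup>2
      \<le> (\<integral>\<^sup>+t. indicator {0..s} t * (indicator {0..s} t * ennreal \<bar>D t\<bar>) \<partial>lborel)\<^sup>2"
    by (rule power_mono) simp
  also have "\<dots> \<le> (\<integral>\<^sup>+t. (indicator {0..s} t)\<^sup>2 \<partial>lborel) * (\<integral>\<^sup>+t. (indicator {0..s} t * ennreal \<bar>D t\<bar>)\<^sup>2 \<partial>lborel)"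
    by (rule Cauchy_Schwarz_nn_integral) measurable
  also have "(\<integral>\<^sup>+t. (indicator {0..s} t)\<^sup>2 \<partial>(lborel :: real measure)) = (\<integral>\<^sup>+t. indicator {0..s} t \<partial>lborel)"
    by (intro nn_integral_cong) (auto simp: indicator_def)
  also have "\<dots> = ennreal s" using s by simp
  also have "(\<integral>\<^sup>+t. (indicator {0..s} t * ennreal \<bar>D t\<bar>)\<^sup>2 \<partial>lborel)
     \<le> (\<integral>\<^sup>+t. ennreal ((dist x y)\<^sup>2) * (indicator {0..s} t * ennreal (grad_sq v (p t))) \<partial>lborel)"
  proof (rule nn_integral_mono)
    fix t
    have "(D t)\<^sup>2 \<le> grad_sq v (p t) * (norm (y - x))\<^sup>2"
      unfolding Deq by (rule directional_deriv_sq_le[OF v])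
    then have "ennreal ((D t)\<^sup>2) \<le> ennreal ((dist x y)\<^sup>2) * ennreal (grad_sq v (p t))"
      by (simp add: ennreal_mult'[symmetric] grad_sq_nonneg ennreal_leI dist_norm norm_minus_commute mult.commute)
    then show "(indicator {0..s} t * ennreal \<bar>D t\<bar>)\<^sup>2
      \<le> ennreal ((dist x y)\<^sup>2) * (indicator {0..s} t * ennreal (grad_sq v (p t)))"
      by (auto simp: indicator_def ennreal_power)
  qed
  also have "\<dots> = ennreal ((dist x y)\<^sup>2) * (\<integral>\<^sup>+t. indicator {0..s} t * ennreal (grad_sq v (p t)) \<partial>lborel)"
    by (rule nn_integral_cmult) measurable
  finally show ?thesis
    using s by (simp add: p_def ennreal_power ennreal_mult' mult.assoc mult_left_mono)
qed

section \<open>The Poincare and trace inequalities\<close>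

lemma nn_integral_Icc_const:
  assumes "0 \<le> \<epsilon>"
  shows "(\<integral>\<^sup>+t. indicator {0..\<epsilon>} t * C \<partial>lborel) = ennreal \<epsilon> * C"
proof -
  have "(\<integral>\<^sup>+t. indicator {0..\<epsilon>} t * C \<partial>lborel) = (\<integral>\<^sup>+t. indicator {0..\<epsilon>} t \<partial>lborel) * C"
    by (rule nn_integral_multc) simp
  also have "\<dots> = ennreal \<epsilon> * C" using assms by simp
  finally show ?thesis .
qed

text \<open>One of the coefficients t and 1 - t is at least 1/2. Integrating first in the variable
  that carries it keeps the Jacobian bounded uniformly in t.\<close>

lemma segment_average_le:
  fixes g :: "'a::euclidean_space \<Rightarrow> ennreal"
  assumes [measurable]: "g \<in> borel_measurable borel" "K \<in> sets borel"
  shows "(\<integral>\<^sup>+x. (\<integral>\<^sup>+y. indicator K x * indicator K y * g ((1 - t) *\<^sub>R x + t *\<^sub>R y) \<partial>lborel) \<partial>lborel)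
    \<le> ennreal (2 ^ DIM('a)) * emeasure lborel K * (\<integral>\<^sup>+x. g x \<partial>lborel)"
proof -
  let ?I = "\<lambda>t. \<integral>\<^sup>+x. (\<integral>\<^sup>+y. indicator K x * indicator K y * g ((1 - t) *\<^sub>R x + t *\<^sub>R y) \<partial>lborel) \<partial>lborel"
    and ?B = "ennreal (2 ^ DIM('a)) * emeasure lborel K * (\<integral>\<^sup>+x. g x \<partial>lborel)" and ?C = "ennreal (2 ^ DIM('a)) * (\<integral>\<^sup>+x. g x \<partial>lborel)"
  have *: "?I t
    \<le> ?B" if t: "1/2 \<le> t" for t :: real
  proof -
    have "?I t
       \<le> (\<integral>\<^sup>+x. indicator K x * ?C \<partial>lborel)"
    proof (rule nn_integral_mono)
      fix x
      have "(\<integral>\<^sup>+y. indicator K x * indicator K y * g ((1 - t) *\<^sub>R x + t *\<^sub>R y) \<partial>lborel)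
         \<le> (\<integral>\<^sup>+y. indicator K x * g ((1 - t) *\<^sub>R x + t *\<^sub>R y) \<partial>lborel)"
        by (intro nn_integral_mono) (auto simp: indicator_def)
      also have "\<dots> = indicator K x * (\<integral>\<^sup>+y. g ((1 - t) *\<^sub>R x + t *\<^sub>R y) \<partial>lborel)"
        by (rule nn_integral_cmult) measurable
      also have "\<dots> \<le> indicator K x * ?C"
        by (intro mult_left_mono nn_integral_convex_comb_le) (use t in auto)
      finally show "(\<integral>\<^sup>+y. indicator K x * indicator K y * g ((1 - t) *\<^sub>R x + t *\<^sub>R y) \<partial>lborel)
         \<le> indicator K x * ?C" .
    qed
    also have "\<dots> = emeasure lborel K * ?C"
      by (subst nn_integral_multc) auto
    finally show ?thesis by (simp add: mult_ac)
  qed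
  show ?thesis
  proof (cases "1/2 \<le> t")
    case False
    have "?I t
        = (\<integral>\<^sup>+y. (\<integral>\<^sup>+x. indicator K x * indicator K y * g ((1 - t) *\<^sub>R x + t *\<^sub>R y) \<partial>lborel) \<partial>lborel)"
      by (rule lborel_pair.Fubini') measurable
    also have "\<dots> = ?I (1 - t)"
      by (simp add: mult.commute add.commute)
    also have "\<dots> \<le> ?B"
      by (rule *) (use False in auto)
    finally show ?thesis .
  qed (rule *)
qed

text \<open>Over pairs of points no mean value occurs, and the increment is an integral along a
  segment that convexity keeps inside \<open>K\<close>. Fubini reduces the claim to a fixed t. The
  constant knows the cell only through \<open>R\<close> and its measure, so it is uniform over all
  convex shapes.\<close>

lemma poincare_convex:
  fixes v :: "'a::euclidean_space \<Rightarrow> real"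
  assumes v: "smooth_fun v" and K: "open K" "convex K" and R: "\<And>x y. x \<in> K \<Longrightarrow> y \<in> K \<Longrightarrow> dist x y \<le> R"
  shows "(\<integral>\<^sup>+x. (\<integral>\<^sup>+y. indicator K x * indicator K y * ennreal ((v y - v x)\<^sup>2) \<partial>lborel) \<partial>lborel)
    \<le> ennreal (R\<^sup>2 * 2 ^ DIM('a)) * emeasure lborel K * (\<integral>\<^sup>+x. indicator K x * ennreal (grad_sq v x) \<partial>lborel)"
proof -
  have [measurable]: "K \<in> sets borel" using K by (simp add: borel_open)
  note [measurable] = smooth_fun_measurable(1,3)[OF v]
  define g where "g x = indicator K x * ennreal (grad_sq v x)" for x
  have g[measurable]: "g \<in> borel_measurable borel" unfolding g_def by measurable
  let ?J = "\<lambda>t x y. indicator {0..1::real} t * (indicator K x * indicator K y * g ((1 - t) *\<^sub>R x + t *\<^sub>R y))"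
  let ?C = "ennreal (2 ^ DIM('a)) * emeasure lborel K * (\<integral>\<^sup>+x. g x \<partial>lborel)"
  have "(\<integral>\<^sup>+x. (\<integral>\<^sup>+y. indicator K x * indicator K y * ennreal ((v y - v x)\<^sup>2) \<partial>lborel) \<partial>lborel)
    \<le> (\<integral>\<^sup>+x. (\<integral>\<^sup>+y. ennreal (R\<^sup>2) * (\<integral>\<^sup>+t. ?J t x y \<partial>lborel) \<partial>lborel) \<partial>lborel)"
  proof (intro nn_integral_mono)
    fix x y
    show "indicator K x * indicator K y * ennreal ((v y - v x)\<^sup>2) \<le> ennreal (R\<^sup>2) * (\<integral>\<^sup>+t. ?J t x y \<partial>lborel)"
    proof (cases "x \<in> K \<and> y \<in> K")
      case True
      have "ennreal ((v y - v x)\<^sup>2) \<le> ennreal ((dist x y)\<^sup>2)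
          * (\<integral>\<^sup>+t. indicator {0..1} t * ennreal (grad_sq v ((1 - t) *\<^sub>R x + t *\<^sub>R y)) \<partial>lborel)"
        using increment_sq_le[OF v, of 1 x y] by simp
      also have "\<dots> \<le> ennreal (R\<^sup>2) * (\<integral>\<^sup>+t. ?J t x y \<partial>lborel)"
      proof (rule mult_mono)
        show "ennreal ((dist x y)\<^sup>2) \<le> ennreal (R\<^sup>2)"
          using R True by (intro ennreal_leI power_mono) auto
        show "(\<integral>\<^sup>+t. indicator {0..1} t * ennreal (grad_sq v ((1 - t) *\<^sub>R x + t *\<^sub>R y)) \<partial>lborel)
          \<le> (\<integral>\<^sup>+t. ?J t x y \<partial>lborel)"
        proof (rule nn_integral_mono)
          fix t :: real
          have "(1 - t) *\<^sub>R x + t *\<^sub>R y \<in> K" if "t \<in> {0..1}"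
            by (rule convexD_alt) (use True K that in auto)
          then show "indicator {0..1} t * ennreal (grad_sq v ((1 - t) *\<^sub>R x + t *\<^sub>R y)) \<le> ?J t x y"
            using True by (auto simp: indicator_def g_def)
        qed
      qed auto
      finally show ?thesis using True by simp
    qed (auto simp: indicator_def)
  qed
  also have "\<dots> = (\<integral>\<^sup>+x. ennreal (R\<^sup>2) * (\<integral>\<^sup>+y. (\<integral>\<^sup>+t. ?J t x y \<partial>lborel) \<partial>lborel) \<partial>lborel)"
    by (intro nn_integral_cong nn_integral_cmult) measurable
  also have "\<dots> = ennreal (R\<^sup>2) * (\<integral>\<^sup>+x. (\<integral>\<^sup>+y. (\<integral>\<^sup>+t. ?J t x y \<partial>lborel) \<partial>lborel) \<partial>lborel)"
    by (rule nn_integral_cmult) measurable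
  also have "(\<integral>\<^sup>+x. (\<integral>\<^sup>+y. (\<integral>\<^sup>+t. ?J t x y \<partial>lborel) \<partial>lborel) \<partial>lborel)
     = (\<integral>\<^sup>+x. (\<integral>\<^sup>+t. (\<integral>\<^sup>+y. ?J t x y \<partial>lborel) \<partial>lborel) \<partial>lborel)"
    by (rule nn_integral_cong, rule lborel_pair.Fubini') measurable
  also have "\<dots> = (\<integral>\<^sup>+t. (\<integral>\<^sup>+x. (\<integral>\<^sup>+y. ?J t x y \<partial>lborel) \<partial>lborel) \<partial>lborel)"
    by (rule lborel_pair.Fubini') measurable
  also have "\<dots> \<le> (\<integral>\<^sup>+t. indicator {0..1::real} t * ?C \<partial>lborel)"
  proof (rule nn_integral_mono)
    fix t :: real
    show "(\<integral>\<^sup>+x. (\<integral>\<^sup>+y. ?J t x y \<partial>lborel) \<partial>lborel) \<le> indicator {0..1} t * ?C"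
      using segment_average_le[OF g, of K t] by (cases "t \<in> {0..1}") simp_all
  qed
  also have "\<dots> = ?C" by (simp add: nn_integral_Icc_const)
  finally show ?thesis
    unfolding g_def by (simp add: ennreal_mult' mult.assoc mult_left_mono)
qed

text \<open>The value at a boundary point is compared with the values on the initial part of the
  segment to \<open>x0\<close>, averaged over parameters up to \<epsilon>, and then integrated in
  cone coordinates. Two choices are used later: \<open>v\<close> minus a cell mean with \<epsilon> =
  1/2 for the seminorm, and a truncation with \<epsilon> tending to zero for pointwise bounds on
  traces.\<close>

lemma trace_inequality:
  fixes v :: "'a::euclidean_space \<Rightarrow> real"
  assumes v: "smooth_fun v" and K: "open K" "convex K" "x0 \<in> K"
    and R: "\<And>x. x \<in> closure K \<Longrightarrow> dist x x0 \<le> R"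
    and a: "norm a = 1" "a \<bullet> x0 \<noteq> c" and q: "\<And>s s'. \<bar>q s - q s'\<bar> \<le> \<bar>s - s'\<bar>"
    and \<epsilon>: "0 < \<epsilon>" "\<epsilon> \<le> 1/2"
  shows "(\<integral>\<^sup>+x. indicator (closure K \<inter> {x. a \<bullet> x = c}) x * ennreal ((q (v x))\<^sup>2) \<partial>hyperplane_borel a c)
    \<le> ennreal (2 ^ DIM('a) / \<bar>a \<bullet> x0 - c\<bar>) *
      (ennreal (2 * \<epsilon> * R\<^sup>2) * (\<integral>\<^sup>+x. indicator K x * ennreal (grad_sq v x) \<partial>lborel)
       + ennreal (2 / \<epsilon>) * (\<integral>\<^sup>+x. indicator K x * ennreal ((q (v x))\<^sup>2) \<partial>lborel))"
proof -
  have [measurable]: "K \<in> sets borel" using K by (simp add: borel_open)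
  note [measurable] = smooth_fun_measurable(1,3)[OF v]
  have "continuous_on UNIV q"
    unfolding continuous_on_iff dist_real_def using q by (metis le_less_trans)
  then have [measurable]: "q \<in> borel_measurable borel" by (rule borel_measurable_continuous_onI)
  define g where "g x = indicator K x * ennreal (grad_sq v x)" for x
  have g[measurable]: "g \<in> borel_measurable borel" unfolding g_def by measurable
  define h where "h x = indicator K x * ennreal ((q (v x))\<^sup>2)" for x
  have h[measurable]: "h \<in> borel_measurable borel" unfolding h_def by measurable
  let ?z = "\<lambda>x t. (1 - t) *\<^sub>R x + t *\<^sub>R x0"
  define A where "A f x = (\<integral>\<^sup>+t. indicator {0..\<epsilon>} t * f (?z x t) \<partial>lborel)" for f :: "'a \<Rightarrow> ennreal" and x
  let ?F = "closure K \<inter> {x. a \<bullet> x = c}" and ?\<mu> = "hyperplane_borel a c"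
  have Ameas: "(\<lambda>x. A f x) \<in> borel_measurable ?\<mu>" if [measurable]: "f \<in> borel_measurable borel" for f
    unfolding A_def by measurable
  \<comment> \<open>At t = 0 the segment point is \<open>x\<close> itself, which need not lie in the
    open set \<open>K\<close>; for 0 < t \<le> \<epsilon> the point is inside.\<close>
  have ae: "AE t in lborel. t \<noteq> (0::real)" by (rule AE_lborel_singleton)
  have pt: "indicator ?F x * ennreal ((q (v x))\<^sup>2)
      \<le> ennreal (2 * \<epsilon> * R\<^sup>2) * A g x + ennreal (2 / \<epsilon>) * A h x" for x
  proof (cases "x \<in> ?F")
    case True
    then have x: "x \<in> closure K" by simp
    have zK: "?z x t \<in> K" if "0 < t" "t \<le> \<epsilon>" for t
    proof -
      have "x0 \<in> interior K" using K by (simp add: interior_open)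
      then have "x - t *\<^sub>R (x - x0) \<in> interior K"
        by (rule mem_interior_closure_convex_shrink[OF K(2) _ x]) (use that \<epsilon> in auto)
      moreover have "x - t *\<^sub>R (x - x0) = ?z x t" by (simp add: algebra_simps)
      ultimately show ?thesis using interior_subset by auto
    qed
    have step: "ennreal ((q (v x))\<^sup>2) \<le> ennreal (2 * \<epsilon> * R\<^sup>2) * A g x + 2 * h (?z x t)"
      if t: "0 < t" "t \<le> \<epsilon>" for t
    proof -
      let ?w = "?z x t"
      have "\<bar>q (v x) - q (v ?w)\<bar>\<^sup>2 \<le> \<bar>v ?w - v x\<bar>\<^sup>2"
        by (rule power_mono) (use q[of "v x" "v ?w"] in auto)
      moreover have "0 \<le> (q (v x) - 2 * q (v ?w))\<^sup>2" by simp
      ultimately have "(q (v x))\<^sup>2 \<le> 2 * (v ?w - v x)\<^sup>2 + 2 * (q (v ?w))\<^sup>2"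
        by (simp add: power2_eq_square algebra_simps)
      then have "ennreal ((q (v x))\<^sup>2) \<le> ennreal (2 * (v ?w - v x)\<^sup>2 + 2 * (q (v ?w))\<^sup>2)"
        by (rule ennreal_leI)
      also have "\<dots> = 2 * ennreal ((v ?w - v x)\<^sup>2) + 2 * ennreal ((q (v ?w))\<^sup>2)"
        by (simp add: ennreal_mult')
      also have "2 * ennreal ((v ?w - v x)\<^sup>2) \<le> 2 * (ennreal (\<epsilon> * R\<^sup>2) * A g x)"
      proof (rule mult_left_mono)
        have "ennreal ((v ?w - v x)\<^sup>2)
          \<le> ennreal (t * (dist x x0)\<^sup>2) * (\<integral>\<^sup>+s. indicator {0..t} s * ennreal (grad_sq v (?z x s)) \<partial>lborel)"
          by (rule increment_sq_le[OF v]) (use t in auto)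
        also have "\<dots> \<le> ennreal (\<epsilon> * R\<^sup>2) * A g x"
          unfolding A_def
        proof (intro mult_mono ennreal_leI nn_integral_mono_AE power_mono)
          show "AE s in lborel. indicator {0..t} s * ennreal (grad_sq v (?z x s)) \<le> indicator {0..\<epsilon>} s * g (?z x s)"
            using ae by eventually_elim (use zK t in \<open>auto simp: indicator_def g_def\<close>)
        qed (use t \<epsilon> R[OF x] in auto)
        finally show "ennreal ((v ?w - v x)\<^sup>2) \<le> ennreal (\<epsilon> * R\<^sup>2) * A g x" .
      qed simp
      also have "2 * (ennreal (\<epsilon> * R\<^sup>2) * A g x) = ennreal (2 * \<epsilon> * R\<^sup>2) * A g x"
        using \<epsilon> by (simp add: ennreal_mult' mult.assoc)
      also have "ennreal ((q (v ?w))\<^sup>2) = h ?w" using zK[OF t] by (simp add: h_def)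
      finally show ?thesis by (simp add: add_right_mono)
    qed
    have e1: "ennreal (1 / \<epsilon>) * ennreal \<epsilon> = 1" using \<epsilon> by (simp flip: ennreal_mult')
    \<comment> \<open>The value at \<open>x\<close> does not depend on t, so it may be replaced by
      its average over [0, \<epsilon>] before the pointwise estimate is inserted.\<close>
    have "ennreal ((q (v x))\<^sup>2) = ennreal (1 / \<epsilon>) * (ennreal \<epsilon> * ennreal ((q (v x))\<^sup>2))"
      unfolding mult.assoc[symmetric] e1 by simp
    also have "ennreal \<epsilon> * ennreal ((q (v x))\<^sup>2) = (\<integral>\<^sup>+t. indicator {0..\<epsilon>} t * ennreal ((q (v x))\<^sup>2) \<partial>lborel)"
      by (rule nn_integral_Icc_const[OF less_imp_le[OF \<epsilon>(1)], symmetric])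
    also have "\<dots> \<le> (\<integral>\<^sup>+t. indicator {0..\<epsilon>} t * (ennreal (2 * \<epsilon> * R\<^sup>2) * A g x) + 2 * (indicator {0..\<epsilon>} t * h (?z x t)) \<partial>lborel)"
    proof (rule nn_integral_mono_AE)
      show "AE t in lborel. indicator {0..\<epsilon>} t * ennreal ((q (v x))\<^sup>2)
         \<le> indicator {0..\<epsilon>} t * (ennreal (2 * \<epsilon> * R\<^sup>2) * A g x) + 2 * (indicator {0..\<epsilon>} t * h (?z x t))"
        using ae by eventually_elim (use step in \<open>auto simp: indicator_def\<close>)
    qed
    also have "\<dots> = ennreal \<epsilon> * (ennreal (2 * \<epsilon> * R\<^sup>2) * A g x) + 2 * A h x"
    proof -
      have "(\<integral>\<^sup>+t. indicator {0..\<epsilon>} t * (ennreal (2 * \<epsilon> * R\<^sup>2) * A g x) \<partial>lborel)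
          = ennreal \<epsilon> * (ennreal (2 * \<epsilon> * R\<^sup>2) * A g x)"
        by (rule nn_integral_Icc_const[OF less_imp_le[OF \<epsilon>(1)]])
      moreover have "(\<integral>\<^sup>+t. 2 * (indicator {0..\<epsilon>} t * h (?z x t)) \<partial>lborel) = 2 * A h x"
        unfolding A_def by (rule nn_integral_cmult) measurable
      ultimately show ?thesis by (subst nn_integral_add) simp_all
    qed
    also have "ennreal (1 / \<epsilon>) * \<dots> = ennreal (2 * \<epsilon> * R\<^sup>2) * A g x + ennreal (2 / \<epsilon>) * A h x"
    proof -
      have "ennreal (1 / \<epsilon>) * 2 = ennreal (2 / \<epsilon>)"
        using ennreal_mult''[of 2 "1 / \<epsilon>"] \<epsilon> by simp
      then show ?thesis unfolding distrib_left mult.assoc[symmetric] e1 by simp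
    qed
    finally show ?thesis using True by (simp add: mult_left_mono)
  qed simp
  have "(\<integral>\<^sup>+x. indicator ?F x * ennreal ((q (v x))\<^sup>2) \<partial>?\<mu>)
      \<le> (\<integral>\<^sup>+x. ennreal (2 * \<epsilon> * R\<^sup>2) * A g x + ennreal (2 / \<epsilon>) * A h x \<partial>?\<mu>)"
    by (intro nn_integral_mono pt)
  also have "\<dots> = ennreal (2 * \<epsilon> * R\<^sup>2) * (\<integral>\<^sup>+x. A g x \<partial>?\<mu>) + ennreal (2 / \<epsilon>) * (\<integral>\<^sup>+x. A h x \<partial>?\<mu>)"
  proof -
    have "(\<integral>\<^sup>+x. ennreal r * A f x \<partial>?\<mu>) = ennreal r * (\<integral>\<^sup>+x. A f x \<partial>?\<mu>)"
      if "f \<in> borel_measurable borel" for r f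
      by (rule nn_integral_cmult[OF Ameas[OF that]])
    note * = this[OF g] this[OF h]
    note [measurable] = Ameas[OF g] Ameas[OF h]
    show ?thesis unfolding *[symmetric] by (rule nn_integral_add) measurable
  qed
  also have "\<dots> \<le> ennreal (2 * \<epsilon> * R\<^sup>2) * (ennreal (2 ^ DIM('a) / \<bar>a \<bullet> x0 - c\<bar>) * (\<integral>\<^sup>+x. g x \<partial>lborel))
      + ennreal (2 / \<epsilon>) * (ennreal (2 ^ DIM('a) / \<bar>a \<bullet> x0 - c\<bar>) * (\<integral>\<^sup>+x. h x \<partial>lborel))"
    unfolding A_def by (intro add_mono mult_left_mono nn_integral_cone_le g h a \<epsilon>) auto
  finally show ?thesis unfolding g_def h_def by (simp add: distrib_left mult.left_commute)
qed

section \<open>Averages and smooth approximations\<close>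

lemma nn_integral_set_eq:
  assumes "set_integrable M S g" "\<And>x. x \<in> S \<Longrightarrow> 0 \<le> g x"
  shows "(\<integral>\<^sup>+x. indicator S x * ennreal (g x) \<partial>M) = ennreal (LINT x:S|M. g x)"
proof -
  have "(\<integral>\<^sup>+x. indicator S x * ennreal (g x) \<partial>M) = (\<integral>\<^sup>+x. ennreal (indicator S x *\<^sub>R g x) \<partial>M)"
    by (intro nn_integral_cong) (auto simp: indicator_def)
  also have "\<dots> = ennreal (LINT x:S|M. g x)"
    unfolding set_lebesgue_integral_def using assms
    by (intro nn_integral_eq_integral) (auto simp: set_integrable_def indicator_def)
  finally show ?thesis .
qed

lemma set_integrable_constant:
  fixes c :: real
  assumes "A \<in> sets M" "emeasure M A < \<infinity>"
  shows "set_integrable M A (\<lambda>_. c)"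
  unfolding set_integrable_def using assms
  by (intro integrable_scaleR_left integrable_real_indicator) auto

text \<open>Jensen's inequality for the square, by way of Cauchy-Schwarz. The free \<open>c\<close>
  is later zero, a point value or a cell mean.\<close>

lemma average_deviation:
  fixes f :: "'b \<Rightarrow> real"
  assumes f: "set_integrable M A f" and A: "A \<in> sets M" "measure M A > 0"
  shows "ennreal (measure M A * ((LINT x:A|M. f x) / measure M A - c)\<^sup>2)
    \<le> (\<integral>\<^sup>+x. indicator A x * ennreal ((f x - c)\<^sup>2) \<partial>M)"
proof -
  let ?\<mu> = "measure M A" and ?X = "\<integral>\<^sup>+x. indicator A x * ennreal ((f x - c)\<^sup>2) \<partial>M"
  have fin: "emeasure M A < \<infinity>" using A(2) by (simp add: measure_def enn2real_positive_iff)
  have c: "set_integrable M A (\<lambda>_. c)"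
    using A(1) fin by (rule set_integrable_constant)
  have fc: "set_integrable M A (\<lambda>x. f x - c)" using f c by (rule set_integral_diff)
  then have [measurable]: "(\<lambda>x. indicator A x *\<^sub>R (f x - c)) \<in> borel_measurable M"
    unfolding set_integrable_def by (rule borel_measurable_integrable)
  have A'[measurable]: "A \<in> sets M" by fact
  have I: "(LINT x:A|M. f x - c) = ?\<mu> * ((LINT x:A|M. f x) / ?\<mu> - c)"
  proof -
    have "(LINT x:A|M. c) = ?\<mu> * c"
      using fin A(1) by (simp add: set_lebesgue_integral_def mult.commute)
    then have "(LINT x:A|M. f x - c) = (LINT x:A|M. f x) - ?\<mu> * c"
      using set_integral_diff(2)[OF f c] by simp
    then show ?thesis using A(2) by (simp add: right_diff_distrib)
  qed
  have "ennreal \<bar>LINT x:A|M. f x - c\<bar> \<le> (\<integral>\<^sup>+x. ennreal \<bar>indicator A x *\<^sub>R (f x - c)\<bar> \<partial>M)"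
    using integral_norm_bound_ennreal[OF fc[unfolded set_integrable_def]]
    by (simp add: set_lebesgue_integral_def)
  also have "\<dots> = (\<integral>\<^sup>+x. indicator A x * ennreal \<bar>indicator A x *\<^sub>R (f x - c)\<bar> \<partial>M)"
    by (intro nn_integral_cong) (auto simp: indicator_def)
  finally have "(ennreal \<bar>LINT x:A|M. f x - c\<bar>)\<^sup>2
     \<le> (\<integral>\<^sup>+x. indicator A x * ennreal \<bar>indicator A x *\<^sub>R (f x - c)\<bar> \<partial>M)\<^sup>2"
    by (rule power_mono) simp
  also have "\<dots> \<le> (\<integral>\<^sup>+x. (indicator A x)\<^sup>2 \<partial>M) * (\<integral>\<^sup>+x. (ennreal \<bar>indicator A x *\<^sub>R (f x - c)\<bar>)\<^sup>2 \<partial>M)"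
    by (rule Cauchy_Schwarz_nn_integral) measurable
  also have "(\<integral>\<^sup>+x. (indicator A x)\<^sup>2 \<partial>M) = (\<integral>\<^sup>+x. indicator A x \<partial>M)"
    by (intro nn_integral_cong) (auto simp: indicator_def)
  also have "\<dots> = ennreal ?\<mu>" using A fin by (simp add: emeasure_eq_ennreal_measure less_top)
  also have "(\<integral>\<^sup>+x. (ennreal \<bar>indicator A x *\<^sub>R (f x - c)\<bar>)\<^sup>2 \<partial>M) = ?X"
    by (intro nn_integral_cong) (auto simp: indicator_def ennreal_power)
  finally have 1: "ennreal ((?\<mu> * ((LINT x:A|M. f x) / ?\<mu> - c))\<^sup>2) \<le> ennreal ?\<mu> * ?X"
    unfolding I by (simp add: ennreal_power)
  have "ennreal (?\<mu> * ((LINT x:A|M. f x) / ?\<mu> - c)\<^sup>2)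
      = ennreal (1 / ?\<mu>) * ennreal ((?\<mu> * ((LINT x:A|M. f x) / ?\<mu> - c))\<^sup>2)"
    using A(2) by (subst ennreal_mult'[symmetric]) (auto simp: power2_eq_square mult_ac)
  also have "\<dots> \<le> ennreal (1 / ?\<mu>) * (ennreal ?\<mu> * ?X)"
    using 1 by (rule mult_left_mono) simp
  also have "\<dots> = ?X"
    using A(2) by (simp add: mult.assoc[symmetric] ennreal_mult'[symmetric])
  finally show ?thesis .
qed

lemma L2_on_set_integrable:
  assumes "L2_on M S d" "A \<in> sets M" "A \<subseteq> S" "emeasure M A < \<infinity>"
  shows "set_integrable M A d"
proof -
  have sq: "set_integrable M A (\<lambda>x. (d x)\<^sup>2)"
    using assms set_integrable_subset[of M S "\<lambda>x. (d x)\<^sup>2" A] by (auto simp: L2_on_def)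
  have one: "set_integrable M A (\<lambda>_. 1::real)"
    using assms(2,4) by (rule set_integrable_constant)
  have "set_borel_measurable M A d"
    using assms set_borel_measurable_subset[of M S d A] by (auto simp: L2_on_def)
  then show ?thesis
    unfolding set_integrable_def set_borel_measurable_def
  proof (rule Bochner_Integration.integrable_bound[OF set_integral_add(1)[OF sq one, unfolded set_integrable_def]])
    have "\<bar>r\<bar> \<le> r\<^sup>2 + 1" for r :: real
      using zero_le_power2[of "\<bar>r\<bar> - 1"] by (simp add: power2_eq_square algebra_simps)
    then show "AE x in M. norm (indicator A x *\<^sub>R d x) \<le> norm (indicator A x *\<^sub>R ((d x)\<^sup>2 + 1))"
      by (intro always_eventually) (auto simp: indicator_def)
  qed
qed

text \<open>\<open>L2_tendsto\<close> only speaks of the differences \<open>v k - f\<close>;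
  integrability of \<open>f\<close> on \<open>A\<close> follows from that of \<open>v k\<close> and
  of the difference. The integral of the difference is controlled by
  \<open>average_deviation\<close> with c = 0.\<close>

lemma L2_tendsto_average:
  assumes L: "L2_tendsto M S v f" and A: "A \<in> sets M" "A \<subseteq> S" "measure M A > 0"
    and v: "\<And>k. set_integrable M A (v k)"
  shows "(\<lambda>k. LINT x:A|M. v k x) \<longlonglongrightarrow> (LINT x:A|M. f x)"
proof -
  have fin: "emeasure M A < \<infinity>" using A(3) by (simp add: measure_def enn2real_positive_iff)
  let ?\<mu> = "measure M A"
  define d where "d k x = v k x - f x" for k x
  define e where "e k = (LINT x:S|M. (d k x)\<^sup>2)" for k
  have L2: "L2_on M S (d k)" for k using L unfolding L2_tendsto_def d_def by blast
  have e: "e \<longlonglongrightarrow> 0" using L unfolding L2_tendsto_def e_def d_def by blast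
  have d: "set_integrable M A (d k)" for k by (rule L2_on_set_integrable[OF L2 A(1,2) fin])
  have f: "(LINT x:A|M. f x) = (LINT x:A|M. v k x) - (LINT x:A|M. d k x)" for k
    using set_integral_diff(2)[OF v[of k] d[of k]] by (simp add: d_def)
  have e0: "0 \<le> e k" for k unfolding e_def set_lebesgue_integral_def by (intro integral_nonneg_AE) auto
  have "((LINT x:A|M. d k x))\<^sup>2 \<le> ?\<mu> * e k" for k
  proof -
    have "ennreal (?\<mu> * ((LINT x:A|M. d k x) / ?\<mu> - 0)\<^sup>2) \<le> (\<integral>\<^sup>+x. indicator A x * ennreal ((d k x - 0)\<^sup>2) \<partial>M)"
      by (rule average_deviation[OF d A(1,3)])
    also have "\<dots> \<le> (\<integral>\<^sup>+x. indicator S x * ennreal ((d k x)\<^sup>2) \<partial>M)"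
      using A(2) by (intro nn_integral_mono) (auto simp: indicator_def)
    also have "\<dots> = ennreal (e k)"
      using L2 unfolding e_def by (intro nn_integral_set_eq) (auto simp: L2_on_def)
    finally have "?\<mu> * ((LINT x:A|M. d k x) / ?\<mu>)\<^sup>2 \<le> e k"
      using e0 by (simp add: ennreal_le_iff)
    then show ?thesis using A(3) by (simp add: power2_eq_square field_simps)
  qed
  moreover have "(\<lambda>k. ?\<mu> * e k) \<longlonglongrightarrow> 0" using tendsto_mult_left[OF e, of ?\<mu>] by simp
  ultimately have "(\<lambda>k. (LINT x:A|M. d k x)\<^sup>2) \<longlonglongrightarrow> 0"
    by (intro tendsto_sandwich[OF _ _ tendsto_const, of _ "\<lambda>k. (LINT x:A|M. d k x)\<^sup>2"]) auto
  then have "(\<lambda>k. (LINT x:A|M. d k x)) \<longlonglongrightarrow> 0"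
    using tendsto_real_sqrt[of "\<lambda>k. (LINT x:A|M. d k x)\<^sup>2"] by (simp add: tendsto_rabs_zero_iff)
  from tendsto_add[OF this tendsto_const[of "LINT x:A|M. f x"]]
  show ?thesis using f by (simp add: algebra_simps)
qed

lemma set_integrable_continuous:
  fixes f :: "'a::euclidean_space \<Rightarrow> real"
  assumes f: "continuous_on UNIV f" and A: "A \<in> sets M" "emeasure M A < \<infinity>" "bounded A"
    and M: "(borel_measurable borel :: ('a \<Rightarrow> real) set) \<subseteq> borel_measurable M"
  shows "set_integrable M A f"
proof -
  have "compact (closure A)" using A(3) by (simp add: compact_closure)
  then have "bounded (f ` closure A)"
    using f by (meson compact_continuous_image compact_imp_bounded continuous_on_subset subset_UNIV)
  then obtain B where B: "\<And>x. x \<in> A \<Longrightarrow> norm (f x) \<le> B"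
    unfolding bounded_iff using closure_subset by fast
  have "f \<in> borel_measurable M" using borel_measurable_continuous_onI[OF f] M by blast
  then show ?thesis
    unfolding set_integrable_def
    by (intro integrableI_bounded_set_indicator[where B = B]) (use A B in auto)
qed

lemma borel_measurable_hyperplane_measure:
  "borel_measurable borel \<subseteq> borel_measurable (hyperplane_measure a c)"
  "borel_measurable borel \<subseteq> borel_measurable lebesgue"
proof -
  have "f \<in> borel_measurable (hyperplane_borel a c)" if "f \<in> borel_measurable borel" for f :: "'a \<Rightarrow> 'b"
    using that by simp
  then show "borel_measurable borel \<subseteq> borel_measurable (hyperplane_measure a c)"
    unfolding hyperplane_measure_eq by (auto intro: measurable_completion)
qed (auto intro: measurable_completion)

section \<open>Gradient energy and smooth approximating sequences\<close>

definition grad_energy :: "('a::euclidean_space \<Rightarrow> real) \<Rightarrow> 'a set \<Rightarrow> ennreal" where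
  "grad_energy v S = (\<integral>\<^sup>+x. indicator S x * ennreal (grad_sq v x) \<partial>lborel)"

lemma grad_energy_mono: "S \<subseteq> S' \<Longrightarrow> grad_energy v S \<le> grad_energy v S'"
  unfolding grad_energy_def by (intro nn_integral_mono) (auto simp: indicator_def)

text \<open>What the proof retains of \<open>has_trace\<close>: convergence of the functions inside
  and on the boundary, and, in place of convergence of the gradients, an eventual bound
  \<open>G\<close> on their energy. \<open>G\<close> belongs to \<Omega> and the datum, so it can
  enter the final constant.\<close>

definition smooth_approximation ::
  "'a::euclidean_space set \<Rightarrow> ('a \<Rightarrow> real) \<Rightarrow> (nat \<Rightarrow> 'a \<Rightarrow> real) \<Rightarrow> real \<Rightarrow> bool" where
  "smooth_approximation \<Omega> f v G \<longleftrightarrow>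
     (\<forall>k. smooth_fun (v k)) \<and> L2_tendsto lebesgue \<Omega> v f \<and>
     (\<forall>a c. norm a = 1 \<longrightarrow> L2_tendsto (hyperplane_measure a c) (frontier \<Omega> \<inter> {x. a \<bullet> x = c}) v f) \<and>
     0 \<le> G \<and> (\<forall>\<^sub>F k in sequentially. grad_energy (v k) \<Omega> \<le> ennreal G)"

lemma smooth_approximationD:
  assumes "smooth_approximation \<Omega> f v G"
  shows "smooth_fun (v k)" "L2_tendsto lebesgue \<Omega> v f"
    "norm a = 1 \<Longrightarrow> L2_tendsto (hyperplane_measure a c) (frontier \<Omega> \<inter> {x. a \<bullet> x = c}) v f"
    "0 \<le> G" "\<forall>\<^sub>F k in sequentially. grad_energy (v k) \<Omega> \<le> ennreal G"
  using assms unfolding smooth_approximation_def by blast+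

lemma has_trace_approximation:
  assumes "has_trace \<Omega> f f" "open \<Omega>"
  shows "\<exists>v G. smooth_approximation \<Omega> f v G"
proof -
  obtain v where v: "\<And>k. smooth_fun (v k)" "L2_tendsto lebesgue \<Omega> v f"
    "\<And>a c. norm a = 1 \<Longrightarrow> L2_tendsto (hyperplane_measure a c) (frontier \<Omega> \<inter> {x. a \<bullet> x = c}) v f"
    and wex: "\<forall>i\<in>Basis. \<exists>w. L2_weak_pderiv \<Omega> f i w \<and> L2_tendsto lebesgue \<Omega> (\<lambda>k. pderivative (v k) i) w"
    using assms(1) unfolding has_trace_def by blast
  then obtain w where w: "\<And>i. i \<in> Basis \<Longrightarrow> L2_weak_pderiv \<Omega> f i (w i)"
    "\<And>i. i \<in> Basis \<Longrightarrow> L2_tendsto lebesgue \<Omega> (\<lambda>k. pderivative (v k) i) (w i)"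
    by metis
  define W where "W i = (LINT x:\<Omega>|lebesgue. (w i x)\<^sup>2)" for i
  \<comment> \<open>From b^2 \<le> 2 (b - w)^2 + 2 w^2, with the squared error of each partial
    derivative eventually below 1.\<close>
  define G where "G = (\<Sum>i\<in>Basis. 2 + 2 * W i)"
  have W0: "W i \<ge> 0" for i unfolding W_def set_lebesgue_integral_def by (intro integral_nonneg_AE) auto
  have \<Omega>[measurable]: "\<Omega> \<in> sets borel" using assms(2) by (rule borel_open)
  let ?P = "\<lambda>k i. \<integral>\<^sup>+x. indicator \<Omega> x * ennreal ((pderivative (v k) i x)\<^sup>2) \<partial>lborel"
  have "\<forall>\<^sub>F k in sequentially. ?P k i
      \<le> ennreal (2 + 2 * W i)" if i: "i \<in> Basis" for i
  proof -
    define e where "e k = (LINT x:\<Omega>|lebesgue. (pderivative (v k) i x - w i x)\<^sup>2)" for k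
    have L2: "L2_on lebesgue \<Omega> (\<lambda>x. pderivative (v k) i x - w i x)" for k
      using w(2)[OF i] unfolding L2_tendsto_def by blast
    have L2w: "L2_on lebesgue \<Omega> (w i)" using w(1)[OF i] unfolding L2_weak_pderiv_def by blast
    have "e \<longlonglongrightarrow> 0" using w(2)[OF i] unfolding L2_tendsto_def e_def by blast
    then have "\<forall>\<^sub>F k in sequentially. e k < 1" by (rule order_tendstoD) simp
    then show ?thesis
    proof eventually_elim
      fix k assume ek: "e k < 1"
      have "set_integrable lebesgue \<Omega> (\<lambda>x. 2 * (pderivative (v k) i x - w i x)\<^sup>2 + 2 * (w i x)\<^sup>2)"
        using L2[of k] L2w by (intro set_integral_add(1) set_integrable_mult_right) (auto simp: L2_on_def)
      then have *: "(\<integral>\<^sup>+x. indicator \<Omega> x * ennreal (2 * (pderivative (v k) i x - w i x)\<^sup>2 + 2 * (w i x)\<^sup>2) \<partial>lebesgue)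
        = ennreal (LINT x:\<Omega>|lebesgue. 2 * (pderivative (v k) i x - w i x)\<^sup>2 + 2 * (w i x)\<^sup>2)"
        by (rule nn_integral_set_eq) simp
      have "?P k i
        = (\<integral>\<^sup>+x. indicator \<Omega> x * ennreal ((pderivative (v k) i x)\<^sup>2) \<partial>lebesgue)"
        by (simp add: nn_integral_completion)
      also have "\<dots> \<le> (\<integral>\<^sup>+x. indicator \<Omega> x * ennreal (2 * (pderivative (v k) i x - w i x)\<^sup>2 + 2 * (w i x)\<^sup>2) \<partial>lebesgue)"
      proof (intro nn_integral_mono mult_left_mono ennreal_leI)
        fix x
        have "0 \<le> (pderivative (v k) i x - 2 * w i x)\<^sup>2" by simp
        then show "(pderivative (v k) i x)\<^sup>2 \<le> 2 * (pderivative (v k) i x - w i x)\<^sup>2 + 2 * (w i x)\<^sup>2"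
          by (simp add: power2_eq_square algebra_simps)
      qed simp
      also note *
      also have "(LINT x:\<Omega>|lebesgue. 2 * (pderivative (v k) i x - w i x)\<^sup>2 + 2 * (w i x)\<^sup>2) = 2 * e k + 2 * W i"
        using L2[of k] L2w unfolding e_def W_def
        by (subst set_integral_add(2)) (auto simp: L2_on_def)
      also have "ennreal (2 * e k + 2 * W i) \<le> ennreal (2 + 2 * W i)"
        using ek by (intro ennreal_leI) simp
      finally show "?P k i \<le> ennreal (2 + 2 * W i)" .
    qed
  qed
  then have "\<forall>\<^sub>F k in sequentially. \<forall>i\<in>Basis.
      ?P k i \<le> ennreal (2 + 2 * W i)"
    by (intro eventually_ball_finite) auto
  then have ev: "\<forall>\<^sub>F k in sequentially. (\<integral>\<^sup>+x. indicator \<Omega> x * ennreal (grad_sq (v k) x) \<partial>lborel) \<le> ennreal G"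
  proof eventually_elim
    fix k
    assume k: "\<forall>i\<in>Basis. ?P k i \<le> ennreal (2 + 2 * W i)"
    have "(\<integral>\<^sup>+x. indicator \<Omega> x * ennreal (grad_sq (v k) x) \<partial>lborel)
       = (\<integral>\<^sup>+x. (\<Sum>i\<in>Basis. indicator \<Omega> x * ennreal ((pderivative (v k) i x)\<^sup>2)) \<partial>lborel)"
      unfolding grad_sq_def by (simp add: sum_distrib_left[symmetric] sum_ennreal)
    also have "\<dots> = (\<Sum>i\<in>Basis. ?P k i)"
    proof (rule nn_integral_sum)
      fix i :: 'a assume i: "i \<in> Basis"
      note [measurable] = smooth_fun_measurable(2)[OF v(1) i]
      show "(\<lambda>x. indicator \<Omega> x * ennreal ((pderivative (v k) i x)\<^sup>2)) \<in> borel_measurable lborel" by measurable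
    qed
    also have "\<dots> \<le> (\<Sum>i\<in>Basis. ennreal (2 + 2 * W i))" using k by (intro sum_mono) auto
    also have "\<dots> = ennreal G" unfolding G_def using W0 by (intro sum_ennreal) (simp add: add_nonneg_nonneg)
    finally show "(\<integral>\<^sup>+x. indicator \<Omega> x * ennreal (grad_sq (v k) x) \<partial>lborel) \<le> ennreal G" .
  qed
  have "0 \<le> G" unfolding G_def using W0 by (intro sum_nonneg) (simp add: add_nonneg_nonneg)
  then show ?thesis unfolding smooth_approximation_def grad_energy_def using v ev by blast
qed

section \<open>The discrete seminorm of the boundary data\<close>

lemma ennreal_mult_mult:
  assumes "0 \<le> x" "0 \<le> y"
  shows "ennreal x * (ennreal y * z) = ennreal (x * y) * z"
  using assms by (simp add: ennreal_mult mult.assoc)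

lemma ennreal_mult_add:
  assumes "0 \<le> x" "0 \<le> y"
  shows "ennreal x * z + ennreal y * z = ennreal (x + y) * z"
  using assms by (simp add: distrib_right)

context regular_admissible_mesh
begin

section \<open>Estimates for smooth functions on cells and edges\<close>

text \<open>The cone has its apex at the cell centre; \<open>center_height\<close> replaces its
  height by \<xi> times the diameter, which no longer depends on the edge.\<close>

lemma edge_trace_inequality:
  assumes K: "K \<in> \<T>" and s: "\<sigma> \<in> edges_of \<M> K"
    and a: "in_hyperplane a c \<sigma>" "measure (hyperplane_measure a c) \<sigma> > 0"
    and v: "smooth_fun v" and q: "\<And>s s'. \<bar>q s - q s'\<bar> \<le> \<bar>s - s'\<bar>"
    and \<epsilon>: "0 < \<epsilon>" "\<epsilon> \<le> 1/2"
  shows "(\<integral>\<^sup>+x. indicator \<sigma> x * ennreal ((q (v x))\<^sup>2) \<partial>hyperplane_measure a c)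
    \<le> ennreal (2 ^ DIM('a) / (\<xi> * diameter K)) *
      (ennreal (2 * \<epsilon> * (diameter K)\<^sup>2) * grad_energy v K
       + ennreal (2 / \<epsilon>) * (\<integral>\<^sup>+x. indicator K x * ennreal ((q (v x))\<^sup>2) \<partial>lborel))"
proof -
  let ?x = "center \<M> K" and ?F = "closure K \<inter> {x. a \<bullet> x = c}"
  have r: "0 < \<xi> * diameter K" using \<xi>_pos diameter_pos[OF K] by simp
  have h: "\<xi> * diameter K \<le> \<bar>a \<bullet> ?x - c\<bar>" by (rule center_height[OF K s a])
  have na: "norm a = 1" "\<sigma> \<subseteq> {x. a \<bullet> x = c}" using a(1) by (auto simp: in_hyperplane_def)
  have "(\<integral>\<^sup>+x. indicator \<sigma> x * ennreal ((q (v x))\<^sup>2) \<partial>hyperplane_measure a c)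
     \<le> (\<integral>\<^sup>+x. indicator ?F x * ennreal ((q (v x))\<^sup>2) \<partial>hyperplane_borel a c)"
    unfolding hyperplane_measure_eq nn_integral_completion
    using na(2) edge_subset_closure[OF K s] by (intro nn_integral_mono) (auto simp: indicator_def)
  also have "\<dots> \<le> ennreal (2 ^ DIM('a) / \<bar>a \<bullet> ?x - c\<bar>) *
      (ennreal (2 * \<epsilon> * (diameter K)\<^sup>2) * (\<integral>\<^sup>+x. indicator K x * ennreal (grad_sq v x) \<partial>lborel)
       + ennreal (2 / \<epsilon>) * (\<integral>\<^sup>+x. indicator K x * ennreal ((q (v x))\<^sup>2) \<partial>lborel))"
  proof (rule trace_inequality[OF v cellD(2,3)[OF K] center_in[OF K] _ na(1) _ q \<epsilon>])
    show "a \<bullet> ?x \<noteq> c" using h r by auto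
    fix x assume x: "x \<in> closure K"
    have "bounded (closure K)" using cellD(5)[OF K] by (rule bounded_closure)
    then have "dist x ?x \<le> diameter (closure K)"
      using x cellD(7)[OF K] by (rule diameter_bounded_bound)
    then show "dist x ?x \<le> diameter K" by (simp add: diameter_closure cellD(5)[OF K])
  qed
  also have "\<dots> \<le> ennreal (2 ^ DIM('a) / (\<xi> * diameter K)) *
      (ennreal (2 * \<epsilon> * (diameter K)\<^sup>2) * grad_energy v K
       + ennreal (2 / \<epsilon>) * (\<integral>\<^sup>+x. indicator K x * ennreal ((q (v x))\<^sup>2) \<partial>lborel))"
    unfolding grad_energy_def using h r by (intro mult_right_mono ennreal_leI divide_left_mono) auto
  finally show ?thesis .
qed

lemma cell_measurable: "K \<in> \<T> \<Longrightarrow> K \<in> sets borel" "K \<in> \<T> \<Longrightarrow> K \<in> sets lebesgue"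
  "K \<in> \<T> \<Longrightarrow> emeasure lebesgue K < \<infinity>" "K \<in> \<T> \<Longrightarrow> emeasure lborel K = ennreal (measure lebesgue K)"
proof -
  assume K: "K \<in> \<T>"
  show b: "K \<in> sets borel" using cellD(2)[OF K] by (rule borel_open)
  show "K \<in> sets lebesgue" using b by simp
  have "K \<in> lmeasurable" using cellD(2,5)[OF K] by (intro lmeasurable_open)
  then show fin: "emeasure lebesgue K < \<infinity>" unfolding fmeasurable_def by blast
  have "emeasure lebesgue K \<noteq> top" using fin unfolding infinity_ennreal_def by (rule less_imp_neq)
  then have "emeasure lebesgue K = ennreal (measure lebesgue K)" by (rule emeasure_eq_ennreal_measure)
  moreover have "emeasure lebesgue K = emeasure lborel K" using b by (simp add: emeasure_completion)
  ultimately show "emeasure lborel K = ennreal (measure lebesgue K)" by simp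
qed

lemma cell_integrable:
  fixes f :: "'a \<Rightarrow> real"
  assumes "K \<in> \<T>" "continuous_on UNIV f"
  shows "set_integrable lebesgue K f"
  by (rule set_integrable_continuous[OF assms(2) cell_measurable(2,3)[OF assms(1)] cellD(5)[OF assms(1)]
        borel_measurable_hyperplane_measure(2)])

text \<open>Jensen's inequality with c = \<open>v x\<close> reduces the deviation from the mean to
  differences over pairs of points. The measure of the cell then cancels.\<close>

lemma cell_poincare:
  assumes K: "K \<in> \<T>" and v: "smooth_fun v"
  shows "(\<integral>\<^sup>+x. indicator K x * ennreal ((v x - cell_avg v K)\<^sup>2) \<partial>lborel)
    \<le> ennreal ((diameter K)\<^sup>2 * 2 ^ DIM('a)) * grad_energy v K"
proof -
  let ?\<mu> = "measure lebesgue K" and ?V = "cell_avg v K"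
  have \<mu>: "?\<mu> > 0" by (rule measure_pos[OF K])
  note [measurable] = cell_measurable(1)[OF K] smooth_fun_measurable(1)[OF v]
  have "ennreal ?\<mu> * (\<integral>\<^sup>+x. indicator K x * ennreal ((v x - ?V)\<^sup>2) \<partial>lborel)
     = (\<integral>\<^sup>+x. ennreal ?\<mu> * (indicator K x * ennreal ((v x - ?V)\<^sup>2)) \<partial>lborel)"
    by (rule nn_integral_cmult[symmetric]) measurable
  also have "\<dots> \<le> (\<integral>\<^sup>+x. (\<integral>\<^sup>+y. indicator K x * indicator K y * ennreal ((v y - v x)\<^sup>2) \<partial>lborel) \<partial>lborel)"
  proof (rule nn_integral_mono)
    fix x
    have "ennreal (?\<mu> * ((LINT y:K|lebesgue. v y) / ?\<mu> - v x)\<^sup>2)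
      \<le> (\<integral>\<^sup>+y. indicator K y * ennreal ((v y - v x)\<^sup>2) \<partial>lebesgue)"
      by (rule average_deviation[OF cell_integrable[OF K smooth_funD(2)[OF v]] cell_measurable(2)[OF K] \<mu>])
    then have "ennreal (?\<mu> * (v x - ?V)\<^sup>2) \<le> (\<integral>\<^sup>+y. indicator K y * ennreal ((v y - v x)\<^sup>2) \<partial>lborel)"
      by (simp add: nn_integral_completion cell_avg_def power2_commute)
    then show "ennreal ?\<mu> * (indicator K x * ennreal ((v x - ?V)\<^sup>2))
      \<le> (\<integral>\<^sup>+y. indicator K x * indicator K y * ennreal ((v y - v x)\<^sup>2) \<partial>lborel)"
      by (cases "x \<in> K") (simp_all add: ennreal_mult')
  qed
  also have "\<dots> \<le> ennreal ((diameter K)\<^sup>2 * 2 ^ DIM('a)) * emeasure lborel K * grad_energy v K"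
    unfolding grad_energy_def
    by (rule poincare_convex[OF v cellD(2,3)[OF K]]) (rule diameter_bounded_bound[OF cellD(5)[OF K]])
  also have "\<dots> = ennreal ?\<mu> * (ennreal ((diameter K)\<^sup>2 * 2 ^ DIM('a)) * grad_energy v K)"
    unfolding cell_measurable(4)[OF K] by (simp only: mult_ac)
  finally show ?thesis
    using \<mu> by (subst (asm) ennreal_mult_le_mult_iff) auto
qed

text \<open>With \<epsilon> = 1/2 the trace inequality has weight 1 on the gradient and 4 on the
  square of the deviation, which Poincare bounds in turn; 2^d (1 + 4 2^d) \<le> 5 4^d explains the
  constant. The squared diameter divided by the height of the cone leaves one diameter, to be
  cancelled by the distance in the transmissibility.\<close>

lemma cell_edge_estimate:
  assumes K: "K \<in> \<T>" and s: "\<sigma> \<in> edges_of \<M> K"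
    and a: "in_hyperplane a c \<sigma>" "measure (hyperplane_measure a c) \<sigma> > 0"
    and v: "smooth_fun v"
  shows "(\<integral>\<^sup>+x. indicator \<sigma> x * ennreal ((v x - cell_avg v K)\<^sup>2) \<partial>hyperplane_measure a c)
    \<le> ennreal (5 * 4 ^ DIM('a) / \<xi> * diameter K) * grad_energy v K"
proof -
  let ?V = "cell_avg v K" and ?R = "diameter K" and ?I = "grad_energy v K" and ?d = "(2::real) ^ DIM('a)"
  have R: "?R > 0" by (rule diameter_pos[OF K])
  have "(\<integral>\<^sup>+x. indicator \<sigma> x * ennreal ((v x - ?V)\<^sup>2) \<partial>hyperplane_measure a c)
    \<le> ennreal (?d / (\<xi> * ?R)) * (ennreal (2 * (1/2) * ?R\<^sup>2) * ?I
       + ennreal (2 / (1/2)) * (\<integral>\<^sup>+x. indicator K x * ennreal ((v x - ?V)\<^sup>2) \<partial>lborel))"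
    by (rule edge_trace_inequality[OF K s a v, of "\<lambda>s. s - ?V"]) auto
  also have "\<dots> \<le> ennreal (?d / (\<xi> * ?R)) * (ennreal (2 * (1/2) * ?R\<^sup>2) * ?I
       + ennreal (2 / (1/2)) * (ennreal (?R\<^sup>2 * ?d) * ?I))"
    by (intro mult_left_mono add_left_mono cell_poincare[OF K v]) auto
  also have "\<dots> = ennreal (?d / (\<xi> * ?R) * (2 * (1/2) * ?R\<^sup>2 + 2 / (1/2) * (?R\<^sup>2 * ?d))) * ?I"
    using \<xi>_pos R by (subst ennreal_mult_mult, simp, simp, subst ennreal_mult_add, simp, simp, subst ennreal_mult_mult) auto
  also have "\<dots> \<le> ennreal (5 * 4 ^ DIM('a) / \<xi> * ?R) * ?I"
  proof (intro mult_right_mono ennreal_leI)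
    have d: "4 ^ DIM('a) = ?d * ?d" by (simp flip: power_mult_distrib)
    have "1 \<le> ?d" by simp
    then have "?d * (1 + 4 * ?d) \<le> 5 * (?d * ?d)" by (simp add: distrib_left)
    then have "?d * (1 + 4 * ?d) * (?R / \<xi>) \<le> 5 * (?d * ?d) * (?R / \<xi>)"
      using R \<xi>_pos by (intro mult_right_mono) auto
    then show "?d / (\<xi> * ?R) * (2 * (1/2) * ?R\<^sup>2 + 2 / (1/2) * (?R\<^sup>2 * ?d)) \<le> 5 * 4 ^ DIM('a) / \<xi> * ?R"
      unfolding d using R \<xi>_pos by (simp add: field_simps power2_eq_square)
  qed simp
  finally show ?thesis .
qed

lemma d_edge_pos: "\<sigma> \<in> \<E> \<Longrightarrow> d_edge \<M> \<sigma> > 0"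
  using d_edge_ge[of "cell \<sigma>" \<sigma>] cell_of_works[of \<sigma>] \<xi>_pos diameter_pos[of "cell \<sigma>"]
  by (smt (verit) mult_pos_pos)

lemma edge_integrable:
  fixes f :: "'a \<Rightarrow> real"
  assumes "\<sigma> \<in> \<E>" "measure (hyperplane_measure a c) \<sigma> > 0" "continuous_on UNIV f"
  shows "set_integrable (hyperplane_measure a c) \<sigma> f"
proof (rule set_integrable_continuous[OF assms(3)])
  \<comment> \<open>\<open>measure\<close> is zero by default on sets outside the sigma-algebra and
    on sets of infinite measure, so positive area yields both measurability and finiteness.\<close>
  show "\<sigma> \<in> sets (hyperplane_measure a c)" using assms(2) measure_notin_sets by force
  show "emeasure (hyperplane_measure a c) \<sigma> < \<infinity>"
    using assms(2) by (simp add: measure_def enn2real_positive_iff)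
  show "bounded \<sigma>" using edge_facts(4)[OF assms(1)] bounded_closure[OF bounded_\<Omega>] by (rule bounded_subset[rotated])
qed (rule borel_measurable_hyperplane_measure)

text \<open>The two values whose jump is taken are compared through \<open>v\<close> on the edge
  itself: two cell means for an interior edge, a cell mean and the edge average for a Dirichlet
  edge. Splitting the square doubles 5 to 10, and the second factor 1/\<xi> comes from
  \<open>d_edge_ge\<close>.\<close>

lemma edge_difference_estimate:
  assumes s: "\<sigma> \<in> \<E>" and v: "smooth_fun v"
  shows "ennreal (\<tau> \<sigma> * (Dabs \<M> \<Gamma>D (with_bd v (cell_avg v)) \<sigma>)\<^sup>2)
    \<le> ennreal (10 * 4 ^ DIM('a) / \<xi>\<^sup>2) * (\<Sum>K | K \<in> \<T> \<and> \<sigma> \<in> edges_of \<M> K. grad_energy v K)"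
proof -
  let ?u = "with_bd v (cell_avg v)" and ?C = "cell \<sigma>" and ?A = "face_area \<sigma>" and ?d = "d_edge \<M> \<sigma>"
  let ?c = "5 * 4 ^ DIM('a) / \<xi>"
  obtain a c where a: "in_hyperplane a c \<sigma>" "surface_measure \<sigma> = hyperplane_measure a c"
    "measure (hyperplane_measure a c) \<sigma> > 0"
    using face_area_pos_cases[OF edge_facts(1,2)[OF s]] .
  let ?\<mu> = "hyperplane_measure a c"
  have A: "?A = measure ?\<mu> \<sigma>" by (simp add: face_area_def a(2))
  have sm: "\<sigma> \<in> sets ?\<mu>" using a(3) measure_notin_sets by force
  have "emeasure ?\<mu> \<sigma> \<noteq> top" using a(3) by (auto simp: measure_def)
  then have em: "emeasure ?\<mu> \<sigma> = ennreal (measure ?\<mu> \<sigma>)" by (rule emeasure_eq_ennreal_measure)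
  have d: "?d > 0" by (rule d_edge_pos[OF s])
  have CK: "?C \<in> \<T>" "\<sigma> \<in> edges_of \<M> ?C" using cell_of_works[OF s] by auto
  define J where "J K = (\<integral>\<^sup>+x. indicator \<sigma> x * ennreal ((v x - cell_avg v K)\<^sup>2) \<partial>?\<mu>)" for K
  have J: "ennreal (1 / ?d) * (2 * J K) \<le> ennreal (10 * 4 ^ DIM('a) / \<xi>\<^sup>2) * grad_energy v K"
    if K: "K \<in> \<T>" "\<sigma> \<in> edges_of \<M> K" for K
  proof -
    have dK: "\<xi> * diameter K \<le> ?d" by (rule d_edge_ge[OF K])
    have "ennreal (1 / ?d) * (2 * J K) \<le> ennreal (1 / ?d) * (2 * (ennreal (?c * diameter K) * grad_energy v K))"
      unfolding J_def by (intro mult_left_mono cell_edge_estimate[OF K a(1,3) v]) auto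
    also have "\<dots> = ennreal (1 / ?d * (2 * (?c * diameter K))) * grad_energy v K"
    proof -
      have B: "0 \<le> ?c * diameter K" using \<xi>_pos diameter_pos[OF K(1)] by simp
      have "2 * (ennreal (?c * diameter K) * grad_energy v K) = ennreal (2 * (?c * diameter K)) * grad_energy v K"
        using ennreal_mult_mult[OF _ B, of 2] by simp
      then show ?thesis using d B ennreal_mult_mult[of "1 / ?d" "2 * (?c * diameter K)"] by simp
    qed
    also have "\<dots> \<le> ennreal (10 * 4 ^ DIM('a) / \<xi>\<^sup>2) * grad_energy v K"
    proof (intro mult_right_mono ennreal_leI)
      have "2 * ?c * (\<xi> * diameter K / (\<xi> * ?d)) \<le> 2 * ?c * (1 / \<xi>)"
        using dK d \<xi>_pos by (intro mult_left_mono) (auto simp: field_simps)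
      then show "1 / ?d * (2 * (?c * diameter K)) \<le> 10 * 4 ^ DIM('a) / \<xi>\<^sup>2"
        using d \<xi>_pos by (simp add: power2_eq_square mult_ac)
    qed simp
    finally show ?thesis .
  qed
  have tr: "ennreal (\<tau> \<sigma> * r) = ennreal (1 / ?d) * ennreal (?A * r)" if "r \<ge> 0" for r
    using d that unfolding transm_def
    by (subst ennreal_mult'[symmetric]) (auto simp: field_simps)
  show ?thesis
  proof (cases "interior_edge \<M> \<sigma>")
    case True
    let ?L = "neighbour \<M> ?C \<sigma>"
    have L: "?L \<in> \<T>" "\<sigma> \<in> edges_of \<M> ?L" "?L \<noteq> ?C"
      using cells_of_interior[OF s True] neighbour_neq[OF s True] by auto
    let ?VC = "cell_avg v ?C" and ?VL = "cell_avg v ?L"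
    have D: "(Dabs \<M> \<Gamma>D ?u \<sigma>)\<^sup>2 = (?VL - ?VC)\<^sup>2"
      using True by (simp add: Dabs_def Dd_def opp_def)
    have vm[measurable]: "v \<in> borel_measurable ?\<mu>"
      using borel_measurable_hyperplane_measure(1) smooth_fun_measurable(1)[OF v] by blast
    note [measurable] = sm
    have "ennreal (?A * (?VL - ?VC)\<^sup>2) = ennreal ((?VL - ?VC)\<^sup>2) * emeasure ?\<mu> \<sigma>"
      unfolding em A by (simp add: ennreal_mult' mult.commute)
    also have "\<dots> = (\<integral>\<^sup>+x. ennreal ((?VL - ?VC)\<^sup>2) * indicator \<sigma> x \<partial>?\<mu>)"
      using sm by (rule nn_integral_cmult_indicator[symmetric])
    also have "\<dots> \<le> (\<integral>\<^sup>+x. 2 * (indicator \<sigma> x * ennreal ((v x - ?VC)\<^sup>2)) + 2 * (indicator \<sigma> x * ennreal ((v x - ?VL)\<^sup>2)) \<partial>?\<mu>)"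
    proof (rule nn_integral_mono)
      fix x
      have "0 \<le> ((v x - ?VC) + (v x - ?VL))\<^sup>2" by simp
      then have "(?VL - ?VC)\<^sup>2 \<le> 2 * (v x - ?VC)\<^sup>2 + 2 * (v x - ?VL)\<^sup>2"
        by (simp add: power2_eq_square algebra_simps)
      then have "ennreal ((?VL - ?VC)\<^sup>2) \<le> ennreal (2 * (v x - ?VC)\<^sup>2 + 2 * (v x - ?VL)\<^sup>2)"
        by (rule ennreal_leI)
      then show "ennreal ((?VL - ?VC)\<^sup>2) * indicator \<sigma> x
        \<le> 2 * (indicator \<sigma> x * ennreal ((v x - ?VC)\<^sup>2)) + 2 * (indicator \<sigma> x * ennreal ((v x - ?VL)\<^sup>2))"
        by (cases "x \<in> \<sigma>") (simp_all add: ennreal_mult')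
    qed
    also have "\<dots> = 2 * J ?C + 2 * J ?L"
    proof -
      have "(\<integral>\<^sup>+x. 2 * (indicator \<sigma> x * ennreal ((v x - V)\<^sup>2)) \<partial>?\<mu>)
          = 2 * (\<integral>\<^sup>+x. indicator \<sigma> x * ennreal ((v x - V)\<^sup>2) \<partial>?\<mu>)" for V
        by (rule nn_integral_cmult) measurable
      then show ?thesis unfolding J_def by (subst nn_integral_add) simp_all
    qed
    finally have "ennreal (\<tau> \<sigma> * (?VL - ?VC)\<^sup>2) \<le> ennreal (1 / ?d) * (2 * J ?C + 2 * J ?L)"
      by (simp add: tr mult_left_mono)
    also have "\<dots> \<le> ennreal (10 * 4 ^ DIM('a) / \<xi>\<^sup>2) * grad_energy v ?C
        + ennreal (10 * 4 ^ DIM('a) / \<xi>\<^sup>2) * grad_energy v ?L"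
      unfolding distrib_left by (intro add_mono J CK L)
    also have "\<dots> = ennreal (10 * 4 ^ DIM('a) / \<xi>\<^sup>2) * (\<Sum>K | K \<in> \<T> \<and> \<sigma> \<in> edges_of \<M> K. grad_energy v K)"
      unfolding cells_of_interior[OF s True] using L(3) by (simp add: distrib_left)
    finally show ?thesis unfolding D .
  next
    case False
    show ?thesis
    proof (cases "\<sigma> \<subseteq> \<Gamma>D")
      case True
      have D: "(Dabs \<M> \<Gamma>D ?u \<sigma>)\<^sup>2 = ((LINT x:\<sigma>|?\<mu>. v x) / measure ?\<mu> \<sigma> - cell_avg v ?C)\<^sup>2"
        using True False by (simp add: Dabs_def Dd_def opp_def edge_avg_def a(2) A)
      have "ennreal (?A * (Dabs \<M> \<Gamma>D ?u \<sigma>)\<^sup>2) \<le> J ?C"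
        unfolding D A J_def
        by (rule average_deviation[OF edge_integrable[OF s a(3) smooth_funD(2)[OF v]] sm a(3)])
      also have "\<dots> \<le> 2 * J ?C" by (simp add: mult_2)
      finally have "ennreal (\<tau> \<sigma> * (Dabs \<M> \<Gamma>D ?u \<sigma>)\<^sup>2) \<le> ennreal (1 / ?d) * (2 * J ?C)"
        by (simp add: tr mult_left_mono)
      also have "\<dots> \<le> ennreal (10 * 4 ^ DIM('a) / \<xi>\<^sup>2) * grad_energy v ?C" by (rule J[OF CK])
      also have "grad_energy v ?C = (\<Sum>K | K \<in> \<T> \<and> \<sigma> \<in> edges_of \<M> K. grad_energy v K)"
        unfolding cells_of_boundary[OF s False] by simp
      finally show ?thesis .
    next
      case nD: False
      then have "Dabs \<M> \<Gamma>D ?u \<sigma> = 0" using False by (simp add: Dabs_def Dd_neumann)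
      then show ?thesis by simp
    qed
  qed
qed

lemma sum_grad_energy_le:
  assumes v: "smooth_fun v"
  shows "(\<Sum>K\<in>\<T>. grad_energy v K) \<le> grad_energy v \<Omega>"
proof -
  note [measurable] = smooth_fun_measurable(3)[OF v]
  have "(\<Sum>K\<in>\<T>. grad_energy v K)
      = (\<integral>\<^sup>+x. (\<Sum>K\<in>\<T>. indicator K x * ennreal (grad_sq v x)) \<partial>lborel)"
    unfolding grad_energy_def
  proof (rule nn_integral_sum[symmetric])
    fix K assume "K \<in> \<T>"
    note [measurable] = cell_measurable(1)[OF this]
    show "(\<lambda>x. indicator K x * ennreal (grad_sq v x)) \<in> borel_measurable lborel" by measurable
  qed
  also have "\<dots> \<le> grad_energy v \<Omega>"
    unfolding grad_energy_def
  proof (rule nn_integral_mono)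
    fix x
    have "disjoint_family_on (\<lambda>K. K) (\<T>)"
      using cells_disjoint unfolding disjoint_family_on_def by blast
    then have "(\<Sum>K\<in>\<T>. indicator K x * ennreal (grad_sq v x)) = indicator (\<Union>(\<T>)) x * ennreal (grad_sq v x)"
      using arg_cong[OF indicator_UN_disjoint[OF finite_cells, of "\<lambda>K. K" x], of "\<lambda>r. r * ennreal (grad_sq v x)"]
      by (simp add: sum_distrib_right)
    also have "\<dots> \<le> indicator \<Omega> x * ennreal (grad_sq v x)"
      using cellD(4) by (intro mult_right_mono) (auto simp: indicator_def)
    finally show "(\<Sum>K\<in>\<T>. indicator K x * ennreal (grad_sq v x)) \<le> indicator \<Omega> x * ennreal (grad_sq v x)" .
  qed
  finally show ?thesis .
qed

text \<open>The energy of a cell is charged once for each of its edges, hence at most \<beta> times,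
  and the cells are disjoint parts of \<Omega>.\<close>

lemma seminorm1_sq_smooth_le:
  assumes v: "smooth_fun v"
  shows "ennreal (snorm (with_bd v (cell_avg v)))
    \<le> ennreal (10 * 4 ^ DIM('a) / \<xi>\<^sup>2 * \<beta>) * grad_energy v \<Omega>"
proof (cases "\<T> = {}")
  case True
  then show ?thesis by (simp add: seminorm1_sq_def edges_eq)
next
  case False
  let ?c = "10 * 4 ^ DIM('a) / \<xi>\<^sup>2"
  have card: "real (card (edges_of \<M> K)) \<le> \<beta>" if "K \<in> \<T>" for K
    using regular that unfolding regular_mesh_def by blast
  then have \<beta>: "0 \<le> \<beta>" using False by (metis all_not_in_conv of_nat_0_le_iff order_trans)
  have "ennreal (snorm (with_bd v (cell_avg v)))
     = (\<Sum>\<sigma>\<in>\<E>. ennreal (\<tau> \<sigma> * (Dabs \<M> \<Gamma>D (with_bd v (cell_avg v)) \<sigma>)\<^sup>2))"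
    unfolding seminorm1_sq_def by (rule sum_ennreal[symmetric]) (simp add: transm_nonneg)
  also have "\<dots> \<le> (\<Sum>\<sigma>\<in>\<E>. ennreal ?c * (\<Sum>K | K \<in> \<T> \<and> \<sigma> \<in> edges_of \<M> K. grad_energy v K))"
    by (intro sum_mono edge_difference_estimate v)
  also have "\<dots> = ennreal ?c * (\<Sum>K\<in>\<T>. \<Sum>\<sigma>\<in>edges_of \<M> K. grad_energy v K)"
    unfolding sum_cells_edges by (simp add: sum_distrib_left)
  also have "\<dots> \<le> ennreal ?c * (\<Sum>K\<in>\<T>. ennreal \<beta> * grad_energy v K)"
  proof (intro mult_left_mono sum_mono)
    fix K assume K: "K \<in> \<T>"
    have "(\<Sum>\<sigma>\<in>edges_of \<M> K. grad_energy v K) = ennreal (real (card (edges_of \<M> K))) * grad_energy v K"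
      by (simp add: ennreal_of_nat_eq_real_of_nat)
    also have "\<dots> \<le> ennreal \<beta> * grad_energy v K" using card[OF K] by (intro mult_right_mono ennreal_leI) auto
    finally show "(\<Sum>\<sigma>\<in>edges_of \<M> K. grad_energy v K) \<le> ennreal \<beta> * grad_energy v K" .
  qed simp
  also have "\<dots> = ennreal (?c * \<beta>) * (\<Sum>K\<in>\<T>. grad_energy v K)"
    using \<beta> unfolding sum_distrib_left[symmetric] by (subst ennreal_mult_mult) auto
  also have "\<dots> \<le> ennreal (?c * \<beta>) * grad_energy v \<Omega>"
    by (intro mult_left_mono sum_grad_energy_le v) simp
  finally show ?thesis .
qed

section \<open>Limits and bounds for the averages of the data\<close>

lemma cell_avg_bounds:
  assumes K: "K \<in> \<T>" and f: "set_borel_measurable lebesgue \<Omega> f"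
    and mM: "AE x in lebesgue. x \<in> \<Omega> \<longrightarrow> m \<le> f x \<and> f x \<le> M"
  shows "m \<le> cell_avg f K \<and> cell_avg f K \<le> M"
proof -
  let ?\<mu> = "measure lebesgue K"
  have \<mu>: "?\<mu> > 0" by (rule measure_pos[OF K])
  have KS: "K \<subseteq> \<Omega>" by (rule cellD(4)[OF K])
  note Km = cell_measurable(2,3)[OF K]
  have int: "set_integrable lebesgue K f"
  proof -
    have "integrable lebesgue (\<lambda>x. indicator K x *\<^sub>R (indicator \<Omega> x *\<^sub>R f x))"
    proof (rule integrableI_bounded_set_indicator[where B = "max \<bar>m\<bar> \<bar>M\<bar>"])
      show "(\<lambda>x. indicator \<Omega> x *\<^sub>R f x) \<in> borel_measurable lebesgue"
        using f unfolding set_borel_measurable_def .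
      show "AE x in lebesgue. x \<in> K \<longrightarrow> norm (indicator \<Omega> x *\<^sub>R f x) \<le> max \<bar>m\<bar> \<bar>M\<bar>"
        using mM by eventually_elim (use KS in \<open>auto simp: indicator_def\<close>)
    qed (use Km in auto)
    moreover have "(\<lambda>x. indicator K x *\<^sub>R (indicator \<Omega> x *\<^sub>R f x)) = (\<lambda>x. indicator K x *\<^sub>R f x)"
      using KS by (intro ext) (auto simp: indicator_def)
    ultimately show ?thesis by (simp only: set_integrable_def)
  qed
  have const: "set_integrable lebesgue K (\<lambda>_. r)" for r :: real
    using Km by (rule set_integrable_constant)
  have cint: "(LINT x:K|lebesgue. r) = ?\<mu> * r" for r
    using Km by (simp add: set_lebesgue_integral_def mult.commute)
  have "(LINT x:K|lebesgue. m) \<le> (LINT x:K|lebesgue. f x)"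
    unfolding set_lebesgue_integral_def
    by (rule integral_mono_AE[OF const[unfolded set_integrable_def] int[unfolded set_integrable_def]],
        use mM in eventually_elim) (use KS in \<open>auto simp: indicator_def\<close>)
  moreover have "(LINT x:K|lebesgue. f x) \<le> (LINT x:K|lebesgue. M)"
    unfolding set_lebesgue_integral_def
    by (rule integral_mono_AE[OF int[unfolded set_integrable_def] const[unfolded set_integrable_def]],
        use mM in eventually_elim) (use KS in \<open>auto simp: indicator_def\<close>)
  ultimately show ?thesis
    using \<mu> unfolding cint cell_avg_def by (simp add: field_simps)
qed

lemma cell_avg_cong:
  assumes K: "K \<in> \<T>" and f: "set_borel_measurable lebesgue \<Omega> f" "set_borel_measurable lebesgue \<Omega> g"
    and eq: "AE x in lebesgue. x \<in> \<Omega> \<longrightarrow> g x - f x = 0"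
  shows "cell_avg f K = cell_avg g K"
proof -
  have m: "set_borel_measurable lebesgue K h" if "set_borel_measurable lebesgue \<Omega> h" for h :: "'a \<Rightarrow> real"
    using that cell_measurable(2)[OF K] cellD(4)[OF K] by (rule set_borel_measurable_subset)
  have "(LINT x:K|lebesgue. f x) = (LINT x:K|lebesgue. g x)"
    unfolding set_lebesgue_integral_def
  proof (rule integral_cong_AE)
    show "AE x in lebesgue. indicator K x *\<^sub>R f x = indicator K x *\<^sub>R g x"
      using eq by eventually_elim (use cellD(4)[OF K] in \<open>auto simp: indicator_def\<close>)
  qed (use m[OF f(1)] m[OF f(2)] in \<open>simp_all add: set_borel_measurable_def\<close>)
  then show ?thesis by (simp add: cell_avg_def)
qed

lemma cell_avg_tendsto:
  assumes K: "K \<in> \<T>" and v: "\<And>k. smooth_fun (v k)" "L2_tendsto lebesgue \<Omega> v f"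
  shows "(\<lambda>k. cell_avg (v k) K) \<longlonglongrightarrow> cell_avg f K"
  unfolding cell_avg_def
  using measure_pos[OF K]
  by (intro tendsto_divide tendsto_const
      L2_tendsto_average[OF v(2) cell_measurable(2)[OF K] cellD(4)[OF K] measure_pos[OF K] cell_integrable[OF K smooth_funD(2)[OF v(1)]]])
    simp

lemma edge_avg_tendsto:
  assumes s: "\<sigma> \<in> \<E>" "\<not> interior_edge \<M> \<sigma>" and v: "\<And>k. smooth_fun (v k)"
    and tr: "\<And>a c. norm a = 1 \<Longrightarrow> L2_tendsto (hyperplane_measure a c) (frontier \<Omega> \<inter> {x. a \<bullet> x = c}) v f"
  shows "(\<lambda>k. edge_avg (v k) \<sigma>) \<longlonglongrightarrow> edge_avg f \<sigma>"
proof -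
  obtain a c where a: "in_hyperplane a c \<sigma>" "surface_measure \<sigma> = hyperplane_measure a c"
    "measure (hyperplane_measure a c) \<sigma> > 0"
    using face_area_pos_cases[OF edge_facts(1,2)[OF s(1)]] .
  have sm: "\<sigma> \<in> sets (hyperplane_measure a c)" using a(3) measure_notin_sets by force
  have "norm a = 1" using a(1) by (simp add: in_hyperplane_def)
  moreover have "\<sigma> \<subseteq> frontier \<Omega> \<inter> {x. a \<bullet> x = c}"
    using s edge_facts(3)[OF s(1)] a(1) by (simp add: in_hyperplane_def)
  ultimately have "(\<lambda>k. LINT x:\<sigma>|hyperplane_measure a c. v k x) \<longlonglongrightarrow> (LINT x:\<sigma>|hyperplane_measure a c. f x)"
    using edge_integrable[OF s(1) a(3) smooth_funD(2)[OF v]]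
    by (intro L2_tendsto_average[OF tr sm _ a(3)])
  then show ?thesis
    unfolding edge_avg_def a(2) using edge_facts(2)[OF s(1)] by (intro tendsto_divide tendsto_const) auto
qed

text \<open>On a fixed mesh the seminorm is a finite polynomial expression in cell and edge
  averages, each of which converges, while the bound for the smooth functions does not depend on
  k.\<close>

lemma seminorm1_sq_trace_le:
  assumes approx: "smooth_approximation \<Omega> f v G" and \<beta>: "0 \<le> \<beta>"
  shows "snorm (with_bd f (cell_avg f)) \<le> 10 * 4 ^ DIM('a) / \<xi>\<^sup>2 * \<beta> * G"
proof (rule tendsto_upperbound)
  note v = smooth_approximationD(1,2)[OF approx] and tr = smooth_approximationD(3)[OF approx]
    and G = smooth_approximationD(4,5)[OF approx]
  let ?C = "10 * 4 ^ DIM('a) / \<xi>\<^sup>2 * \<beta>"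
  show "(\<lambda>k. snorm (with_bd (v k) (cell_avg (v k))))
      \<longlonglongrightarrow> snorm (with_bd f (cell_avg f))"
    unfolding seminorm1_sq_def
  proof (rule tendsto_sum)
    fix \<sigma> assume s: "\<sigma> \<in> \<E>"
    have cell: "(\<lambda>k. cell_avg (v k) K) \<longlonglongrightarrow> cell_avg f K" if "K \<in> \<T>" for K
      using cell_avg_tendsto[OF that v] .
    have "(\<lambda>k. val (with_bd (v k) (cell_avg (v k))) (cell \<sigma>) \<sigma>)
       \<longlonglongrightarrow> val (with_bd f (cell_avg f)) (cell \<sigma>) \<sigma>"
    proof (cases "interior_edge \<M> \<sigma>")
      case True
      then show ?thesis using cell[OF nbr_in[OF s]] by (simp add: opp_def)
    next
      case False
      then show ?thesis using cell[OF cell_of_in[OF s]] edge_avg_tendsto[OF s False v(1) tr] by (simp add: opp_def)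
    qed
    then have "(\<lambda>k. D (with_bd (v k) (cell_avg (v k))) (cell \<sigma>) \<sigma>)
       \<longlonglongrightarrow> D (with_bd f (cell_avg f)) (cell \<sigma>) \<sigma>"
      unfolding Dd_def with_bd_simps by (intro tendsto_diff cell cell_of_in s)
    then show "(\<lambda>k. \<tau> \<sigma> * (Dabs \<M> \<Gamma>D (with_bd (v k) (cell_avg (v k))) \<sigma>)\<^sup>2)
       \<longlonglongrightarrow> \<tau> \<sigma> * (Dabs \<M> \<Gamma>D (with_bd f (cell_avg f)) \<sigma>)\<^sup>2"
      unfolding Dabs_def by (intro tendsto_intros)
  qed
  show "\<forall>\<^sub>F k in sequentially. snorm (with_bd (v k) (cell_avg (v k))) \<le> ?C * G"
    using G(2)
  proof eventually_elim
    fix k assume k: "grad_energy (v k) \<Omega> \<le> ennreal G"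
    have "ennreal (snorm (with_bd (v k) (cell_avg (v k)))) \<le> ennreal ?C * grad_energy (v k) \<Omega>"
      by (rule seminorm1_sq_smooth_le[OF v(1)])
    also have "\<dots> \<le> ennreal ?C * ennreal G" using k by (intro mult_left_mono) auto
    also have "\<dots> = ennreal (?C * G)" using \<beta> G(1) by (intro ennreal_mult[symmetric]) auto
    finally show "snorm (with_bd (v k) (cell_avg (v k))) \<le> ?C * G"
      using \<beta> G(1) by (subst (asm) ennreal_le_iff) auto
  qed
qed simp

text \<open>On the boundary, \<open>q \<circ> v k\<close> is controlled by a thin layer of width \<open>\<epsilon>\<close> inside the cell, where it
  converges to \<open>q \<circ> f = 0\<close>; the gradient contributes only a term of order \<open>\<epsilon>\<close>.\<close>

lemma edge_avg_tendsto_zero: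
  assumes s: "\<sigma> \<in> \<E>" and approx: "smooth_approximation \<Omega> f v G"
    and q: "\<And>s s'. \<bar>q s - q s'\<bar> \<le> \<bar>s - s'\<bar>" and qf: "AE x in lebesgue. x \<in> \<Omega> \<longrightarrow> q (f x) = 0"
  shows "(\<lambda>k. edge_avg (\<lambda>x. q (v k x)) \<sigma>) \<longlonglongrightarrow> 0"
proof -
  note v = smooth_approximationD(1,2)[OF approx] and G = smooth_approximationD(4,5)[OF approx]
  obtain a c where a: "in_hyperplane a c \<sigma>" "surface_measure \<sigma> = hyperplane_measure a c"
    "measure (hyperplane_measure a c) \<sigma> > 0"
    using face_area_pos_cases[OF edge_facts(1,2)[OF s]] .
  have sm: "\<sigma> \<in> sets (hyperplane_measure a c)" using a(3) measure_notin_sets by force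
  define \<mu> where "\<mu> = measure (hyperplane_measure a c) \<sigma>"
  have \<mu>: "\<mu> > 0" using a(3) by (simp add: \<mu>_def)
  have K: "cell \<sigma> \<in> \<T>" "\<sigma> \<in> edges_of \<M> (cell \<sigma>)" using cell_of_works[OF s] by auto
  define R where "R = diameter (cell \<sigma>)"
  have R: "R > 0" unfolding R_def by (rule diameter_pos[OF K(1)])
  define C where "C = 2 ^ DIM('a) / (\<xi> * R)"
  have C: "C > 0" using R \<xi>_pos by (simp add: C_def)
  define A where "A k = \<mu> * (edge_avg (\<lambda>x. q (v k x)) \<sigma>)\<^sup>2" for k
  define e where "e k = (LINT x:\<Omega>|lebesgue. (v k x - f x)\<^sup>2)" for k
  have e: "e \<longlonglongrightarrow> 0" using v(2) unfolding L2_tendsto_def e_def by blast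
  have e0: "0 \<le> e k" for k unfolding e_def set_lebesgue_integral_def by (intro integral_nonneg_AE) auto
  have "continuous_on UNIV q"
    unfolding continuous_on_iff dist_real_def using q by (metis le_less_trans)
  then have cq: "continuous_on UNIV (\<lambda>x. q (v k x))" for k
    by (rule continuous_on_compose2[OF _ smooth_funD(2)[OF v(1)]]) simp
  have bound: "\<forall>\<^sub>F k in sequentially. A k \<le> C * (2 * \<epsilon> * R\<^sup>2 * G + 2 / \<epsilon> * e k)"
    if \<epsilon>: "0 < \<epsilon>" "\<epsilon> \<le> 1/2" for \<epsilon>
    using G(2)
  proof eventually_elim
    fix k assume k: "grad_energy (v k) \<Omega> \<le> ennreal G"
    let ?K = "cell \<sigma>"
    have "ennreal (A k) = ennreal (\<mu> * ((LINT x:\<sigma>|hyperplane_measure a c. q (v k x)) / \<mu> - 0)\<^sup>2)"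
      by (simp add: A_def edge_avg_def face_area_def a(2) \<mu>_def)
    also have "\<dots> \<le> (\<integral>\<^sup>+x. indicator \<sigma> x * ennreal ((q (v k x) - 0)\<^sup>2) \<partial>hyperplane_measure a c)"
      unfolding \<mu>_def by (rule average_deviation[OF edge_integrable[OF s a(3) cq] sm a(3)])
    also have "\<dots> \<le> ennreal C * (ennreal (2 * \<epsilon> * R\<^sup>2) * grad_energy (v k) ?K
       + ennreal (2 / \<epsilon>) * (\<integral>\<^sup>+x. indicator ?K x * ennreal ((q (v k x))\<^sup>2) \<partial>lborel))"
      using edge_trace_inequality[OF K a(1,3) v(1) q \<epsilon>] unfolding C_def R_def by simp
    also have "\<dots> \<le> ennreal C * (ennreal (2 * \<epsilon> * R\<^sup>2) * ennreal G + ennreal (2 / \<epsilon>) * ennreal (e k))"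
    proof (intro mult_left_mono add_mono)
      show "grad_energy (v k) ?K \<le> ennreal G"
        using grad_energy_mono[OF cellD(4)[OF K(1)]] k by (rule order_trans)
      have "(\<integral>\<^sup>+x. indicator ?K x * ennreal ((q (v k x))\<^sup>2) \<partial>lborel)
         = (\<integral>\<^sup>+x. indicator ?K x * ennreal ((q (v k x))\<^sup>2) \<partial>lebesgue)"
        by (simp add: nn_integral_completion)
      also have "\<dots> \<le> (\<integral>\<^sup>+x. indicator \<Omega> x * ennreal ((v k x - f x)\<^sup>2) \<partial>lebesgue)"
      proof (rule nn_integral_mono_AE)
        show "AE x in lebesgue. indicator ?K x * ennreal ((q (v k x))\<^sup>2) \<le> indicator \<Omega> x * ennreal ((v k x - f x)\<^sup>2)"
          using qf
        proof eventually_elim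
          fix x assume x: "x \<in> \<Omega> \<longrightarrow> q (f x) = 0"
          show "indicator ?K x * ennreal ((q (v k x))\<^sup>2) \<le> indicator \<Omega> x * ennreal ((v k x - f x)\<^sup>2)"
          proof (cases "x \<in> ?K")
            case True
            then have "x \<in> \<Omega>" using cellD(4)[OF K(1)] by auto
            then have "\<bar>q (v k x)\<bar>\<^sup>2 \<le> \<bar>v k x - f x\<bar>\<^sup>2"
              using x q[of "v k x" "f x"] by (intro power_mono) auto
            then show ?thesis using \<open>x \<in> \<Omega>\<close> True by (simp add: ennreal_leI)
          qed simp
        qed
      qed
      also have "\<dots> = ennreal (e k)"
        unfolding e_def using v(2) by (intro nn_integral_set_eq) (auto simp: L2_tendsto_def L2_on_def)
      finally show "(\<integral>\<^sup>+x. indicator ?K x * ennreal ((q (v k x))\<^sup>2) \<partial>lborel) \<le> ennreal (e k)" .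
    qed auto
    also have "\<dots> = ennreal (C * (2 * \<epsilon> * R\<^sup>2 * G + 2 / \<epsilon> * e k))"
      using C \<epsilon> G(1) e0[of k] by (simp add: ennreal_mult'[symmetric] ennreal_plus[symmetric] del: ennreal_plus)
    finally show "A k \<le> C * (2 * \<epsilon> * R\<^sup>2 * G + 2 / \<epsilon> * e k)"
      using C \<epsilon> G(1) e0[of k] by (subst (asm) ennreal_le_iff) auto
  qed
  have "A \<longlonglongrightarrow> 0"
  proof (rule order_tendstoI)
    fix y :: real assume "y < 0"
    moreover have "0 \<le> A k" for k using \<mu> by (simp add: A_def)
    ultimately show "\<forall>\<^sub>F k in sequentially. y < A k" by (intro always_eventually allI) (rule less_le_trans)
  next
    fix y :: real assume y: "0 < y"
    define B where "B = C * (2 * R\<^sup>2 * G)"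
    have B: "0 \<le> B" using C G(1) by (simp add: B_def)
    \<comment> \<open>The width is chosen so that the gradient contribution
      \<open>\<epsilon> * B\<close> stays below y/2. Dividing by \<open>B + 1\<close> also admits
      \<open>B = 0\<close>.\<close>
    define \<epsilon> where "\<epsilon> = min (1/2) (y / (2 * (B + 1)))"
    have "0 < \<epsilon>" using y B by (simp add: \<epsilon>_def)
    moreover have "\<epsilon> \<le> 1/2" unfolding \<epsilon>_def by (rule min.cobounded1)
    ultimately have \<epsilon>: "0 < \<epsilon>" "\<epsilon> \<le> 1/2" by auto
    have \<epsilon>y: "\<epsilon> \<le> y / (2 * (B + 1))" unfolding \<epsilon>_def by (rule min.cobounded2)
    have small: "\<epsilon> * B < y / 2"
    proof -
      have "\<epsilon> * B \<le> y / (2 * (B + 1)) * B" using \<epsilon>y B by (rule mult_right_mono)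
      also have "\<dots> < y / 2" using B y by (simp add: field_simps)
      finally show ?thesis .
    qed
    have "(\<lambda>k. C * (2 / \<epsilon>) * e k) \<longlonglongrightarrow> C * (2 / \<epsilon>) * 0"
      by (intro tendsto_mult_left e)
    then have "\<forall>\<^sub>F k in sequentially. C * (2 / \<epsilon>) * e k < y / 2"
      using y by (intro order_tendstoD) auto
    then show "\<forall>\<^sub>F k in sequentially. A k < y"
      using bound[OF \<epsilon>]
    proof eventually_elim
      case (elim k)
      have "C * (2 * \<epsilon> * R\<^sup>2 * G + 2 / \<epsilon> * e k) = \<epsilon> * B + C * (2 / \<epsilon>) * e k"
        unfolding B_def by (simp add: algebra_simps)
      then show ?case using elim small by linarith
    qed
  qed
  then have "(\<lambda>k. (1 / \<mu>) * A k) \<longlonglongrightarrow> (1 / \<mu>) * 0" by (rule tendsto_mult_left)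
  then have "(\<lambda>k. (edge_avg (\<lambda>x. q (v k x)) \<sigma>)\<^sup>2) \<longlonglongrightarrow> 0" using \<mu> by (simp add: A_def)
  from tendsto_real_sqrt[OF this] show ?thesis by (simp add: tendsto_rabs_zero_iff)
qed

lemma edge_avg_mono:
  assumes s: "\<sigma> \<in> \<E>" and "continuous_on UNIV f" "continuous_on UNIV g" "\<And>x. f x \<le> g x"
  shows "edge_avg f \<sigma> \<le> edge_avg g \<sigma>"
proof -
  obtain a c where a: "in_hyperplane a c \<sigma>" "surface_measure \<sigma> = hyperplane_measure a c"
    "measure (hyperplane_measure a c) \<sigma> > 0"
    using face_area_pos_cases[OF edge_facts(1,2)[OF s]] .
  have "(LINT x:\<sigma>|hyperplane_measure a c. f x) \<le> (LINT x:\<sigma>|hyperplane_measure a c. g x)"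
    using assms by (intro set_integral_mono edge_integrable[OF s a(3)]) auto
  then show ?thesis unfolding edge_avg_def a(2)
    using edge_facts(2)[OF s] by (intro divide_right_mono) auto
qed

lemma edge_avg_affine:
  assumes s: "\<sigma> \<in> \<E>" and f: "continuous_on UNIV f"
  shows "edge_avg (\<lambda>x. c + r * f x) \<sigma> = c + r * edge_avg f \<sigma>"
proof -
  obtain a b where a: "in_hyperplane a b \<sigma>" "surface_measure \<sigma> = hyperplane_measure a b"
    "measure (hyperplane_measure a b) \<sigma> > 0"
    using face_area_pos_cases[OF edge_facts(1,2)[OF s]] .
  let ?\<mu> = "hyperplane_measure a b"
  have sm: "\<sigma> \<in> sets ?\<mu>" using a(3) measure_notin_sets by force
  have "emeasure ?\<mu> \<sigma> < \<infinity>" using a(3) by (simp add: measure_def enn2real_positive_iff)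
  then have "(LINT x:\<sigma>|?\<mu>. c) = measure ?\<mu> \<sigma> * c"
    using sm by (simp add: set_lebesgue_integral_def mult.commute)
  moreover have "(LINT x:\<sigma>|?\<mu>. c + r * f x) = (LINT x:\<sigma>|?\<mu>. c) + (LINT x:\<sigma>|?\<mu>. r * f x)"
    by (intro set_integral_add(2) edge_integrable[OF s a(3)] continuous_intros f)
  ultimately show ?thesis
    unfolding edge_avg_def face_area_def a(2) using a(3) by (simp add: add_divide_distrib)
qed

text \<open>The bounds are known almost everywhere inside \<Omega>, which is no statement about the
  boundary. But v is at least m minus its truncation max 0 (m - v), and the edge averages of the
  truncations tend to zero because the truncation of \<open>f\<close> vanishes almost everywhere
  inside; likewise for \<open>M\<close>.\<close>

lemma edge_avg_bounds:
  assumes s: "\<sigma> \<in> \<E>" "\<not> interior_edge \<M> \<sigma>" and approx: "smooth_approximation \<Omega> f v G"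
    and mM: "AE x in lebesgue. x \<in> \<Omega> \<longrightarrow> m \<le> f x \<and> f x \<le> M"
  shows "m \<le> edge_avg f \<sigma> \<and> edge_avg f \<sigma> \<le> M"
proof
  note v = smooth_approximationD(1,2)[OF approx] and tr = smooth_approximationD(3)[OF approx]
  have lim: "(\<lambda>k. edge_avg (v k) \<sigma>) \<longlonglongrightarrow> edge_avg f \<sigma>" by (rule edge_avg_tendsto[OF s v(1) tr])
  have cv: "continuous_on UNIV (v k)" for k by (rule smooth_funD(2)[OF v(1)])
  show "m \<le> edge_avg f \<sigma>"
  proof (rule LIMSEQ_le[OF tendsto_const])
    have "(\<lambda>k. edge_avg (\<lambda>x. max 0 (m - v k x)) \<sigma>) \<longlonglongrightarrow> 0"
      by (rule edge_avg_tendsto_zero[OF s(1) approx, where q = "\<lambda>s. max 0 (m - s)"]) (use mM in auto)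
    from tendsto_add[OF lim this]
    show "(\<lambda>k. edge_avg (v k) \<sigma> + edge_avg (\<lambda>x. max 0 (m - v k x)) \<sigma>) \<longlonglongrightarrow> edge_avg f \<sigma>" by simp
    have "m + (-1) * edge_avg (v k) \<sigma> \<le> edge_avg (\<lambda>x. max 0 (m - v k x)) \<sigma>" for k
      unfolding edge_avg_affine[OF s(1) cv, symmetric]
      by (rule edge_avg_mono[OF s(1)]) (auto intro!: continuous_intros cv)
    then have "m \<le> edge_avg (v k) \<sigma> + edge_avg (\<lambda>x. max 0 (m - v k x)) \<sigma>" for k
      by (simp add: algebra_simps)
    then show "\<exists>k0. \<forall>k\<ge>k0. m \<le> edge_avg (v k) \<sigma> + edge_avg (\<lambda>x. max 0 (m - v k x)) \<sigma>" by blast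
  qed
  show "edge_avg f \<sigma> \<le> M"
  proof (rule LIMSEQ_le[OF _ tendsto_const])
    have "(\<lambda>k. edge_avg (\<lambda>x. max 0 (v k x - M)) \<sigma>) \<longlonglongrightarrow> 0"
      by (rule edge_avg_tendsto_zero[OF s(1) approx, where q = "\<lambda>s. max 0 (s - M)"]) (use mM in auto)
    from tendsto_diff[OF lim this]
    show "(\<lambda>k. edge_avg (v k) \<sigma> - edge_avg (\<lambda>x. max 0 (v k x - M)) \<sigma>) \<longlonglongrightarrow> edge_avg f \<sigma>" by simp
    have "- M + 1 * edge_avg (v k) \<sigma> \<le> edge_avg (\<lambda>x. max 0 (v k x - M)) \<sigma>" for k
      unfolding edge_avg_affine[OF s(1) cv, symmetric]
      by (rule edge_avg_mono[OF s(1)]) (auto intro!: continuous_intros cv)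
    then have "edge_avg (v k) \<sigma> - edge_avg (\<lambda>x. max 0 (v k x - M)) \<sigma> \<le> M" for k
      by (simp add: algebra_simps)
    then show "\<exists>k0. \<forall>k\<ge>k0. edge_avg (v k) \<sigma> - edge_avg (\<lambda>x. max 0 (v k x - M)) \<sigma> \<le> M" by blast
  qed
qed

lemma sum_measure_cells_le: "(\<Sum>K\<in>\<T>. measure lebesgue K) \<le> measure lebesgue \<Omega>"
proof -
  have "(\<Sum>K\<in>\<T>. measure lebesgue K) = measure lebesgue (\<Union>K\<in>\<T>. K)"
    by (rule measure_finite_Union[symmetric])
      (use finite_cells cells_disjoint cell_measurable(2,3) in \<open>auto simp: disjoint_family_on_def less_top image_subset_iff\<close>)
  also have "\<dots> \<le> measure lebesgue \<Omega>"
  proof (rule measure_mono_fmeasurable)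
    show "\<Omega> \<in> lmeasurable" using bounded_\<Omega> open_\<Omega> by (rule lmeasurable_open)
    show "(\<Union>K\<in>\<T>. K) \<in> sets lebesgue"
      using finite_cells cell_measurable(2) by (intro sets.finite_UN) auto
  qed (use cellD(4) in auto)
  finally show ?thesis .
qed

end

section \<open>The entropy estimates\<close>

context regular_admissible_mesh
begin

lemma scheme_equations:
  assumes "scheme_solution \<M> \<Gamma>D \<Delta>t lam N0 P0 ND PD PsiD N P \<Psi>" "K \<in> \<T>"
  shows "measure lebesgue K * ((N (Suc n) K - N n K) / \<Delta>t)
      + (\<Sum>\<sigma>\<in>edges_of \<M> K. flux (with_bd ND (N (Suc n))) (with_bd PsiD (\<Psi> (Suc n))) K \<sigma>) = 0"
    "measure lebesgue K * ((P (Suc n) K - P n K) / \<Delta>t)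
      + (\<Sum>\<sigma>\<in>edges_of \<M> K. flux_P \<M> \<Gamma>D (with_bd PD (P (Suc n))) (with_bd PsiD (\<Psi> (Suc n))) K \<sigma>) = 0"
    "- (lam\<^sup>2) * (\<Sum>\<sigma>\<in>edges_of \<M> K. \<tau> \<sigma> * D (with_bd PsiD (\<Psi> n)) K \<sigma>)
      = measure lebesgue K * (P n K - N n K)"
  using assms unfolding scheme_solution_def by blast+

lemma scheme_bounds:
  assumes \<Delta>t: "\<Delta>t > 0" and m: "m > 0"
    and sol: "scheme_solution \<M> \<Gamma>D \<Delta>t lam N0 P0 ND PD PsiD N P \<Psi>"
    and init: "\<And>K. K \<in> \<T> \<Longrightarrow> m \<le> cell_avg N0 K \<and> cell_avg N0 K \<le> M"
      "\<And>K. K \<in> \<T> \<Longrightarrow> m \<le> cell_avg P0 K \<and> cell_avg P0 K \<le> M"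
    and bd: "\<And>\<sigma>. \<sigma> \<in> \<E> \<Longrightarrow> \<not> interior_edge \<M> \<sigma> \<Longrightarrow> m \<le> edge_avg ND \<sigma> \<and> edge_avg ND \<sigma> \<le> M"
      "\<And>\<sigma>. \<sigma> \<in> \<E> \<Longrightarrow> \<not> interior_edge \<M> \<sigma> \<Longrightarrow> m \<le> edge_avg PD \<sigma> \<and> edge_avg PD \<sigma> \<le> M"
    and K: "K \<in> \<T>"
  shows "m \<le> N n K \<and> N n K \<le> M \<and> m \<le> P n K \<and> P n K \<le> M"
  using K
proof (induction n arbitrary: K)
  case 0
  then have "N 0 K = cell_avg N0 K" "P 0 K = cell_avg P0 K"
    using sol unfolding scheme_solution_def by blast+
  then show ?case using init 0 by simp
next
  case (Suc n)
  show ?case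
    using maximum_principle[OF \<Delta>t m, of "N n" M "P n" "with_bd ND (N (Suc n))" "with_bd PD (P (Suc n))"
        "with_bd PsiD (\<Psi> (Suc n))" lam K] Suc.IH Suc.prems bd scheme_equations[OF sol]
    by simp
qed

text \<open>\<open>C\<close> is M/2 times the seminorms of the two reference vectors, each bounded
  by \<open>seminorm1_sq_ln\<close>. In the summed estimate the production carries the factor 1/2,
  so the initial entropy counts twice: its two density parts give 4 M^2 |\<Omega>| / m, its
  potential part \<lambda>^2 times \<open>SPsi\<close>. The final entropy is dropped, being
  nonnegative.\<close>

lemma entropy_production_estimates:
  assumes \<Delta>t: "\<Delta>t > 0" and m: "m > 0" and T: "T > 0"
    and sol: "scheme_solution \<M> \<Gamma>D \<Delta>t lam N0 P0 ND PD PsiD N P \<Psi>"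
    and init: "\<And>K. K \<in> \<T> \<Longrightarrow> m \<le> cell_avg N0 K \<and> cell_avg N0 K \<le> M"
      "\<And>K. K \<in> \<T> \<Longrightarrow> m \<le> cell_avg P0 K \<and> cell_avg P0 K \<le> M"
    and bd: "\<And>\<sigma>. \<sigma> \<in> \<E> \<Longrightarrow> \<not> interior_edge \<M> \<sigma> \<Longrightarrow> m \<le> edge_avg ND \<sigma> \<and> edge_avg ND \<sigma> \<le> M"
      "\<And>\<sigma>. \<sigma> \<in> \<E> \<Longrightarrow> \<not> interior_edge \<M> \<sigma> \<Longrightarrow> m \<le> edge_avg PD \<sigma> \<and> edge_avg PD \<sigma> \<le> M"
    and cell: "\<And>K. K \<in> \<T> \<Longrightarrow> m \<le> cell_avg ND K \<and> cell_avg ND K \<le> M"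
      "\<And>K. K \<in> \<T> \<Longrightarrow> m \<le> cell_avg PD K \<and> cell_avg PD K \<le> M"
    and S: "snorm (with_bd ND (cell_avg ND)) \<le> SN"
      "snorm (with_bd PD (cell_avg PD)) \<le> SP"
      "snorm (with_bd PsiD (cell_avg PsiD)) \<le> SPsi"
    and M: "M > 0"
  defines "C \<equiv> M / 2 * (2 / m\<^sup>2 * (SN + SP) + 4 * SPsi)"
  defines "E n \<equiv> entropy \<M> \<Gamma>D lam ND PD PsiD (N n) (P n) (\<Psi> n)"
    and "I n \<equiv> entropy_production \<M> \<Gamma>D ND PD PsiD (N n) (P n) (\<Psi> n)"
  shows "(E (Suc n) - E n) / \<Delta>t + 1 / 2 * I (Suc n) \<le> C"
    and "(\<And>K. K \<in> \<T> \<Longrightarrow> cell_avg N0 K = cell_avg P0 K) \<Longrightarrow>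
      (\<Sum>n<nat \<lfloor>T / \<Delta>t\<rfloor>. \<Delta>t * I (Suc n)) \<le> 2 * C * T + 4 * (M\<^sup>2 / m * measure lebesgue \<Omega>) + lam\<^sup>2 * SPsi"
proof -
  have b: "m \<le> N n K \<and> N n K \<le> M \<and> m \<le> P n K \<and> P n K \<le> M" if "K \<in> \<T>" for n K
    by (rule scheme_bounds[OF \<Delta>t m sol init bd that])
  note eqs = scheme_equations[OF sol]
  let ?SD = "with_bd PsiD (cell_avg PsiD)"
  let ?vN = "dmap2 (\<lambda>s t. ln s - t) (with_bd ND (cell_avg ND)) ?SD"
  let ?vP = "dmap2 (\<lambda>s t. ln s + t) (with_bd PD (cell_avg PD)) ?SD"
  have "snorm ?vN \<le> 2 / m\<^sup>2 * snorm (with_bd ND (cell_avg ND)) + 2 * snorm ?SD"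
    by (rule seminorm1_sq_ln[where g = "\<lambda>s t. s - t"]) (use m cell bd in auto)
  also have "\<dots> \<le> 2 / m\<^sup>2 * SN + 2 * SPsi" using S m by (intro add_mono mult_left_mono) auto
  finally have vN: "snorm ?vN \<le> 2 / m\<^sup>2 * SN + 2 * SPsi" .
  have "snorm ?vP \<le> 2 / m\<^sup>2 * snorm (with_bd PD (cell_avg PD)) + 2 * snorm ?SD"
    by (rule seminorm1_sq_ln[where g = "\<lambda>s t. s + t"]) (use m cell bd in auto)
  also have "\<dots> \<le> 2 / m\<^sup>2 * SP + 2 * SPsi" using S m by (intro add_mono mult_left_mono) auto
  finally have vP: "snorm ?vP \<le> 2 / m\<^sup>2 * SP + 2 * SPsi" .
  have step: "(E (Suc n) - E n) / \<Delta>t + 1 / 2 * I (Suc n) \<le> C" for n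
  proof -
    have "(E (Suc n) - E n) / \<Delta>t + 1 / 2 * I (Suc n)
        \<le> M / 2 * (snorm ?vN + snorm ?vP)"
      unfolding E_def I_def
    proof (rule entropy_step[OF \<Delta>t _ _ _ eqs eqs(3)])
      show "0 < N n K \<and> 0 < P n K" if "K \<in> \<T>" for K using b[OF that, of n] m by linarith
      show "0 < N (Suc n) K \<and> N (Suc n) K \<le> M \<and> 0 < P (Suc n) K \<and> P (Suc n) K \<le> M"
        if "K \<in> \<T>" for K using b[OF that, of "Suc n"] m by linarith
      show "0 < edge_avg ND \<sigma> \<and> edge_avg ND \<sigma> \<le> M \<and> 0 < edge_avg PD \<sigma> \<and> edge_avg PD \<sigma> \<le> M"
        if "\<sigma> \<in> \<E>" "\<not> interior_edge \<M> \<sigma>" for \<sigma> using bd[OF that] m by linarith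
    qed
    also have "\<dots> \<le> M / 2 * ((2 / m\<^sup>2 * SN + 2 * SPsi) + (2 / m\<^sup>2 * SP + 2 * SPsi))"
      using M by (intro mult_left_mono add_mono vN vP) auto
    also have "\<dots> = C" unfolding C_def by (simp add: algebra_simps add_divide_distrib)
    finally show ?thesis .
  qed
  then show "(E (Suc n) - E n) / \<Delta>t + 1 / 2 * I (Suc n) \<le> C" .
  have S0: "0 \<le> SN" "0 \<le> SP" "0 \<le> SPsi" using S seminorm1_sq_nonneg order_trans by blast+
  then have C0: "0 \<le> C" using M unfolding C_def by simp
  assume neutral: "\<And>K. K \<in> \<T> \<Longrightarrow> cell_avg N0 K = cell_avg P0 K"
  let ?n = "nat \<lfloor>T / \<Delta>t\<rfloor>"
  have "\<Delta>t * I (Suc n) \<le> 2 * C * \<Delta>t + 2 * (E n - E (Suc n))" for n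
    using step[of n] \<Delta>t by (simp add: field_simps)
  then have "(\<Sum>n<?n. \<Delta>t * I (Suc n)) \<le> (\<Sum>n<?n. 2 * C * \<Delta>t + 2 * (E n - E (Suc n)))" by (rule sum_mono)
  also have "\<dots> = 2 * C * (real ?n * \<Delta>t) + 2 * (E 0 - E ?n)"
    using sum_lessThan_telescope'[of "\<lambda>n. 2 * E n" ?n] by (simp add: sum.distrib right_diff_distrib)
  also have "\<dots> \<le> 2 * C * T + 2 * E 0"
  proof -
    have "real ?n \<le> T / \<Delta>t" using T \<Delta>t by (intro of_nat_floor) simp
    then have "real ?n * \<Delta>t \<le> T" using \<Delta>t by (simp add: field_simps)
    then have "2 * C * (real ?n * \<Delta>t) \<le> 2 * C * T" using C0 by (intro mult_left_mono) auto
    moreover have "0 \<le> E ?n"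
      unfolding E_def entropy_def
      using rel_entropy_bounds(1)[OF m cell(1), of "N ?n"] rel_entropy_bounds(1)[OF m cell(2), of "P ?n"] b seminorm1_sq_nonneg
      by (intro add_nonneg_nonneg mult_nonneg_nonneg) auto
    ultimately show ?thesis by simp
  qed
  also have "E 0 \<le> M\<^sup>2 / m * measure lebesgue \<Omega> + M\<^sup>2 / m * measure lebesgue \<Omega> + lam\<^sup>2 / 2 * SPsi"
    unfolding E_def entropy_def
  proof (intro add_mono)
    have Om: "M\<^sup>2 / m * (\<Sum>K\<in>\<T>. measure lebesgue K) \<le> M\<^sup>2 / m * measure lebesgue \<Omega>"
      using m by (intro mult_left_mono sum_measure_cells_le) auto
    show "rel_entropy \<M> ND (N 0) \<le> M\<^sup>2 / m * measure lebesgue \<Omega>"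
      by (rule order_trans[OF rel_entropy_bounds(2)[OF m cell(1)] Om]) (use b in auto)
    show "rel_entropy \<M> PD (P 0) \<le> M\<^sup>2 / m * measure lebesgue \<Omega>"
      by (rule order_trans[OF rel_entropy_bounds(2)[OF m cell(2)] Om]) (use b in auto)
    show "lam\<^sup>2 / 2 * snorm (dmap2 (-) (with_bd PsiD (\<Psi> 0)) ?SD) \<le> lam\<^sup>2 / 2 * SPsi"
    \<comment> \<open>For \<lambda> = 0 the initial potential is not constrained, but its energy has
      the factor zero. Otherwise equality of the initial averages makes the potential discretely
      harmonic.\<close>
    proof (cases "lam = 0")
      case False
      have "(\<Sum>\<sigma>\<in>edges_of \<M> K. \<tau> \<sigma> * D (with_bd PsiD (\<Psi> 0)) K \<sigma>) = 0" if K: "K \<in> \<T>" for K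
      proof -
        have "N 0 K = P 0 K" using sol neutral[OF K] K unfolding scheme_solution_def by simp
        then show ?thesis using eqs(3)[OF K, of 0] False by simp
      qed
      then show ?thesis
        using order_trans[OF initial_potential S(3)] by (intro mult_left_mono) auto
    qed simp
  qed
  finally show "(\<Sum>n<?n. \<Delta>t * I (Suc n)) \<le> 2 * C * T + 4 * (M\<^sup>2 / m * measure lebesgue \<Omega>) + lam\<^sup>2 * SPsi"
    by (simp add: mult_ac)
qed

end

theorem theorem1p2:
  fixes \<Omega> :: "'a::euclidean_space set"
    and ND PD PsiD :: "'a \<Rightarrow> real"
    and T m M \<xi> \<beta> :: real
  assumes "T > 0" and "\<xi> > 0" and "\<beta> > 0"
  shows "\<exists>KE :: real.
    \<forall>(\<Gamma>D :: 'a set) (\<Gamma>N :: 'a set) (N0 :: 'a \<Rightarrow> real) (P0 :: 'a \<Rightarrow> real).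
      hypotheses_H \<Omega> \<Gamma>D \<Gamma>N N0 P0 ND PD PsiD m M \<longrightarrow>
      (\<forall>(\<M> :: 'a mesh) (\<Delta>t :: real) (lam :: real)
         (N :: nat \<Rightarrow> 'a set \<Rightarrow> real) (P :: nat \<Rightarrow> 'a set \<Rightarrow> real) (\<Psi> :: nat \<Rightarrow> 'a set \<Rightarrow> real).
        admissible_mesh \<Omega> \<Gamma>D \<Gamma>N \<M> \<longrightarrow> regular_mesh \<xi> \<beta> \<M> \<longrightarrow> \<Delta>t > 0 \<longrightarrow> lam \<ge> 0 \<longrightarrow>
        (lam = 0 \<longrightarrow> (AE x in lebesgue. x \<in> \<Omega> \<longrightarrow> P0 x - N0 x = 0)
               \<and> (AE x in lebesgue. x \<in> \<Omega> \<longrightarrow> PD x - ND x = 0)) \<longrightarrow>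
        scheme_solution \<M> \<Gamma>D \<Delta>t lam N0 P0 ND PD PsiD N P \<Psi> \<longrightarrow>
          (\<forall>n. (entropy \<M> \<Gamma>D lam ND PD PsiD (N (Suc n)) (P (Suc n)) (\<Psi> (Suc n))
                 - entropy \<M> \<Gamma>D lam ND PD PsiD (N n) (P n) (\<Psi> n)) / \<Delta>t
               + 1 / 2 * entropy_production \<M> \<Gamma>D ND PD PsiD (N (Suc n)) (P (Suc n)) (\<Psi> (Suc n))
             \<le> KE) \<and>
          ((AE x in lebesgue. x \<in> \<Omega> \<longrightarrow> P0 x - N0 x = 0) \<longrightarrow>
             (\<Sum>n<nat \<lfloor>T / \<Delta>t\<rfloor>. \<Delta>t *
                entropy_production \<M> \<Gamma>D ND PD PsiD (N (Suc n)) (P (Suc n)) (\<Psi> (Suc n)))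
             \<le> KE * (1 + lam\<^sup>2)))"
\<comment> \<open>The constant must precede \<Gamma>D, \<Gamma>N and the initial data. If no choice
  of them fulfils the hypotheses there is nothing to show; otherwise any one choice provides the
  traces, which do not refer to it.\<close>
proof (cases "\<exists>\<Gamma>D \<Gamma>N N0 P0. hypotheses_H \<Omega> \<Gamma>D \<Gamma>N N0 P0 ND PD PsiD m M")
  case False
  then show ?thesis by blast
next
  case True
  then have H: "open \<Omega>" "bounded \<Omega>" "m > 0" "M > 0" "has_trace \<Omega> ND ND" "has_trace \<Omega> PD PD" "has_trace \<Omega> PsiD PsiD"
    unfolding hypotheses_H_def by auto
  obtain vN GN where vN: "smooth_approximation \<Omega> ND vN GN"
    using has_trace_approximation[OF H(5,1)] by blast
  obtain vP GP where vP: "smooth_approximation \<Omega> PD vP GP"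
    using has_trace_approximation[OF H(6,1)] by blast
  obtain vS GS where vS: "smooth_approximation \<Omega> PsiD vS GS"
    using has_trace_approximation[OF H(7,1)] by blast
  note G = smooth_approximationD(4)[OF vN] smooth_approximationD(4)[OF vP] smooth_approximationD(4)[OF vS]
  define c where "c = 10 * 4 ^ DIM('a) / \<xi>\<^sup>2 * \<beta>"
  define C where "C = M / 2 * (2 / m\<^sup>2 * (c * GN + c * GP) + 4 * (c * GS))"
  \<comment> \<open>All summands are nonnegative, so the sum dominates \<open>C\<close>, the part of
    the summed estimate that is free of \<lambda>, and the coefficient \<open>c * GS\<close> of
    \<lambda>^2.\<close>
  define KE where "KE = C + 2 * C * T + 4 * (M\<^sup>2 / m * measure lebesgue \<Omega>) + c * GS"
  have c: "0 \<le> c" using assms by (simp add: c_def)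
  then have C: "0 \<le> C" using H G by (simp add: C_def)
  have nn: "0 \<le> C * T" "0 \<le> M\<^sup>2 / m * measure lebesgue \<Omega>" "0 \<le> c * GS"
    using C c H assms G by simp_all
  show ?thesis
  proof (intro exI[of _ KE] allI impI)
    fix \<Gamma>D \<Gamma>N :: "'a set" and N0 P0 :: "'a \<Rightarrow> real" and \<M> :: "'a mesh" and \<Delta>t lam :: real
      and N P \<Psi> :: "nat \<Rightarrow> 'a set \<Rightarrow> real"
    assume hyp: "hypotheses_H \<Omega> \<Gamma>D \<Gamma>N N0 P0 ND PD PsiD m M"
      and mesh: "admissible_mesh \<Omega> \<Gamma>D \<Gamma>N \<M>" "regular_mesh \<xi> \<beta> \<M>" and \<Delta>t: "\<Delta>t > 0" and lam: "lam \<ge> 0"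
      and sol: "scheme_solution \<M> \<Gamma>D \<Delta>t lam N0 P0 ND PD PsiD N P \<Psi>"
    interpret regular_admissible_mesh \<Omega> \<Gamma>D \<Gamma>N \<M> \<xi> \<beta>
      by unfold_locales (use mesh H assms in auto)
    have meas: "set_borel_measurable lebesgue \<Omega> N0" "set_borel_measurable lebesgue \<Omega> P0"
      "set_borel_measurable lebesgue \<Omega> ND" "set_borel_measurable lebesgue \<Omega> PD"
      using hyp unfolding hypotheses_H_def Linf_on_def by blast+
    have AE: "AE x in lebesgue. x \<in> \<Omega> \<longrightarrow> m \<le> N0 x \<and> N0 x \<le> M" "AE x in lebesgue. x \<in> \<Omega> \<longrightarrow> m \<le> P0 x \<and> P0 x \<le> M"
      "AE x in lebesgue. x \<in> \<Omega> \<longrightarrow> m \<le> ND x \<and> ND x \<le> M" "AE x in lebesgue. x \<in> \<Omega> \<longrightarrow> m \<le> PD x \<and> PD x \<le> M"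
      using hyp unfolding hypotheses_H_def by blast+
    note S = seminorm1_sq_trace_le[OF vN less_imp_le[OF assms(3)]] seminorm1_sq_trace_le[OF vP less_imp_le[OF assms(3)]]
      seminorm1_sq_trace_le[OF vS less_imp_le[OF assms(3)]]
    note est = entropy_production_estimates[OF \<Delta>t H(3) assms(1) sol
        cell_avg_bounds[OF _ meas(1) AE(1)] cell_avg_bounds[OF _ meas(2) AE(2)]
        edge_avg_bounds[OF _ _ vN AE(3)] edge_avg_bounds[OF _ _ vP AE(4)]
        cell_avg_bounds[OF _ meas(3) AE(3)] cell_avg_bounds[OF _ meas(4) AE(4)] S H(4), folded c_def C_def]
    let ?E = "\<lambda>n. entropy \<M> \<Gamma>D lam ND PD PsiD (N n) (P n) (\<Psi> n)"
    let ?I = "\<lambda>n. entropy_production \<M> \<Gamma>D ND PD PsiD (N n) (P n) (\<Psi> n)"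
    show "(\<forall>n. (?E (Suc n) - ?E n) / \<Delta>t + 1 / 2 * ?I (Suc n) \<le> KE) \<and>
      ((AE x in lebesgue. x \<in> \<Omega> \<longrightarrow> P0 x - N0 x = 0) \<longrightarrow>
        (\<Sum>n<nat \<lfloor>T / \<Delta>t\<rfloor>. \<Delta>t * ?I (Suc n)) \<le> KE * (1 + lam\<^sup>2))"
    proof (intro conjI allI impI)
      fix n
      have "C \<le> KE" using nn unfolding KE_def by linarith
      then show "(?E (Suc n) - ?E n) / \<Delta>t + 1 / 2 * ?I (Suc n) \<le> KE"
        using est(1)[of n] by linarith
    next
      assume neutral: "AE x in lebesgue. x \<in> \<Omega> \<longrightarrow> P0 x - N0 x = 0"
      have "(\<Sum>n<nat \<lfloor>T / \<Delta>t\<rfloor>. \<Delta>t * ?I (Suc n))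
        \<le> 2 * C * T + 4 * (M\<^sup>2 / m * measure lebesgue \<Omega>) + lam\<^sup>2 * (c * GS)"
        by (rule est(2)) (auto intro: cell_avg_cong[OF _ meas(1,2) neutral])
      also have "\<dots> \<le> KE + lam\<^sup>2 * KE"
      proof (intro add_mono mult_left_mono)
        show "2 * C * T + 4 * (M\<^sup>2 / m * measure lebesgue \<Omega>) \<le> KE" using C nn unfolding KE_def by linarith
        show "c * GS \<le> KE" using C nn unfolding KE_def by linarith
      qed simp
      finally show "(\<Sum>n<nat \<lfloor>T / \<Delta>t\<rfloor>. \<Delta>t * ?I (Suc n)) \<le> KE * (1 + lam\<^sup>2)" by (simp add: algebra_simps)
    qed
  qed
qed

end
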